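(* Let $(\Omega,\Sigma,\mu)$ be a non-atomic $\sigma$-finite complete measure space. Let $p$ be a measurable function on $\Omega$ with $1\le p(t)\le\infty$, and let $q$ be given by $1/p(t)+1/q(t)=1$ for $\mu$-a.a. $t\in\Omega$, with the usual convention that $q(t)=\infty$ if $p(t)=1$ (and $q(t)=1$ if $p(t)=\infty$). Let $\Omega_\infty=\{t\in\Omega:p(t)=\infty\}$. The following statements are equivalent. (i) $L_{p(t)}$ has the Daugavet property. (ii) $L_{p(t)}=L_1$, or $L_{p(t)}=L_\infty$, or $L_{p(t)}=L_1(\Omega\setminus\Omega_\infty)\oplus_\infty L_\infty(\Omega_\infty)$. (iii) $L_{q(t)}^o=L_\infty$, or $L_{q(t)}^o=L_1$, or $L_{q(t)}^o=L_\infty(\Omega\setminus\Omega_\infty)\oplus_1L_1(\Omega_\infty)$. (iv) $L_{q(t)}^o$ has the Daugavet property.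
   Context: All Banach spaces are real. A Banach space $X$ has the Daugavet property if $\|I+T\|=1+\|T\|$ for every rank one bounded linear operator $T:X\to X$. $L_0$ is the set of ($\mu$-a.e. equivalence classes of) measurable extended-real valued functions on $\Omega$. Let $\alpha(u)=0$ for $0\le u\le1$ and $\alpha(u)=\infty$ for $u>1$. The Nakano (variable exponent Lebesgue) space $L_{p(t)}$ is defined by $M(t,u)=u^{p(t)}/p(t)$ if $p(t)<\infty$ and $M(t,u)=\alpha(u)$ if $p(t)=\infty$: with $\rho_M(x)=\int_\Omega M(t,|x(t)|)\,d\mu$, $L_{p(t)}=\{x\in L_0:\rho_M(\lambda x)<\infty\text{ for some }\lambda>0\}$ with the Luxemburg norm $\|x\|=\inf\{\lambda>0:\rho_M(x/\lambda)\le1\}$. The space $L_{q(t)}^o$ is the Nakano space of the exponent $q$ (i.e. generated in the same way by $N(t,u)=u^{q(t)}/q(t)$ if $q(t)<\infty$, $N(t,u)=\alpha(u)$ if $q(t)=\infty$, which is the function complementary to $M$), with the Orlicz norm $\|x\|^o=\sup\{\int_\Omega|xy|\,d\mu:\rho_M(y)\le1\}$. $X\oplus_1Y$ and $X\oplus_\infty Y$ are the direct sums with norms $\|x\|_X+\|y\|_Y$ and $\max\{\|x\|_X,\|y\|_Y\}$. Equalities of spaces mean equality as sets of functions with equality of norms; for the direct sums a function $x$ is identified with the pair of its restrictions to $\Omega\setminus\Omega_\infty$ and $\Omega_\infty$. *)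

theory Defs
  imports "HOL-Probability.Essential_Supremum"
begin

section \<open>Normed spaces with an explicit carrier and the Daugavet property\<close>

text \<open>The spaces below depend on a measure and an exponent, so they cannot be types of class
  real_normed_vector; they are real normed spaces given by an explicit carrier.\<close>

record 'v nspace =
  elems :: "'v set"
  zer   :: 'v
  add   :: "'v \<Rightarrow> 'v \<Rightarrow> 'v"
  scl   :: "real \<Rightarrow> 'v \<Rightarrow> 'v"
  nrm   :: "'v \<Rightarrow> real"

definition bounded_operator :: "'v nspace \<Rightarrow> ('v \<Rightarrow> 'v) \<Rightarrow> bool" where
  "bounded_operator X T \<longleftrightarrow>
     (\<forall>x\<in>elems X. T x \<in> elems X) \<and>
     (\<forall>x\<in>elems X. \<forall>y\<in>elems X. T (add X x y) = add X (T x) (T y)) \<and>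
     (\<forall>c. \<forall>x\<in>elems X. T (scl X c x) = scl X c (T x)) \<and>
     (\<exists>C. \<forall>x\<in>elems X. nrm X (T x) \<le> C * nrm X x)"

definition rank_one :: "'v nspace \<Rightarrow> ('v \<Rightarrow> 'v) \<Rightarrow> bool" where
  "rank_one X T \<longleftrightarrow>
     (\<exists>y\<in>elems X. y \<noteq> zer X \<and> T ` elems X = {scl X c y | c. True})"

definition op_norm :: "'v nspace \<Rightarrow> ('v \<Rightarrow> 'v) \<Rightarrow> real" where
  "op_norm X T = (SUP x\<in>{x \<in> elems X. nrm X x \<le> 1}. nrm X (T x))"

definition daugavet :: "'v nspace \<Rightarrow> bool" where
  "daugavet X \<longleftrightarrow>
     (\<forall>T. bounded_operator X T \<and> rank_one X T \<longrightarrow>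
        op_norm X (\<lambda>x. add X x (T x)) = 1 + op_norm X T)"

definition direct_sum ::
  "(real \<Rightarrow> real \<Rightarrow> real) \<Rightarrow> 'v nspace \<Rightarrow> 'w nspace \<Rightarrow> ('v \<times> 'w) nspace" where
  "direct_sum h X Y =
     \<lparr> elems = elems X \<times> elems Y,
       zer = (zer X, zer Y),
       add = (\<lambda>a b. (add X (fst a) (fst b), add Y (snd a) (snd b))),
       scl = (\<lambda>c a. (scl X c (fst a), scl Y c (snd a))),
       nrm = (\<lambda>a. h (nrm X (fst a)) (nrm Y (snd a))) \<rparr>"

definition sum_one :: "'v nspace \<Rightarrow> 'w nspace \<Rightarrow> ('v \<times> 'w) nspace" where
  "sum_one X Y = direct_sum (+) X Y"

definition sum_inf :: "'v nspace \<Rightarrow> 'w nspace \<Rightarrow> ('v \<times> 'w) nspace" where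
  "sum_inf X Y = direct_sum max X Y"

text \<open>Equality of spaces of functions, after identifying the elements of the first with
  those of the second by j. (The linear operations of all spaces below are induced by the
  pointwise ones, so only carriers and norms need to be compared.)\<close>

definition equal_via :: "('v \<Rightarrow> 'w) \<Rightarrow> 'v nspace \<Rightarrow> 'w nspace \<Rightarrow> bool" where
  "equal_via j X Y \<longleftrightarrow>
     bij_betw j (elems X) (elems Y) \<and> (\<forall>x\<in>elems X. nrm Y (j x) = nrm X x)"

definition equal_spaces :: "'v nspace \<Rightarrow> 'v nspace \<Rightarrow> bool" where
  "equal_spaces X Y \<longleftrightarrow> elems X = elems Y \<and> (\<forall>x\<in>elems X. nrm X x = nrm Y x)"


section \<open>Spaces of classes of measurable functions\<close>

definition non_atomic :: "'a measure \<Rightarrow> bool" where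
  "non_atomic M \<longleftrightarrow>
     (\<forall>A\<in>sets M. 0 < emeasure M A \<longrightarrow>
        (\<exists>B\<in>sets M. B \<subseteq> A \<and> 0 < emeasure M B \<and> emeasure M B < emeasure M A))"

definition ae_rel :: "'a measure \<Rightarrow> (('a \<Rightarrow> ereal) \<times> ('a \<Rightarrow> ereal)) set" where
  "ae_rel M = {(f, g). f \<in> borel_measurable M \<and> g \<in> borel_measurable M \<and> (AE t in M. f t = g t)}"

definition ae_class :: "'a measure \<Rightarrow> ('a \<Rightarrow> ereal) \<Rightarrow> ('a \<Rightarrow> ereal) set" where
  "ae_class M f = ae_rel M `` {f}"

definition rep :: "('a \<Rightarrow> ereal) set \<Rightarrow> 'a \<Rightarrow> ereal" where
  "rep F = (SOME f. f \<in> F)"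

text \<open>The normed space of the classes of the functions in K, with norm N. Operations and norm
  act on chosen representatives; for the sets K and functionals N used below nothing depends on
  the choice. Functions in those sets K are finite almost everywhere, so the value that HOL
  assigns to the sum of opposite infinities plays no role.\<close>

definition fun_space ::
  "'a measure \<Rightarrow> ('a \<Rightarrow> ereal) set \<Rightarrow> (('a \<Rightarrow> ereal) \<Rightarrow> real) \<Rightarrow> ('a \<Rightarrow> ereal) set nspace" where
  "fun_space M K N =
     \<lparr> elems = ae_class M ` K,
       zer = ae_class M (\<lambda>t. 0),
       add = (\<lambda>F G. ae_class M (\<lambda>t. rep F t + rep G t)),
       scl = (\<lambda>c F. ae_class M (\<lambda>t. ereal c * rep F t)),
       nrm = (\<lambda>F. N (rep F)) \<rparr>"

definition L1_space :: "'a measure \<Rightarrow> ('a \<Rightarrow> ereal) set nspace" where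
  "L1_space M = fun_space M
     {f \<in> borel_measurable M. (\<integral>\<^sup>+t. e2ennreal \<bar>f t\<bar> \<partial>M) < \<infinity>}
     (\<lambda>f. enn2real (\<integral>\<^sup>+t. e2ennreal \<bar>f t\<bar> \<partial>M))"

definition Linf_space :: "'a measure \<Rightarrow> ('a \<Rightarrow> ereal) set nspace" where
  "Linf_space M = fun_space M
     {f \<in> borel_measurable M. esssup M (\<lambda>t. e2ennreal \<bar>f t\<bar>) < \<infinity>}
     (\<lambda>f. enn2real (esssup M (\<lambda>t. e2ennreal \<bar>f t\<bar>)))"

text \<open>The identification of (the class of) a function with the pair of (the classes of) its
  restrictions to the complement of A and to A. A function on a restricted space is
  represented by a function on the whole type; its values off the restricted space are
  irrelevant, both for measurability and for almost everywhere equality.\<close>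

definition restr_pair ::
  "'a measure \<Rightarrow> 'a set \<Rightarrow> ('a \<Rightarrow> ereal) set \<Rightarrow> ('a \<Rightarrow> ereal) set \<times> ('a \<Rightarrow> ereal) set" where
  "restr_pair M A F =
     (ae_class (restrict_space M (space M - A)) (rep F), ae_class (restrict_space M A) (rep F))"


section \<open>Nakano spaces\<close>

definition modular ::
  "'a measure \<Rightarrow> ('a \<Rightarrow> ennreal \<Rightarrow> ennreal) \<Rightarrow> ('a \<Rightarrow> ereal) \<Rightarrow> ennreal" where
  "modular M \<Phi> f = (\<integral>\<^sup>+t. \<Phi> t (e2ennreal \<bar>f t\<bar>) \<partial>M)"

definition modular_funs ::
  "'a measure \<Rightarrow> ('a \<Rightarrow> ennreal \<Rightarrow> ennreal) \<Rightarrow> ('a \<Rightarrow> ereal) set" where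
  "modular_funs M \<Phi> =
     {f \<in> borel_measurable M. \<exists>c::real. c > 0 \<and> modular M \<Phi> (\<lambda>t. ereal c * f t) < \<infinity>}"

definition luxemburg_norm ::
  "'a measure \<Rightarrow> ('a \<Rightarrow> ennreal \<Rightarrow> ennreal) \<Rightarrow> ('a \<Rightarrow> ereal) \<Rightarrow> real" where
  "luxemburg_norm M \<Phi> f = Inf {c::real. c > 0 \<and> modular M \<Phi> (\<lambda>t. f t / ereal c) \<le> 1}"

text \<open>The Orlicz norm on the space generated by the function complementary to \<open>\<Phi>\<close>.
  The supremum is finite on that space.\<close>

definition orlicz_norm ::
  "'a measure \<Rightarrow> ('a \<Rightarrow> ennreal \<Rightarrow> ennreal) \<Rightarrow> ('a \<Rightarrow> ereal) \<Rightarrow> real" where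
  "orlicz_norm M \<Phi> f = enn2real
     (SUP g\<in>{g \<in> borel_measurable M. modular M \<Phi> g \<le> 1}. \<integral>\<^sup>+t. e2ennreal \<bar>f t * g t\<bar> \<partial>M)"

definition nakano :: "('a \<Rightarrow> ennreal) \<Rightarrow> 'a \<Rightarrow> ennreal \<Rightarrow> ennreal" where
  "nakano p t u =
     (if p t = \<infinity> then (if u \<le> 1 then 0 else \<infinity>)
      else if u = \<infinity> then \<infinity>
      else ennreal (enn2real u powr enn2real (p t) / enn2real (p t)))"

definition nakano_space :: "'a measure \<Rightarrow> ('a \<Rightarrow> ennreal) \<Rightarrow> ('a \<Rightarrow> ereal) set nspace" where
  "nakano_space M p = fun_space M (modular_funs M (nakano p)) (luxemburg_norm M (nakano p))"

text \<open>The Nakano space of the exponent q with the Orlicz norm; p is the conjugate exponent,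
  whose modular enters the norm.\<close>

definition nakano_orlicz_space ::
  "'a measure \<Rightarrow> ('a \<Rightarrow> ennreal) \<Rightarrow> ('a \<Rightarrow> ennreal) \<Rightarrow> ('a \<Rightarrow> ereal) set nspace" where
  "nakano_orlicz_space M q p =
     fun_space M (modular_funs M (nakano q)) (orlicz_norm M (nakano p))"

end

theory Submission
  imports Defs
begin

text \<open>All four statements are equivalent to one condition on the exponent: almost everywhere
  \<open>p\<close> is either 1 or infinite.

  Suppose that this holds. The modular of \<open>x\<close> is then the integral of \<open>|x|\<close> over the part where
  \<open>p\<close> is 1, with the constraint \<open>|x| \<le> 1\<close> on the part where \<open>p\<close> is infinite. Hence the Luxemburg
  norm is the maximum of an integral and an essential supremum over complementary parts, and the
  Orlicz norm is the sum of an essential supremum and an integral, with the parts exchanged; these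
  are the direct sums of the identification. For the Daugavet property, a rank one
  operator has the form \<open>x \<mapsto> L x y\<close> with a bounded functional \<open>L\<close>, and it suffices to move a unit
  vector \<open>x\<close>, almost without lowering \<open>L x\<close>, to a position where its norm and that of a given \<open>z\<close>
  add up (\<open>daugavet_criterion\<close>). On the integral part \<open>x\<close> is concentrated on a set that carries
  almost nothing of \<open>z\<close>; additivity and averaging show that some small set does not lower \<open>L\<close>
  (\<open>concentrate_L1_part\<close>). On the supremum part \<open>x\<close> receives the largest admissible modulus and
  the sign of \<open>z\<close> on a small set where \<open>|z|\<close> is almost maximal; a bounded additive set function on
  a non-atomic measure cannot be large on all of its positive subsets, so \<open>L\<close> hardly notices
  (\<open>modify_Linf_part\<close>). No representation of \<open>L\<close> is needed, which matters because of the singular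
  functionals on the supremum part.

  Suppose that the condition fails. Then \<open>1 < a \<le> p \<le> b\<close> on a set \<open>C\<close> of finite positive measure,
  and the modular is uniformly convex there. Let \<open>y\<close> be supported by \<open>C\<close> with modular one and let
  \<open>\<phi>\<close> be its dual function in Young's inequality. A function \<open>g\<close> of modular at most one with
  \<open>\<integral> \<phi> g\<close> close to one almost gives equality in Young's inequality, so it is close to \<open>y\<close> on \<open>C\<close>.
  Therefore \<open>g - (\<integral> \<phi> g) y\<close> has norm at most \<open>2 - d\<close> for every such \<open>g\<close> (\<open>convexity_gap\<close>), and
  the operator \<open>g \<mapsto> - (\<integral> \<phi> g) y\<close> of norm one violates the Daugavet property. The same bound holds
  for the adjoint \<open>f \<mapsto> f - (\<integral> f y) \<phi>\<close> in the Orlicz norm, by Hoelder's inequality, so the second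
  space fails as well. Finally each identification would force the indicator function of a set
  \<open>E \<subseteq> C\<close> to have norm 1 or \<open>\<mu>(E)\<close>, and for small \<open>E\<close> neither norm takes these values
  (\<open>indicator_norms\<close>).\<close>

section \<open>Non-atomic measures\<close>

lemma non_atomic_split:
  assumes "non_atomic M" "A \<in> sets M" "0 < emeasure M A"
  obtains B where "B \<in> sets M" "B \<subseteq> A" "0 < emeasure M B" "0 < emeasure M (A - B)"
proof -
  obtain B where B: "B \<in> sets M" "B \<subseteq> A" "0 < emeasure M B" "emeasure M B < emeasure M A"
    using assms unfolding non_atomic_def by blast
  have "emeasure M B \<noteq> \<infinity>" using B(4) by auto
  then have "emeasure M (A - B) = emeasure M A - emeasure M B"
    using B assms(2) by (intro emeasure_Diff) auto
  then have "0 < emeasure M (A - B)" using B(4)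
    by (metis diff_gt_0_iff_gt_ennreal)
  then show thesis using that B by blast
qed

text \<open>Where the density is positive the two measures have the same null sets, so a proper part for
  one is a proper part for the other; finiteness of the total mass turns two positive pieces into
  a strictly smaller one.\<close>

lemma non_atomic_density:
  assumes na: "non_atomic M" and h [measurable]: "h \<in> borel_measurable M"
    and fin: "(\<integral>\<^sup>+t. h t \<partial>M) < \<infinity>"
  shows "non_atomic (density M h)"
  unfolding non_atomic_def
proof (intro ballI impI)
  fix A assume "A \<in> sets (density M h)" and pos: "0 < emeasure (density M h) A"
  then have A [measurable]: "A \<in> sets M" by simp
  have pos_iff: "0 < emeasure (density M h) E \<longleftrightarrow> 0 < emeasure M E"
    if "E \<subseteq> A \<inter> {t \<in> space M. 0 < h t}" "E \<in> sets M" for E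
  proof -
    have "emeasure (density M h) E = (\<integral>\<^sup>+t. h t * indicator E t \<partial>M)"
      using that by (simp add: emeasure_density)
    also have "\<dots> = 0 \<longleftrightarrow> (AE t in M. h t * indicator E t = 0)"
      using that by (subst nn_integral_0_iff_AE) auto
    also have "\<dots> \<longleftrightarrow> (AE t in M. t \<notin> E)"
      using that by (intro AE_cong) (auto split: split_indicator)
    also have "\<dots> \<longleftrightarrow> emeasure M E = 0"
      using that by (metis AE_iff_null_sets null_setsD1 null_setsI)
    finally show ?thesis by (metis not_gr_zero)
  qed
  define A' where "A' = A \<inter> {t \<in> space M. 0 < h t}"
  have A' [measurable]: "A' \<in> sets M" unfolding A'_def by measurable
  have same: "emeasure (density M h) A = emeasure (density M h) A'"
    by (auto simp: emeasure_density A'_def intro!: nn_integral_cong split: split_indicator)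
  then have "0 < emeasure M A'" using pos pos_iff[of A'] by (auto simp: A'_def)
  from non_atomic_split[OF na A' this] obtain B where
    B: "B \<in> sets M" "B \<subseteq> A'" "0 < emeasure M B" "0 < emeasure M (A' - B)" .
  have B1: "0 < emeasure (density M h) B" "0 < emeasure (density M h) (A' - B)"
    using B pos_iff[of B] pos_iff[of "A' - B"] unfolding A'_def by auto
  have sum: "emeasure (density M h) A' = emeasure (density M h) B + emeasure (density M h) (A' - B)"
    using B by (subst plus_emeasure) (auto simp: Un_absorb1)
  have "emeasure (density M h) B \<le> (\<integral>\<^sup>+t. h t \<partial>M)"
    using B by (auto simp: emeasure_density intro!: nn_integral_mono split: split_indicator)
  then have "emeasure (density M h) B \<noteq> \<infinity>" using fin by (auto simp: top_unique)
  then have "emeasure (density M h) B < emeasure (density M h) A"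
    unfolding same sum using B1 by (metis add.right_neutral ennreal_add_left_cancel_less infinity_ennreal_def)
  then show "\<exists>B\<in>sets (density M h). B \<subseteq> A \<and> 0 < emeasure (density M h) B \<and>
      emeasure (density M h) B < emeasure (density M h) A"
    using B B1 by (auto simp: A'_def intro!: bexI[of _ B])
qed

text \<open>Otherwise the positive measures of subsets have a positive infimum, and a set of less than
  twice that measure could not be split into two positive pieces.\<close>

lemma non_atomic_small_subset:
  assumes na: "non_atomic M" and "finite_measure M" and A: "A \<in> sets M" "0 < measure M A"
    and e: "0 < (e::real)"
  obtains B where "B \<in> sets M" "B \<subseteq> A" "0 < measure M B" "measure M B < e"
proof -
  interpret finite_measure M by fact
  define S where "S = measure M ` {B \<in> sets M. B \<subseteq> A \<and> 0 < measure M B}"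
  have ne: "S \<noteq> {}" and bdd: "bdd_below S" using A by (auto simp: S_def intro!: bdd_belowI[of _ 0])
  have "Inf S \<le> 0"
  proof (rule ccontr)
    assume pos: "\<not> Inf S \<le> 0"
    then obtain s where "s \<in> S" "s < 2 * Inf S"
      using cInf_lessD[OF ne, of "2 * Inf S"] by auto
    then obtain B where B: "B \<in> sets M" "B \<subseteq> A" "0 < measure M B" "measure M B < 2 * Inf S"
      by (auto simp: S_def)
    obtain C where C: "C \<in> sets M" "C \<subseteq> B" "0 < emeasure M C" "0 < emeasure M (B - C)"
      using non_atomic_split[OF na B(1)] B(3) by (auto simp: emeasure_eq_measure)
    have "measure M C \<in> S" "measure M (B - C) \<in> S"
      using B C by (auto simp: S_def emeasure_eq_measure)
    then have "Inf S \<le> measure M C" "Inf S \<le> measure M (B - C)"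
      using bdd by (auto intro: cInf_lower)
    moreover have "measure M B = measure M C + measure M (B - C)"
      using B C by (simp add: finite_measure_Diff)
    ultimately show False using B(4) by simp
  qed
  then obtain s where "s \<in> S" "s < e" using cInf_lessD[OF ne, of e] e by auto
  then show thesis using that by (auto simp: S_def)
qed

text \<open>A weak form of Sierpinski's theorem. If no subset has between one and two thirds of the
  measure, then the subsets below one third are closed under unions; a maximal one is obtained as
  a countable union, and it can still be enlarged by a small piece of its complement.\<close>

lemma non_atomic_balanced_split:
  assumes na: "non_atomic M" and "finite_measure M" and A: "A \<in> sets M"
  obtains B where "B \<in> sets M" "B \<subseteq> A" "3 * measure M B \<le> 2 * measure M A"
    "3 * measure M (A - B) \<le> 2 * measure M A"
proof (cases "measure M A = 0")
  case True
  then show ?thesis using that[of A] A by simp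
next
  case False
  interpret finite_measure M by fact
  define a where "a = measure M A / 3"
  have a: "0 < a" using False by (simp add: a_def zero_less_measure_iff)
  note res = that
  show ?thesis
  proof (rule ccontr)
    assume no: "\<not> thesis"
    have dich: "measure M B < a \<or> 2 * a < measure M B" if "B \<in> sets M" "B \<subseteq> A" for B
    proof (rule ccontr)
      assume "\<not> ?thesis"
      moreover have "measure M (A - B) = measure M A - measure M B"
        using that A by (simp add: finite_measure_Diff)
      ultimately have "3 * measure M B \<le> 2 * measure M A" "3 * measure M (A - B) \<le> 2 * measure M A"
        by (auto simp: a_def)
      then show False using no res[OF that] by blast
    qed
    define G where "G = {B \<in> sets M. B \<subseteq> A \<and> measure M B < a}"
    have un: "B \<union> C \<in> G" if "B \<in> G" "C \<in> G" for B C
    proof -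
      have "measure M (B \<union> C) \<le> measure M B + measure M C"
        using that by (intro measure_Un_le) (auto simp: G_def)
      also have "\<dots> < 2 * a" using that by (auto simp: G_def)
      finally show ?thesis using dich[of "B \<union> C"] that by (auto simp: G_def)
    qed
    define s where "s = Sup (measure M ` G)"
    have ne: "{} \<in> G" using a by (auto simp: G_def)
    have bdd: "bdd_above (measure M ` G)" by (auto simp: G_def intro!: bdd_aboveI[of _ a])
    have s_le: "s \<le> a" unfolding s_def using ne by (intro cSup_least) (auto simp: G_def)
    have "\<exists>B\<in>G. s - 1 / Suc n < measure M B" for n
    proof -
      have "s - 1 / Suc n < Sup (measure M ` G)" by (simp add: s_def)
      then show ?thesis using less_cSupE[of "s - 1 / Suc n" "measure M ` G"] ne by auto
    qed
    then obtain B where B: "\<And>n. B n \<in> G" "\<And>n. s - 1 / Suc n < measure M (B n)" by metis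
    define C where "C n = (\<Union>i\<le>n. B i)" for n
    have CG: "C n \<in> G" for n
      by (induction n) (auto simp: C_def atMost_Suc B(1) intro!: un)
    have Cm: "C n \<in> sets M" "C n \<subseteq> A" for n using CG by (auto simp: G_def)
    define D where "D = (\<Union>n. C n)"
    have D: "D \<in> sets M" "D \<subseteq> A" using Cm by (auto simp: D_def)
    have "incseq C" unfolding C_def by (intro monoI UN_mono) auto
    then have lim: "(\<lambda>n. measure M (C n)) \<longlonglongrightarrow> measure M D"
      unfolding D_def using Cm by (intro finite_Lim_measure_incseq) auto
    have "measure M D \<le> a"
      using CG by (intro LIMSEQ_le_const2[OF lim]) (auto simp: G_def intro!: less_imp_le)
    then have DG: "D \<in> G" using dich[OF D] D a by (auto simp: G_def)
    have sD: "s \<le> measure M D"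
    proof (rule field_le_epsilon)
      fix e :: real assume "0 < e"
      then obtain n where n: "1 / Suc n < e" using nat_approx_posE by blast
      have "s - 1 / Suc n < measure M (B n)" by (rule B)
      also have "\<dots> \<le> measure M D"
        using D by (intro finite_measure_mono) (auto simp: D_def C_def)
      finally show "s \<le> measure M D + e" using n by simp
    qed
    have "measure M (A - D) = measure M A - measure M D"
      using D A by (simp add: finite_measure_Diff)
    then have "0 < measure M (A - D)" using DG a by (auto simp: G_def a_def)
    then obtain F where F: "F \<in> sets M" "F \<subseteq> A - D" "0 < measure M F" "measure M F < a"
      using non_atomic_small_subset[OF na assms(2) _ _ a] A D by (metis sets.Diff)
    have "D \<union> F \<in> G" using F by (intro un DG) (auto simp: G_def)
    then have "measure M (D \<union> F) \<le> s" unfolding s_def using bdd by (intro cSup_upper) auto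
    moreover have "measure M (D \<union> F) = measure M D + measure M F"
      using D F by (intro finite_measure_Union) auto
    ultimately show False using F sD by simp
  qed
qed

text \<open>The inequality \<open>k w \<le> v\<close> between additive set functions passes to at least one half of every
  splitting, so it survives on sets of arbitrarily small measure.\<close>

lemma concentrate_on_small_set:
  fixes v w :: "'a set \<Rightarrow> real"
  assumes na: "non_atomic M" and fin: "finite_measure M"
    and v_add: "\<And>A B. A \<in> sets M \<Longrightarrow> B \<in> sets M \<Longrightarrow> A \<inter> B = {} \<Longrightarrow> v (A \<union> B) = v A + v B"
    and w_add: "\<And>A B. A \<in> sets M \<Longrightarrow> B \<in> sets M \<Longrightarrow> A \<inter> B = {} \<Longrightarrow> w (A \<union> B) = w A + w B"
    and w_nonneg: "\<And>A. A \<in> sets M \<Longrightarrow> 0 \<le> w A"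
    and vw: "\<And>A. A \<in> sets M \<Longrightarrow> w A = 0 \<Longrightarrow> v A = 0"
    and top: "0 < w (space M)" "k * w (space M) \<le> v (space M)"
    and e: "0 < e"
  obtains A where "A \<in> sets M" "0 < w A" "k * w A \<le> v A" "measure M A < e"
proof -
  interpret finite_measure M by fact
  have "\<exists>A\<in>sets M. 0 < w A \<and> k * w A \<le> v A \<and> measure M A \<le> (2/3)^n * measure M (space M)" for n
  proof (induction n)
    case 0
    then show ?case using top by (intro bexI[of _ "space M"]) auto
  next
    case (Suc n)
    then obtain A where A: "A \<in> sets M" "0 < w A" "k * w A \<le> v A"
      "measure M A \<le> (2/3)^n * measure M (space M)" by blast
    obtain B where B: "B \<in> sets M" "B \<subseteq> A" "3 * measure M B \<le> 2 * measure M A"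
        "3 * measure M (A - B) \<le> 2 * measure M A"
      by (rule non_atomic_balanced_split[OF na fin A(1)])
    have D: "A - B \<in> sets M" using A B by auto
    have AB: "B \<union> (A - B) = A" using B by auto
    have w: "w A = w B + w (A - B)" using w_add[OF B(1) D] AB by simp
    have v: "v A = v B + v (A - B)" using v_add[OF B(1) D] AB by simp
    \<comment> \<open>one half inherits the inequality; a half with \<open>w = 0\<close> contributes nothing to \<open>v\<close>\<close>
    have "(0 < w B \<and> k * w B \<le> v B) \<or> (0 < w (A - B) \<and> k * w (A - B) \<le> v (A - B))"
    proof (cases "0 < w B \<and> 0 < w (A - B)")
      case True
      then show ?thesis using A(3) unfolding w v by (auto simp: algebra_simps)
    next
      case False
      then show ?thesis using A(2,3) w v vw[OF B(1)] vw[OF D] w_nonneg[OF B(1)] w_nonneg[OF D]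
        by (cases "w B = 0") auto
    qed
    then obtain C where C: "C \<in> sets M" "0 < w C" "k * w C \<le> v C" "3 * measure M C \<le> 2 * measure M A"
      using B D by blast
    then have "measure M C \<le> (2/3) ^ Suc n * measure M (space M)"
      using A(4) by simp
    then show ?case using C by blast
  qed
  moreover obtain n where "(2/3)^n * measure M (space M) < e"
  proof -
    have "(\<lambda>n. (2/3::real)^n * measure M (space M)) \<longlonglongrightarrow> 0 * measure M (space M)"
      by (intro tendsto_intros LIMSEQ_realpow_zero) auto
    then have "eventually (\<lambda>n. (2/3::real)^n * measure M (space M) < e) sequentially"
      using e by (intro order_tendstoD(2)) auto
    then show ?thesis using that by (auto simp: eventually_sequentially)
  qed
  ultimately show thesis using that by (meson le_less_trans)
qed

text \<open>If \<open>|v| > e\<close> on all positive pieces of \<open>A\<close>, then splitting off pieces again and again and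
  sorting them by the sign of \<open>v\<close> makes the difference of two values of \<open>v\<close> arbitrarily large.\<close>

lemma bounded_additive_small:
  fixes v :: "'a set \<Rightarrow> real"
  assumes na: "non_atomic M" and A: "A \<in> sets M" "0 < emeasure M A"
    and v_add: "\<And>A B. A \<in> sets M \<Longrightarrow> B \<in> sets M \<Longrightarrow> A \<inter> B = {} \<Longrightarrow> v (A \<union> B) = v A + v B"
    and bound: "\<And>A. A \<in> sets M \<Longrightarrow> \<bar>v A\<bar> \<le> C"
    and e: "0 < e"
  obtains B where "B \<in> sets M" "B \<subseteq> A" "0 < emeasure M B" "\<bar>v B\<bar> \<le> e"
proof (rule ccontr)
  note found = that
  assume "\<not> thesis"
  then have big: "e < \<bar>v B\<bar>" if "B \<in> sets M" "B \<subseteq> A" "0 < emeasure M B" for B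
    using found[OF that] by force
  have "\<exists>E F. E \<in> sets M \<and> F \<in> sets M \<and> E \<subseteq> B \<and> F \<subseteq> B \<and> E \<inter> F = {} \<and> real n * e \<le> v E - v F"
    if "B \<in> sets M" "B \<subseteq> A" "0 < emeasure M B" for n B
    using that
  proof (induction n arbitrary: B)
    case 0
    show ?case by (intro exI[of _ "{}"]) auto
  next
    case (Suc n)
    obtain C where C: "C \<in> sets M" "C \<subseteq> B" "0 < emeasure M C" "0 < emeasure M (B - C)"
      using non_atomic_split[OF na Suc.prems(1,3)] .
    obtain E F where EF: "E \<in> sets M" "F \<in> sets M" "E \<subseteq> C" "F \<subseteq> C" "E \<inter> F = {}"
        "real n * e \<le> v E - v F"
      using Suc.IH[of C] C Suc.prems by blast
    define D where "D = B - C"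
    have D: "D \<in> sets M" "D \<subseteq> B" "D \<inter> C = {}" "0 < emeasure M D" using C Suc.prems by (auto simp: D_def)
    then have "e < \<bar>v D\<bar>" using big Suc.prems by blast
    then consider "e < v D" | "v D < - e" by linarith
    then show ?case
    proof cases
      case 1
      have "v (E \<union> D) = v E + v D" using EF D by (intro v_add) auto
      then have "real (Suc n) * e \<le> v (E \<union> D) - v F" using EF 1 by (simp add: algebra_simps)
      moreover have "E \<union> D \<in> sets M" "E \<union> D \<subseteq> B" "F \<subseteq> B" "(E \<union> D) \<inter> F = {}" using EF D C by auto
      ultimately show ?thesis using EF(2) by blast
    next
      case 2
      have "v (F \<union> D) = v F + v D" using EF D by (intro v_add) auto
      then have "real (Suc n) * e \<le> v E - v (F \<union> D)" using EF 2 by (simp add: algebra_simps)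
      moreover have "F \<union> D \<in> sets M" "F \<union> D \<subseteq> B" "E \<subseteq> B" "E \<inter> (F \<union> D) = {}" using EF D C by auto
      ultimately show ?thesis using EF(1) by blast
    qed
  qed
  note family = this
  obtain n :: nat where n: "2 * C < real n * e" using e reals_Archimedean3 by blast
  from family[OF A(1) order_refl A(2), of n] obtain E F where
    "E \<in> sets M" "F \<in> sets M" "real n * e \<le> v E - v F" by blast
  then show False using bound[of E] bound[of F] n by linarith
qed


section \<open>Function spaces in terms of real-valued representatives\<close>

lemma rep_ae_class:
  assumes "f \<in> borel_measurable M"
  shows "rep (ae_class M f) \<in> borel_measurable M" "AE t in M. f t = rep (ae_class M f) t"
proof -
  have "f \<in> ae_class M f" using assms by (auto simp: ae_class_def ae_rel_def)
  then have "rep (ae_class M f) \<in> ae_class M f" unfolding rep_def by (rule someI[where P="\<lambda>g. g \<in> ae_class M f"])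
  then show "rep (ae_class M f) \<in> borel_measurable M" "AE t in M. f t = rep (ae_class M f) t"
    by (auto simp: ae_class_def ae_rel_def)
qed

lemma ae_class_eq_iff:
  assumes "f \<in> borel_measurable M" "g \<in> borel_measurable M"
  shows "ae_class M f = ae_class M g \<longleftrightarrow> (AE t in M. f t = g t)"
proof
  assume "ae_class M f = ae_class M g"
  then have "g \<in> ae_class M f" using assms by (auto simp: ae_class_def ae_rel_def)
  then show "AE t in M. f t = g t" by (auto simp: ae_class_def ae_rel_def)
next
  assume eq: "AE t in M. f t = g t"
  show "ae_class M f = ae_class M g"
    unfolding ae_class_def ae_rel_def using assms
    by (auto intro: AE_mp[OF eq])
qed

text \<open>Functions that are finite almost everywhere have real-valued representatives, and in terms
  of these the quotient space becomes a space of real functions with a seminorm. The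
  assumptions on sums and multiples are therefore stated for real-valued functions only.\<close>

locale normed_fun_space =
  fixes M :: "'a measure" and K :: "('a \<Rightarrow> ereal) set" and N :: "('a \<Rightarrow> ereal) \<Rightarrow> real"
  assumes K_measurable: "f \<in> K \<Longrightarrow> f \<in> borel_measurable M"
    and K_finite: "f \<in> K \<Longrightarrow> AE t in M. \<bar>f t\<bar> \<noteq> \<infinity>"
    and K_cong: "f \<in> K \<Longrightarrow> g \<in> borel_measurable M \<Longrightarrow> AE t in M. f t = g t \<Longrightarrow> g \<in> K"
    and N_cong: "f \<in> K \<Longrightarrow> g \<in> borel_measurable M \<Longrightarrow> AE t in M. f t = g t \<Longrightarrow> N g = N f"
    and K_zero: "(\<lambda>t. 0) \<in> K"
    and K_add: "(\<lambda>t. ereal (x t)) \<in> K \<Longrightarrow> (\<lambda>t. ereal (y t)) \<in> K \<Longrightarrow> (\<lambda>t. ereal (x t + y t)) \<in> K"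
    and K_scale: "(\<lambda>t. ereal (x t)) \<in> K \<Longrightarrow> (\<lambda>t. ereal (c * x t)) \<in> K"
    and N_triangle: "(\<lambda>t. ereal (x t)) \<in> K \<Longrightarrow> (\<lambda>t. ereal (y t)) \<in> K \<Longrightarrow>
      N (\<lambda>t. ereal (x t + y t)) \<le> N (\<lambda>t. ereal (x t)) + N (\<lambda>t. ereal (y t))"
    and N_scale: "(\<lambda>t. ereal (x t)) \<in> K \<Longrightarrow> N (\<lambda>t. ereal (c * x t)) = \<bar>c\<bar> * N (\<lambda>t. ereal (x t))"
    and N_definite: "(\<lambda>t. ereal (x t)) \<in> K \<Longrightarrow> N (\<lambda>t. ereal (x t)) = 0 \<Longrightarrow> AE t in M. x t = 0"
begin

definition V :: "('a \<Rightarrow> real) set" where "V = {x. (\<lambda>t. ereal (x t)) \<in> K}"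

definition norm_of :: "('a \<Rightarrow> real) \<Rightarrow> real" where "norm_of x = N (\<lambda>t. ereal (x t))"

definition cls :: "('a \<Rightarrow> real) \<Rightarrow> ('a \<Rightarrow> ereal) set" where "cls x = ae_class M (\<lambda>t. ereal (x t))"

abbreviation space_of :: "('a \<Rightarrow> ereal) set nspace" where "space_of \<equiv> fun_space M K N"

lemma V_measurable: "x \<in> V \<Longrightarrow> x \<in> borel_measurable M"
  using K_measurable[of "\<lambda>t. ereal (x t)"] borel_measurable_ereal_iff by (auto simp: V_def)

lemma V_zero: "(\<lambda>t. 0) \<in> V"
  using K_zero by (simp add: V_def zero_ereal_def)

lemma V_add: "x \<in> V \<Longrightarrow> y \<in> V \<Longrightarrow> (\<lambda>t. x t + y t) \<in> V"
  using K_add by (simp add: V_def)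

lemma V_scale: "x \<in> V \<Longrightarrow> (\<lambda>t. c * x t) \<in> V"
  using K_scale by (simp add: V_def)

lemma V_diff: "x \<in> V \<Longrightarrow> y \<in> V \<Longrightarrow> (\<lambda>t. x t - y t) \<in> V"
  using V_add[OF _ V_scale[of y "-1"]] by simp

lemma norm_cong: "x \<in> V \<Longrightarrow> y \<in> borel_measurable M \<Longrightarrow> AE t in M. x t = y t \<Longrightarrow> norm_of y = norm_of x"
  using N_cong[of "\<lambda>t. ereal (x t)" "\<lambda>t. ereal (y t)"] by (simp add: V_def norm_of_def)

lemma norm_triangle: "x \<in> V \<Longrightarrow> y \<in> V \<Longrightarrow> norm_of (\<lambda>t. x t + y t) \<le> norm_of x + norm_of y"
  using N_triangle by (simp add: V_def norm_of_def)

lemma norm_scale: "x \<in> V \<Longrightarrow> norm_of (\<lambda>t. c * x t) = \<bar>c\<bar> * norm_of x"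
  using N_scale by (simp add: V_def norm_of_def)

lemma norm_zero: "norm_of (\<lambda>t. 0) = 0"
  using norm_scale[OF V_zero, of 0] by simp

lemma norm_nonneg: "x \<in> V \<Longrightarrow> 0 \<le> norm_of x"
  using norm_triangle[OF _ V_scale[of x "-1"], of x] norm_scale[of x "-1"] by (simp add: norm_zero)

lemma norm_definite: "x \<in> V \<Longrightarrow> norm_of x = 0 \<Longrightarrow> AE t in M. x t = 0"
  using N_definite by (simp add: V_def norm_of_def)

lemma cls_eq_iff: "x \<in> V \<Longrightarrow> y \<in> V \<Longrightarrow> cls x = cls y \<longleftrightarrow> (AE t in M. x t = y t)"
  unfolding cls_def by (subst ae_class_eq_iff) (auto dest: V_measurable)

lemma elems_space: "elems space_of = cls ` V"
proof (intro equalityI subsetI)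
  fix F assume "F \<in> elems space_of"
  then obtain f where f: "f \<in> K" "F = ae_class M f" by (auto simp: fun_space_def)
  define x where "x t = real_of_ereal (f t)" for t
  have eq: "AE t in M. f t = ereal (x t)"
    using K_finite[OF f(1)] by eventually_elim (auto simp: x_def ereal_real)
  have xm: "(\<lambda>t. ereal (x t)) \<in> borel_measurable M"
    using K_measurable[OF f(1)] by (auto simp: x_def)
  then have "x \<in> V" using K_cong[OF f(1) xm eq] by (simp add: V_def)
  moreover have "F = cls x"
    unfolding f(2) cls_def by (subst ae_class_eq_iff) (use eq xm K_measurable[OF f(1)] in auto)
  ultimately show "F \<in> cls ` V" by blast
next
  fix F assume "F \<in> cls ` V"
  then show "F \<in> elems space_of" by (auto simp: fun_space_def cls_def V_def)
qed

lemma cls_in [simp]: "x \<in> V \<Longrightarrow> cls x \<in> elems space_of"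
  by (simp add: elems_space)

lemma rep_cls:
  assumes "x \<in> V"
  shows "rep (cls x) \<in> borel_measurable M" "AE t in M. rep (cls x) t = ereal (x t)"
  using rep_ae_class[of "\<lambda>t. ereal (x t)" M] V_measurable[OF assms] by (auto simp: cls_def)

lemma nrm_cls: "x \<in> V \<Longrightarrow> nrm space_of (cls x) = norm_of x"
  using rep_cls[of x] N_cong[of "\<lambda>t. ereal (x t)" "rep (cls x)"]
  by (simp add: norm_of_def fun_space_def V_def eq_commute[of "ereal _"])

lemma add_cls: "x \<in> V \<Longrightarrow> y \<in> V \<Longrightarrow> add space_of (cls x) (cls y) = cls (\<lambda>t. x t + y t)"
proof -
  assume x: "x \<in> V" and y: "y \<in> V"
  note [measurable] = rep_cls(1)[OF x] rep_cls(1)[OF y] V_measurable[OF x] V_measurable[OF y]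
  have "AE t in M. rep (cls x) t + rep (cls y) t = ereal (x t + y t)"
    using rep_cls(2)[OF x] rep_cls(2)[OF y] by eventually_elim simp
  then show ?thesis
    unfolding cls_def[of "\<lambda>t. x t + y t"] fun_space_def by (simp add: ae_class_eq_iff)
qed

lemma scl_cls: "x \<in> V \<Longrightarrow> scl space_of c (cls x) = cls (\<lambda>t. c * x t)"
proof -
  assume x: "x \<in> V"
  note [measurable] = rep_cls(1)[OF x] V_measurable[OF x]
  have "AE t in M. ereal c * rep (cls x) t = ereal (c * x t)"
    using rep_cls(2)[OF x] by eventually_elim simp
  then show ?thesis
    unfolding cls_def[of "\<lambda>t. c * x t"] fun_space_def by (simp add: ae_class_eq_iff)
qed

lemma zer_cls: "zer space_of = cls (\<lambda>t. 0)"
  by (simp add: fun_space_def cls_def zero_ereal_def)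

lemma op_norm_eq: "op_norm space_of T = (SUP x\<in>{x \<in> V. norm_of x \<le> 1}. nrm space_of (T (cls x)))"
proof -
  have "{F \<in> elems space_of. nrm space_of F \<le> 1} = cls ` {x \<in> V. norm_of x \<le> 1}"
    by (auto simp: elems_space nrm_cls)
  then show ?thesis by (simp add: op_norm_def image_image)
qed

lemma unit_ball_nonempty: "{x \<in> V. norm_of x \<le> 1} \<noteq> {}"
  using V_zero norm_zero by (metis (mono_tags, lifting) empty_iff mem_Collect_eq zero_le_one)

section \<open>The Daugavet property in terms of functionals\<close>

text \<open>The operator \<open>x \<mapsto> - L x y\<close> has norm one, because \<open>L\<close> has norm one and attains it at \<open>y\<close>;
  adding the identity would have to give norm two.\<close>

lemma not_daugavet_criterion:
  assumes y: "y \<in> V" "norm_of y = 1" "L y = 1"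
    and L_cong: "\<And>x x'. x \<in> V \<Longrightarrow> x' \<in> V \<Longrightarrow> AE t in M. x t = x' t \<Longrightarrow> L x = L x'"
    and L_add: "\<And>x x'. x \<in> V \<Longrightarrow> x' \<in> V \<Longrightarrow> L (\<lambda>t. x t + x' t) = L x + L x'"
    and L_scale: "\<And>x c. x \<in> V \<Longrightarrow> L (\<lambda>t. c * x t) = c * L x"
    and L_bound: "\<And>x. x \<in> V \<Longrightarrow> \<bar>L x\<bar> \<le> norm_of x"
    and d: "0 < d"
    and gap: "\<And>x. x \<in> V \<Longrightarrow> norm_of x \<le> 1 \<Longrightarrow> norm_of (\<lambda>t. x t - L x * y t) \<le> 2 - d"
  shows "\<not> daugavet space_of"
proof
  assume D: "daugavet space_of"
  \<comment> \<open>the functional acts on classes through a chosen representative in \<open>V\<close>\<close>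
  define pick where "pick F = (SOME x. x \<in> V \<and> cls x = F)" for F
  have pick: "pick (cls x) \<in> V" "AE t in M. pick (cls x) t = x t" if "x \<in> V" for x
  proof -
    have "pick (cls x) \<in> V \<and> cls (pick (cls x)) = cls x"
      unfolding pick_def by (rule someI[of _ x]) (simp add: that)
    then show "pick (cls x) \<in> V" "AE t in M. pick (cls x) t = x t"
      using cls_eq_iff that by blast+
  qed
  define T where "T F = cls (\<lambda>t. - L (pick F) * y t)" for F
  have T: "T (cls x) = cls (\<lambda>t. - L x * y t)" if "x \<in> V" for x
    using L_cong[OF pick(1)[OF that] that pick(2)[OF that]] by (simp add: T_def)
  have Ly: "(\<lambda>t. - c * y t) \<in> V" for c using V_scale[OF y(1)] by blast
  have bop: "bounded_operator space_of T"
    unfolding bounded_operator_def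
  proof (intro conjI ballI allI)
    fix F assume "F \<in> elems space_of"
    then obtain x where x: "x \<in> V" "F = cls x" by (auto simp: elems_space)
    show "T F \<in> elems space_of" using x Ly by (simp add: T)
    show "T (scl space_of c F) = scl space_of c (T F)" for c
      using scl_cls[OF Ly, of c "L x"] by (simp add: x scl_cls V_scale T L_scale mult.assoc)
    fix G assume "G \<in> elems space_of"
    then obtain x' where x': "x' \<in> V" "G = cls x'" by (auto simp: elems_space)
    show "T (add space_of F G) = add space_of (T F) (T G)"
      using add_cls[OF Ly Ly, of "L x" "L x'"] by (simp add: x x' add_cls V_add T L_add algebra_simps)
  next
    have "nrm space_of (T F) \<le> 1 * nrm space_of F" if "F \<in> elems space_of" for F
    proof -
      from that obtain x where x: "x \<in> V" "F = cls x" by (auto simp: elems_space)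
      show ?thesis using L_bound[OF x(1)] norm_scale[OF y(1), of "- L x"] nrm_cls[OF Ly, of "L x"]
        by (simp add: x T nrm_cls y)
    qed
    then show "\<exists>C. \<forall>x\<in>elems space_of. nrm space_of (T x) \<le> C * nrm space_of x" by blast
  qed
  have r1: "rank_one space_of T"
    unfolding rank_one_def
  proof (intro bexI conjI)
    show "cls y \<in> elems space_of" using y by simp
    show "cls y \<noteq> zer space_of"
    proof
      assume "cls y = zer space_of"
      then have "AE t in M. y t = 0" using y V_zero by (simp add: zer_cls cls_eq_iff)
      then have "AE t in M. 0 = y t" by eventually_elim simp
      then show False using norm_cong[OF V_zero V_measurable[OF y(1)]] y norm_zero by simp
    qed
    show "T ` elems space_of = {scl space_of c (cls y) |c. True}"
    proof (intro equalityI subsetI)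
      fix F assume "F \<in> T ` elems space_of"
      then obtain x where "x \<in> V" "F = T (cls x)" by (auto simp: elems_space)
      then show "F \<in> {scl space_of c (cls y) |c. True}"
        using scl_cls[OF y(1), of "- L x"] by (auto simp: T)
    next
      fix F assume "F \<in> {scl space_of c (cls y) |c. True}"
      then obtain c where "F = scl space_of c (cls y)" by blast
      then have "F = T (cls (\<lambda>t. - c * y t))"
        using L_scale[OF y(1), of "-c"] T[OF Ly, of c] y by (simp add: scl_cls)
      moreover have "cls (\<lambda>t. - c * y t) \<in> elems space_of" using Ly by (intro cls_in)
      ultimately show "F \<in> T ` elems space_of" by (metis imageI)
    qed
  qed
  have nT: "nrm space_of (T (cls x)) = \<bar>L x\<bar>" if "x \<in> V" for x
    using norm_scale[OF y(1), of "- L x"] nrm_cls[OF Ly, of "L x"] by (simp add: that T y)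
  have "1 \<le> op_norm space_of T"
    unfolding op_norm_eq
  proof (rule cSUP_upper2[where x=y])
    show "bdd_above ((\<lambda>x. nrm space_of (T (cls x))) ` {x \<in> V. norm_of x \<le> 1})"
      using L_bound by (intro bdd_aboveI2[of _ _ 1]) (force simp: nT)
  qed (use y nT in auto)
  moreover have "op_norm space_of (\<lambda>x. add space_of x (T x)) \<le> 2 - d"
    unfolding op_norm_eq
  proof (rule cSUP_least[OF unit_ball_nonempty])
    fix x assume "x \<in> {x \<in> V. norm_of x \<le> 1}"
    then have x: "x \<in> V" "norm_of x \<le> 1" by auto
    have "nrm space_of (add space_of (cls x) (T (cls x))) = norm_of (\<lambda>t. x t - L x * y t)"
      using add_cls[OF x(1) Ly, of "L x"] nrm_cls[OF V_add[OF x(1) Ly], of "L x"] by (simp add: T x)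
    then show "nrm space_of (add space_of (cls x) (T (cls x))) \<le> 2 - d" using gap[OF x] by simp
  qed
  moreover have "op_norm space_of (\<lambda>x. add space_of x (T x)) = 1 + op_norm space_of T"
    using D bop r1 unfolding daugavet_def by blast
  ultimately show False using d by linarith
qed

text \<open>Apply the assumption to an almost norming vector \<open>x\<close> of \<open>L\<close> and to \<open>z = L x y\<close>, the image of \<open>x\<close>
  under the operator. Since \<open>L x\<close> is almost maximal on the unit ball, \<open>L x'\<close> is close to \<open>L x\<close>, so
  the image of \<open>x'\<close> is close to \<open>z\<close> and \<open>x'\<close> plus its image has norm almost \<open>1 + \<parallel>z\<parallel>\<close>.\<close>

lemma daugavet_criterion:
  assumes shift: "\<And>L C z x e.
      (\<And>x x'. x \<in> V \<Longrightarrow> x' \<in> V \<Longrightarrow> L (\<lambda>t. x t + x' t) = L x + L x') \<Longrightarrow>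
      (\<And>x c. x \<in> V \<Longrightarrow> L (\<lambda>t. c * x t) = c * L x) \<Longrightarrow>
      (\<And>x. x \<in> V \<Longrightarrow> \<bar>L x\<bar> \<le> C * norm_of x) \<Longrightarrow>
      z \<in> V \<Longrightarrow> x \<in> V \<Longrightarrow> norm_of x = 1 \<Longrightarrow> 0 < L x \<Longrightarrow> (0::real) < e \<Longrightarrow>
      \<exists>x'\<in>V. norm_of x' \<le> 1 \<and> L x - e \<le> L x' \<and> 1 + norm_of z - e \<le> norm_of (\<lambda>t. x' t + z t)"
  shows "daugavet space_of"
  unfolding daugavet_def
proof (intro allI impI, elim conjE)
  fix T assume bop: "bounded_operator space_of T" and r1: "rank_one space_of T"
  from r1 obtain y where y: "y \<in> V" "cls y \<noteq> zer space_of"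
    "T ` elems space_of = {scl space_of c (cls y) |c. True}"
    unfolding rank_one_def elems_space by blast
  have cy: "(\<lambda>t. c * y t) \<in> V" for c by (rule V_scale[OF y(1)])
  have ny: "0 < norm_of y"
  proof -
    have "norm_of y \<noteq> 0"
      using norm_definite[OF y(1)] y V_zero by (auto simp: zer_cls cls_eq_iff)
    then show ?thesis using norm_nonneg[OF y(1)] by simp
  qed
  have uniq: "c = d" if "cls (\<lambda>t. c * y t) = cls (\<lambda>t. d * y t)" for c d
  proof -
    have "AE t in M. c * y t = d * y t" using that cy by (simp add: cls_eq_iff)
    then have "AE t in M. (c - d) * y t = 0" by eventually_elim (simp add: algebra_simps)
    then have "AE t in M. 0 = (c - d) * y t" by eventually_elim simp
    then have "norm_of (\<lambda>t. (c - d) * y t) = 0"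
      using norm_cong[OF V_zero V_measurable[OF cy]] norm_zero by simp
    then show ?thesis using norm_scale[OF y(1)] ny by simp
  qed
  define L where "L x = (THE c. T (cls x) = cls (\<lambda>t. c * y t))" for x
  have T: "T (cls x) = cls (\<lambda>t. L x * y t)" if x: "x \<in> V" for x
  proof -
    have "T (cls x) \<in> {scl space_of c (cls y) |c. True}" unfolding y(3)[symmetric] using x by simp
    then obtain c where c: "T (cls x) = cls (\<lambda>t. c * y t)" using y(1) by (auto simp: scl_cls)
    show ?thesis unfolding L_def by (rule theI2[of _ c]) (use c uniq in auto)
  qed
  have L_eqI: "L x = c" if "x \<in> V" "T (cls x) = cls (\<lambda>t. c * y t)" for x c
    using T[OF that(1)] that(2) uniq by simp
  have L_add: "L (\<lambda>t. x t + x' t) = L x + L x'" if "x \<in> V" "x' \<in> V" for x x'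
  proof (rule L_eqI)
    have "T (cls (\<lambda>t. x t + x' t)) = T (add space_of (cls x) (cls x'))" using that by (simp add: add_cls)
    also have "\<dots> = add space_of (T (cls x)) (T (cls x'))"
      using bop that unfolding bounded_operator_def by simp
    also have "\<dots> = cls (\<lambda>t. (L x + L x') * y t)" using that by (simp add: T add_cls cy algebra_simps)
    finally show "T (cls (\<lambda>t. x t + x' t)) = cls (\<lambda>t. (L x + L x') * y t)" .
  qed (use that V_add in auto)
  have L_scale: "L (\<lambda>t. c * x t) = c * L x" if "x \<in> V" for x c
  proof (rule L_eqI)
    have "T (cls (\<lambda>t. c * x t)) = T (scl space_of c (cls x))" using that by (simp add: scl_cls)
    also have "\<dots> = scl space_of c (T (cls x))"
      using bop that unfolding bounded_operator_def by simp
    also have "\<dots> = cls (\<lambda>t. (c * L x) * y t)" using that by (simp add: T scl_cls cy algebra_simps)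
    finally show "T (cls (\<lambda>t. c * x t)) = cls (\<lambda>t. (c * L x) * y t)" .
  qed (use that V_scale in auto)
  have nT: "nrm space_of (T (cls x)) = \<bar>L x\<bar> * norm_of y" if "x \<in> V" for x
    using that by (simp add: T nrm_cls cy norm_scale y)
  obtain C where C: "\<And>x. x \<in> V \<Longrightarrow> \<bar>L x\<bar> * norm_of y \<le> C * norm_of x"
    using bop unfolding bounded_operator_def by (metis nT cls_in nrm_cls)
  have L_bound: "\<bar>L x\<bar> \<le> (C / norm_of y) * norm_of x" if "x \<in> V" for x
    using C[OF that] ny by (simp add: field_simps)
  let ?B = "{x \<in> V. norm_of x \<le> 1}"
  have C0: "C * norm_of x \<le> \<bar>C\<bar>" if "x \<in> ?B" for x
  proof -
    have "C * norm_of x \<le> \<bar>C\<bar> * norm_of x" using that norm_nonneg[of x] by (intro mult_right_mono) auto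
    also have "\<dots> \<le> \<bar>C\<bar> * 1" using that by (intro mult_left_mono) auto
    finally show ?thesis by simp
  qed
  define t where "t = op_norm space_of T"
  have t: "t = (SUP x\<in>?B. \<bar>L x\<bar> * norm_of y)"
    unfolding t_def op_norm_eq by (intro SUP_cong) (auto simp: nT)
  have bdd: "bdd_above ((\<lambda>x. \<bar>L x\<bar> * norm_of y) ` ?B)"
    using C C0 by (intro bdd_aboveI2[of _ _ "\<bar>C\<bar>"]) (force intro: order_trans)
  have le_t: "\<bar>L x\<bar> * norm_of y \<le> t" if "x \<in> ?B" for x
    unfolding t using that bdd by (intro cSUP_upper)
  have "0 \<le> \<bar>L (\<lambda>t. 0)\<bar> * norm_of y" using ny by simp
  then have t0: "0 \<le> t" using le_t[of "\<lambda>t. 0"] V_zero norm_zero by simp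
  have IT: "nrm space_of (add space_of (cls x) (T (cls x))) = norm_of (\<lambda>t. x t + L x * y t)"
    if "x \<in> V" for x
    using that by (simp add: T add_cls cy nrm_cls V_add)
  define s where "s = op_norm space_of (\<lambda>x. add space_of x (T x))"
  have s: "s = (SUP x\<in>?B. norm_of (\<lambda>t. x t + L x * y t))"
    unfolding s_def op_norm_eq by (intro SUP_cong) (auto simp: IT)
  have upper: "norm_of (\<lambda>t. x t + L x * y t) \<le> 1 + t" if "x \<in> ?B" for x
    using norm_triangle[of x, OF _ cy, of "L x"] that le_t[OF that] by (simp add: norm_scale y)
  have bdd_s: "bdd_above ((\<lambda>x. norm_of (\<lambda>t. x t + L x * y t)) ` ?B)"
    using upper by (intro bdd_aboveI2)
  have le_s: "norm_of (\<lambda>t. x t + L x * y t) \<le> s" if "x \<in> ?B" for x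
    unfolding s using that bdd_s by (intro cSUP_upper)
  have "s \<le> 1 + t" unfolding s using upper by (intro cSUP_least[OF unit_ball_nonempty])
  moreover have "1 + t \<le> s"
  proof (cases "t = 0")
    case True
    \<comment> \<open>impossible, since the range contains the nonzero vector \<open>y\<close>\<close>
    have "cls y \<in> T ` elems space_of" using y scl_cls[OF y(1), of 1] by (auto intro: exI[of _ 1])
    then obtain x where x: "x \<in> V" "T (cls x) = cls y" by (auto simp: elems_space)
    have Lx: "L x = 1" using x by (intro L_eqI) auto
    have nx: "0 < norm_of x"
      using L_bound[OF x(1)] Lx norm_nonneg[OF x(1)] by (cases "norm_of x = 0") auto
    define u where "u = (\<lambda>t. (1 / norm_of x) * x t)"
    have "u \<in> ?B"
      unfolding u_def using nx V_scale[OF x(1), of "1 / norm_of x"] norm_scale[OF x(1), of "1 / norm_of x"] by simp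
    from le_t[OF this] have "\<bar>L u\<bar> * norm_of y \<le> 0" using True by simp
    moreover have "\<bar>L u\<bar> = 1 / norm_of x"
      using L_scale[OF x(1), of "1 / norm_of x"] Lx nx by (simp add: u_def)
    ultimately have False using divide_pos_pos[OF ny nx] by (metis linorder_not_le mult_1 times_divide_eq_left)
    then show ?thesis ..
  next
    case False
    then have tpos: "0 < t" using t0 by simp
    show ?thesis
    proof (rule field_le_epsilon)
      fix e :: real assume e: "0 < e"
      define h where "h = min (e / 4) (t / 2)"
      have h: "0 < h" "h \<le> e / 4" "h < t" using e tpos by (auto simp: h_def)
      have "t - h < (SUP x\<in>?B. \<bar>L x\<bar> * norm_of y)" using h t by simp
      then obtain x0 where x0: "x0 \<in> ?B" "t - h < \<bar>L x0\<bar> * norm_of y"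
        using less_cSUP_iff[OF unit_ball_nonempty bdd] by blast
      have L0: "L x0 \<noteq> 0" using x0 h by auto
      have n0: "0 < norm_of x0"
        using L0 L_bound[of x0] x0 norm_nonneg[of x0] by (cases "norm_of x0 = 0") auto
      define c where "c = sgn (L x0) / norm_of x0"
      define x where "x = (\<lambda>t. c * x0 t)"
      have x: "x \<in> V" "norm_of x = 1"
        unfolding x_def using x0 n0 L0 V_scale[of x0 c] norm_scale[of x0 c]
        by (simp_all add: c_def abs_mult abs_sgn_eq)
      have "L x = \<bar>L x0\<bar> / norm_of x0" 
        using x0 L_scale[of x0 c] by (simp add: x_def c_def abs_sgn mult.commute)
      moreover have "\<bar>L x0\<bar> \<le> \<bar>L x0\<bar> / norm_of x0"
        using x0 n0 by (simp add: field_simps mult_left_le)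
      ultimately have Lx: "\<bar>L x0\<bar> \<le> L x" by simp
      have Lx0: "0 < L x" using Lx L0 by linarith
      have Lxt: "t - h < L x * norm_of y"
        using x0(2) mult_right_mono[OF Lx, of "norm_of y"] ny by linarith
      define k where "k = h / (1 + norm_of y)"
      have k: "0 < k" "k \<le> h" "k * norm_of y \<le> h" using h ny by (auto simp: k_def field_simps)
      define z where "z = (\<lambda>t. L x * y t)"
      have z: "z \<in> V" by (simp add: z_def cy)
      obtain x' where x': "x' \<in> V" "norm_of x' \<le> 1" "L x - k \<le> L x'"
        "1 + norm_of z - k \<le> norm_of (\<lambda>t. x' t + z t)"
        using shift[OF L_add L_scale L_bound z x Lx0 k(1)] by blast
      have "(L x - k) * norm_of y \<le> L x' * norm_of y" using x' ny by (intro mult_right_mono) auto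
      then have lo: "t - 2 * h \<le> L x' * norm_of y" using Lxt k by (simp add: algebra_simps)
      have "L x' * norm_of y \<le> \<bar>L x'\<bar> * norm_of y" using ny by (intro mult_right_mono) auto
      then have hi: "L x' * norm_of y \<le> t" using le_t[of x'] x' by simp
      have hix: "L x * norm_of y \<le> t" using le_t[of x] x Lx0 by simp
      have "\<bar>L x - L x'\<bar> * norm_of y \<le> 2 * h"
        using lo hi hix Lxt h by (auto simp: abs_if algebra_simps)
      then have close: "norm_of (\<lambda>t. (L x - L x') * y t) \<le> 2 * h" by (simp add: norm_scale y)
      have a1: "(\<lambda>t. x' t + L x' * y t) \<in> V" using x' cy V_add by blast
      have "norm_of (\<lambda>t. (x' t + L x' * y t) + (L x - L x') * y t) \<le> s + 2 * h"
        using norm_triangle[OF a1 cy, of "L x - L x'"] close le_s[of x'] x' by simp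
      moreover have "(\<lambda>t. (x' t + L x' * y t) + (L x - L x') * y t) = (\<lambda>t. x' t + z t)"
        by (auto simp: z_def algebra_simps)
      moreover have "norm_of z = L x * norm_of y" using Lx0 by (simp add: z_def norm_scale y)
      ultimately have "1 + L x * norm_of y - k \<le> s + 2 * h" using x'(4) by simp
      then show "1 + t \<le> s + e" using Lxt k h by linarith
    qed
  qed
  ultimately show "op_norm space_of (\<lambda>x. add space_of x (T x)) = 1 + op_norm space_of T"
    unfolding s_def t_def by simp
qed

end


section \<open>The Nakano modular\<close>

text \<open>The convexity of powers on the open half line, extended to the end point zero, where
  \<open>k\<^sup>P \<le> k\<close> for \<open>k \<le> 1\<close> takes its place.\<close>

lemma powr_convex_nonneg:
  fixes a b l P :: real
  assumes "1 \<le> P" "0 \<le> a" "0 \<le> b" "0 \<le> l" "l \<le> 1"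
  shows "(l * a + (1 - l) * b) powr P \<le> l * a powr P + (1 - l) * b powr P"
proof -
  have contract: "(k * u) powr P \<le> k * u powr P" if "0 \<le> k" "k \<le> 1" "0 \<le> u" for k u
  proof (cases "k = 0")
    case False
    then have "k powr P \<le> k powr 1" using that assms(1) by (intro powr_mono') auto
    then show ?thesis using that by (simp add: powr_mult mult_right_mono)
  qed simp
  consider "a = 0" | "b = 0" | "0 < a" "0 < b" using assms by linarith
  then show ?thesis
  proof cases
    case 1
    then show ?thesis using contract[of "1 - l" b] assms by simp
  next
    case 2
    then show ?thesis using contract[of l a] assms by simp
  next
    case 3
    then show ?thesis
      using convex_onD[OF powr_convex[OF assms(1)], of "1 - l" a b] assms by simp
  qed
qed

lemma nakano_infinite_exponent:
  "p t = \<infinity> \<Longrightarrow> nakano p t u = (if u \<le> 1 then 0 else \<infinity>)"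
  by (simp add: nakano_def)

lemma nakano_finite_exponent:
  "p t \<noteq> \<infinity> \<Longrightarrow> 0 \<le> u \<Longrightarrow>
    nakano p t (ennreal u) = ennreal (u powr enn2real (p t) / enn2real (p t))"
  by (simp add: nakano_def)

lemma nakano_zero [simp]: "nakano p t 0 = 0"
  by (simp add: nakano_def)

lemma nakano_top [simp]: "nakano p t \<infinity> = \<infinity>"
  by (auto simp: nakano_def top_unique)

lemma nakano_mono: "u \<le> v \<Longrightarrow> nakano p t u \<le> nakano p t v"
proof (cases "p t = \<infinity> \<or> v = \<infinity>")
  case True
  then show "u \<le> v \<Longrightarrow> ?thesis" by (auto simp: nakano_def top_unique)
next
  case False
  assume "u \<le> v"
  then have "enn2real u \<le> enn2real v" "u \<noteq> \<infinity>"
    using False by (auto intro!: enn2real_mono simp: top_unique less_top)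
  then show ?thesis
    using False by (auto simp: nakano_def intro!: ennreal_leI divide_right_mono powr_mono2)
qed

lemma nakano_one_le: "1 \<le> p t \<Longrightarrow> nakano p t 1 \<le> 1"
proof (cases "p t = \<infinity>")
  case False
  assume "1 \<le> p t"
  then have "1 \<le> enn2real (p t)" using enn2real_mono[of 1 "p t"] False by (simp add: less_top)
  then have "ennreal (1 powr enn2real (p t) / enn2real (p t)) \<le> 1" by (simp add: ennreal_le_1)
  then show ?thesis using False nakano_finite_exponent[of p t 1] by simp
qed (simp add: nakano_infinite_exponent)

lemma nakano_convex:
  assumes "1 \<le> p t" "0 \<le> a" "0 \<le> b" "0 \<le> l" "l \<le> (1::real)"
  shows "nakano p t (ennreal (l * a + (1 - l) * b))
    \<le> ennreal l * nakano p t (ennreal a) + ennreal (1 - l) * nakano p t (ennreal b)"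
proof (cases "p t = \<infinity>")
  case True
  consider "l = 0" | "l = 1" | "0 < l" "l < 1" using assms by linarith
  then show ?thesis
  proof cases
    case 3
    have "l * a + (1 - l) * b \<le> 1" if "a \<le> 1" "b \<le> 1"
      using convex_bound_le[OF that, of l "1 - l"] assms by simp
    then show ?thesis using True 3
      by (auto simp: nakano_infinite_exponent ennreal_mult_eq_top_iff ennreal_mult_top top_add ennreal_le_1)
  qed (use assms in auto)
next
  case False
  define P where "P = enn2real (p t)"
  have P: "1 \<le> P" using assms(1) False enn2real_mono[of 1 "p t"] by (simp add: P_def less_top)
  have "(l * a + (1 - l) * b) powr P / P \<le> (l * a powr P + (1 - l) * b powr P) / P"
    using powr_convex_nonneg[OF P assms(2-5)] P by (intro divide_right_mono) auto
  also have "\<dots> = l * (a powr P / P) + (1 - l) * (b powr P / P)" by (simp add: add_divide_distrib)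
  finally show ?thesis
    using False assms P by (simp add: nakano_finite_exponent flip: P_def ennreal_mult ennreal_plus) 
qed

lemma measurable_nakano [measurable]:
  assumes [measurable]: "p \<in> borel_measurable M" "u \<in> borel_measurable M"
  shows "(\<lambda>t. nakano p t (u t)) \<in> borel_measurable M"
  unfolding nakano_def by measurable

lemma modular_real:
  "modular M (nakano p) (\<lambda>t. ereal (x t)) = (\<integral>\<^sup>+t. nakano p t (ennreal \<bar>x t\<bar>) \<partial>M)"
  by (simp add: modular_def)

lemma modular_cong:
  "AE t in M. f t = g t \<Longrightarrow> modular M \<Phi> f = modular M \<Phi> g"
  unfolding modular_def by (intro nn_integral_cong_AE) auto

lemma modular_scaled_cong:
  "AE t in M. f t = g t \<Longrightarrow> modular M \<Phi> (\<lambda>t. ereal c * f t) = modular M \<Phi> (\<lambda>t. ereal c * g t)"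
  "AE t in M. f t = g t \<Longrightarrow> modular M \<Phi> (\<lambda>t. f t / ereal c) = modular M \<Phi> (\<lambda>t. g t / ereal c)"
  by (auto intro!: modular_cong)

locale exponent =
  fixes M :: "'a measure" and p :: "'a \<Rightarrow> ennreal"
  assumes p_measurable [measurable]: "p \<in> borel_measurable M"
    and p_ge_1: "t \<in> space M \<Longrightarrow> 1 \<le> p t"
begin

definition rho :: "('a \<Rightarrow> real) \<Rightarrow> ennreal" where
  "rho x = (\<integral>\<^sup>+t. nakano p t (ennreal \<bar>x t\<bar>) \<partial>M)"

lemma rho_mono: "AE t in M. \<bar>x t\<bar> \<le> \<bar>y t\<bar> \<Longrightarrow> rho x \<le> rho y"
  unfolding rho_def by (intro nn_integral_mono_AE) (auto intro!: nakano_mono ennreal_leI)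

lemma rho_zero [simp]: "rho (\<lambda>t. 0) = 0"
  by (simp add: rho_def)

lemma rho_convex:
  assumes [measurable]: "x \<in> borel_measurable M" "y \<in> borel_measurable M" and l: "0 \<le> l" "l \<le> 1"
  shows "rho (\<lambda>t. l * x t + (1 - l) * y t) \<le> ennreal l * rho x + ennreal (1 - l) * rho y"
proof -
  have "rho (\<lambda>t. l * x t + (1 - l) * y t) \<le>
    (\<integral>\<^sup>+t. ennreal l * nakano p t (ennreal \<bar>x t\<bar>) + ennreal (1 - l) * nakano p t (ennreal \<bar>y t\<bar>) \<partial>M)"
    unfolding rho_def
  proof (intro nn_integral_mono)
    fix t assume t: "t \<in> space M"
    have "\<bar>l * x t + (1 - l) * y t\<bar> \<le> l * \<bar>x t\<bar> + (1 - l) * \<bar>y t\<bar>"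
      using l abs_triangle_ineq[of "l * x t" "(1 - l) * y t"] by (simp add: abs_mult)
    then have "nakano p t (ennreal \<bar>l * x t + (1 - l) * y t\<bar>) \<le>
      nakano p t (ennreal (l * \<bar>x t\<bar> + (1 - l) * \<bar>y t\<bar>))"
      by (intro nakano_mono ennreal_leI)
    also have "\<dots> \<le> ennreal l * nakano p t (ennreal \<bar>x t\<bar>) + ennreal (1 - l) * nakano p t (ennreal \<bar>y t\<bar>)"
      using l p_ge_1[OF t] by (intro nakano_convex) auto
    finally show "nakano p t (ennreal \<bar>l * x t + (1 - l) * y t\<bar>) \<le>
      ennreal l * nakano p t (ennreal \<bar>x t\<bar>) + ennreal (1 - l) * nakano p t (ennreal \<bar>y t\<bar>)" .
  qed
  also have "\<dots> = ennreal l * rho x + ennreal (1 - l) * rho y"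
    unfolding rho_def by (subst nn_integral_add) (auto simp: nn_integral_cmult)
  finally show ?thesis .
qed

lemma rho_scale_le:
  "x \<in> borel_measurable M \<Longrightarrow> 0 \<le> l \<Longrightarrow> l \<le> 1 \<Longrightarrow> rho (\<lambda>t. l * x t) \<le> ennreal l * rho x"
  using rho_convex[of x "\<lambda>t. 0" l] by simp

lemma modular_rho: "modular M (nakano p) (\<lambda>t. ereal (x t)) = rho x"
  by (simp add: modular_real rho_def)

lemma modular_funs_real_iff:
  "(\<lambda>t. ereal (x t)) \<in> modular_funs M (nakano p) \<longleftrightarrow>
    x \<in> borel_measurable M \<and> (\<exists>c>0. rho (\<lambda>t. c * x t) < \<infinity>)"
  using modular_rho[of "\<lambda>t. _ * x t"]
  by (auto simp: modular_funs_def borel_measurable_ereal_iff)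

lemma rho_unit_scale:
  assumes "x \<in> borel_measurable M" "c > 0" "rho (\<lambda>t. c * x t) < \<infinity>"
  obtains d where "0 < d" "rho (\<lambda>t. d * x t) \<le> 1"
proof -
  obtain r where r: "rho (\<lambda>t. c * x t) = ennreal r" "0 \<le> r" using assms(3) by (cases "rho (\<lambda>t. c * x t)") auto
  define l where "l = 1 / (1 + r)"
  have l: "0 < l" "l \<le> 1" "l * r \<le> 1" using r by (auto simp: l_def field_simps)
  have "rho (\<lambda>t. l * (c * x t)) \<le> ennreal l * ennreal r"
    using rho_scale_le[of "\<lambda>t. c * x t" l] assms l r by simp
  also have "\<dots> \<le> 1" using l r by (simp add: ennreal_le_1 flip: ennreal_mult)
  finally show thesis using that[of "l * c"] l assms(2) by (simp add: mult.assoc)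
qed

lemma modular_funs_finite:
  assumes "f \<in> modular_funs M (nakano p)"
  shows "AE t in M. \<bar>f t\<bar> \<noteq> \<infinity>"
proof -
  obtain c where [measurable]: "f \<in> borel_measurable M" and c: "0 < (c::real)"
    "modular M (nakano p) (\<lambda>t. ereal c * f t) < \<infinity>"
    using assms by (auto simp: modular_funs_def)
  have "AE t in M. nakano p t (e2ennreal \<bar>ereal c * f t\<bar>) \<noteq> \<infinity>"
    using c(2) unfolding modular_def by (intro nn_integral_PInf_AE) auto
  then show ?thesis
  proof eventually_elim
    case (elim t)
    then show ?case using c(1) nakano_top[of p t] by (cases "f t") (auto simp: top_ennreal.rep_eq)
  qed
qed

lemma modular_funs_cong:
  assumes "f \<in> modular_funs M \<Phi>" "g \<in> borel_measurable M" "AE t in M. f t = g t"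
  shows "g \<in> modular_funs M \<Phi>"
  using assms modular_scaled_cong(1)[OF assms(3), of \<Phi>] by (auto simp: modular_funs_def)

lemma modular_funs_zero: "(\<lambda>t. 0) \<in> modular_funs M (nakano p)"
  using modular_funs_real_iff[of "\<lambda>t. 0"] gt_ex[of "0::real"] by (simp add: zero_ereal_def)

lemma modular_funs_scale:
  assumes "(\<lambda>t. ereal (x t)) \<in> modular_funs M (nakano p)"
  shows "(\<lambda>t. ereal (c * x t)) \<in> modular_funs M (nakano p)"
proof (cases "c = 0")
  case True
  then show ?thesis using modular_funs_zero by (simp add: zero_ereal_def)
next
  case False
  obtain d where d: "0 < d" "rho (\<lambda>t. d * x t) < \<infinity>" "x \<in> borel_measurable M"
    using assms modular_funs_real_iff by auto
  have "rho (\<lambda>t. (d / \<bar>c\<bar>) * (c * x t)) = rho (\<lambda>t. d * x t)"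
    unfolding rho_def using False d(1) by (intro nn_integral_cong) (simp add: abs_mult)
  then show ?thesis using d False unfolding modular_funs_real_iff
    by (auto intro!: exI[of _ "d / \<bar>c\<bar>"])
qed

lemma modular_funs_add:
  assumes "(\<lambda>t. ereal (x t)) \<in> modular_funs M (nakano p)" "(\<lambda>t. ereal (y t)) \<in> modular_funs M (nakano p)"
  shows "(\<lambda>t. ereal (x t + y t)) \<in> modular_funs M (nakano p)"
proof -
  obtain c d where c: "0 < c" "rho (\<lambda>t. c * x t) < \<infinity>" and d: "0 < d" "rho (\<lambda>t. d * y t) < \<infinity>"
    and [measurable]: "x \<in> borel_measurable M" "y \<in> borel_measurable M"
    using assms modular_funs_real_iff by auto
  define m where "m = min c d"
  have "rho (\<lambda>t. m * x t) \<le> rho (\<lambda>t. c * x t)" "rho (\<lambda>t. m * y t) \<le> rho (\<lambda>t. d * y t)"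
    using c d by (auto intro!: rho_mono AE_I2 mult_right_mono simp: m_def abs_mult)
  then have "ennreal (1/2) * rho (\<lambda>t. m * x t) + ennreal (1/2) * rho (\<lambda>t. m * y t) < \<infinity>"
    using c d by (auto simp: ennreal_mult_less_top ennreal_less_top intro: le_less_trans simp del: ennreal_half)
  then have "rho (\<lambda>t. (1/2) * (m * x t) + (1 - 1/2) * (m * y t)) < \<infinity>"
    by (intro le_less_trans[OF rho_convex]) auto
  also have "(\<lambda>t. (1/2) * (m * x t) + (1 - 1/2) * (m * y t)) = (\<lambda>t. (m / 2) * (x t + y t))"
    by (auto simp: field_simps)
  finally show ?thesis using c d unfolding modular_funs_real_iff
    by (auto intro!: exI[of _ "m / 2"] simp: m_def)
qed

section \<open>The Luxemburg norm\<close>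

definition lux :: "('a \<Rightarrow> real) \<Rightarrow> real" where
  "lux x = Inf {c. 0 < c \<and> rho (\<lambda>t. x t / c) \<le> 1}"

lemma luxemburg_norm_real: "luxemburg_norm M (nakano p) (\<lambda>t. ereal (x t)) = lux x"
proof -
  have "modular M (nakano p) (\<lambda>t. ereal (x t) / ereal c) = rho (\<lambda>t. x t / c)" if "0 < c" for c
    using that modular_rho[of "\<lambda>t. x t / c"] by simp
  then show ?thesis unfolding luxemburg_norm_def lux_def by (metis (no_types, lifting))
qed

lemma lux_le: "0 < c \<Longrightarrow> rho (\<lambda>t. x t / c) \<le> 1 \<Longrightarrow> lux x \<le> c"
  unfolding lux_def by (intro cInf_lower bdd_belowI[of _ 0]) auto

lemma lux_set_nonempty:
  assumes "(\<lambda>t. ereal (x t)) \<in> modular_funs M (nakano p)"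
  shows "{c. 0 < c \<and> rho (\<lambda>t. x t / c) \<le> 1} \<noteq> {}"
proof -
  obtain c where c: "0 < c" "rho (\<lambda>t. c * x t) < \<infinity>" "x \<in> borel_measurable M"
    using assms modular_funs_real_iff by auto
  obtain d where "0 < d" "rho (\<lambda>t. d * x t) \<le> 1" using rho_unit_scale[OF c(3,1,2)] .
  then have "0 < 1/d \<and> rho (\<lambda>t. x t / (1/d)) \<le> 1" by (simp add: mult.commute)
  then show ?thesis by blast
qed

lemma lux_nonneg: "(\<lambda>t. ereal (x t)) \<in> modular_funs M (nakano p) \<Longrightarrow> 0 \<le> lux x"
  unfolding lux_def using lux_set_nonempty by (intro cInf_greatest) auto

lemma lux_less:
  assumes "(\<lambda>t. ereal (x t)) \<in> modular_funs M (nakano p)" "lux x < c"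
  shows "rho (\<lambda>t. x t / c) \<le> 1"
proof -
  obtain d where d: "0 < d" "rho (\<lambda>t. x t / d) \<le> 1" "d < c"
    using cInf_lessD[OF lux_set_nonempty[OF assms(1)]] assms(2) unfolding lux_def by blast
  have "rho (\<lambda>t. x t / c) \<le> rho (\<lambda>t. x t / d)"
    using d by (intro rho_mono) (auto simp: divide_left_mono)
  then show ?thesis using d by simp
qed

text \<open>The triangle inequality is the convexity of the modular applied with the weights
  \<open>a / (a + b)\<close> and \<open>b / (a + b)\<close>, where \<open>a\<close> and \<open>b\<close> are slightly larger than the two norms. If the
  norm vanishes, all multiples of \<open>x\<close> have modular zero by convexity, which forces \<open>x = 0\<close>.\<close>

lemma lux_space: "normed_fun_space M (modular_funs M (nakano p)) (luxemburg_norm M (nakano p))"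
proof
  let ?K = "modular_funs M (nakano p)" and ?N = "luxemburg_norm M (nakano p)"
  fix f g :: "'a \<Rightarrow> ereal" and x y :: "'a \<Rightarrow> real" and c :: real
  show "f \<in> ?K \<Longrightarrow> f \<in> borel_measurable M" by (simp add: modular_funs_def)
  show "f \<in> ?K \<Longrightarrow> AE t in M. \<bar>f t\<bar> \<noteq> \<infinity>" by (rule modular_funs_finite)
  show "f \<in> ?K \<Longrightarrow> g \<in> borel_measurable M \<Longrightarrow> AE t in M. f t = g t \<Longrightarrow> g \<in> ?K"
    by (rule modular_funs_cong)
  show "?N g = ?N f" if "AE t in M. f t = g t"
    unfolding luxemburg_norm_def using modular_scaled_cong(2)[OF that, of "nakano p"] by simp
  show "(\<lambda>t. 0) \<in> ?K" by (rule modular_funs_zero)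
  show "(\<lambda>t. ereal (x t)) \<in> ?K \<Longrightarrow> (\<lambda>t. ereal (y t)) \<in> ?K \<Longrightarrow> (\<lambda>t. ereal (x t + y t)) \<in> ?K"
    by (rule modular_funs_add)
  show "(\<lambda>t. ereal (x t)) \<in> ?K \<Longrightarrow> (\<lambda>t. ereal (c * x t)) \<in> ?K"
    by (rule modular_funs_scale)
  show "?N (\<lambda>t. ereal (x t + y t)) \<le> ?N (\<lambda>t. ereal (x t)) + ?N (\<lambda>t. ereal (y t))"
    if x: "(\<lambda>t. ereal (x t)) \<in> ?K" and y: "(\<lambda>t. ereal (y t)) \<in> ?K"
    unfolding luxemburg_norm_real
  proof (rule field_le_epsilon)
    fix e :: real assume e: "0 < e"
    define a where "a = lux x + e / 2"
    define b where "b = lux y + e / 2"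
    have ab: "0 < a" "0 < b" "lux x < a" "lux y < b"
      using e lux_nonneg[OF x] lux_nonneg[OF y] by (auto simp: a_def b_def)
    have [measurable]: "x \<in> borel_measurable M" "y \<in> borel_measurable M"
      using x y modular_funs_real_iff by auto
    define l where "l = a / (a + b)"
    have l: "0 \<le> l" "l \<le> 1" using ab by (auto simp: l_def)
    have "(\<lambda>t. l * (x t / a) + (1 - l) * (y t / b)) = (\<lambda>t. (x t + y t) / (a + b))"
    proof
      fix t
      have "1 - l = b / (a + b)" using ab by (simp add: l_def field_simps)
      then show "l * (x t / a) + (1 - l) * (y t / b) = (x t + y t) / (a + b)"
        using ab by (simp add: l_def add_divide_distrib)
    qed
    then have "rho (\<lambda>t. (x t + y t) / (a + b)) \<le> ennreal l * rho (\<lambda>t. x t / a) + ennreal (1 - l) * rho (\<lambda>t. y t / b)"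
      using rho_convex[of "\<lambda>t. x t / a" "\<lambda>t. y t / b" l] l by simp
    also have "\<dots> \<le> ennreal l * 1 + ennreal (1 - l) * 1"
      using lux_less[OF x ab(3)] lux_less[OF y ab(4)] by (intro add_mono mult_left_mono) auto
    also have "\<dots> = 1" using l by (simp flip: ennreal_plus)
    finally have "lux (\<lambda>t. x t + y t) \<le> a + b" using ab by (intro lux_le) auto
    then show "lux (\<lambda>t. x t + y t) \<le> lux x + lux y + e" by (simp add: a_def b_def)
  qed
  have scale_le: "lux (\<lambda>t. c * x t) \<le> \<bar>c\<bar> * lux x" if x: "(\<lambda>t. ereal (x t)) \<in> ?K" and c: "c \<noteq> 0" for x and c :: real
  proof (rule field_le_epsilon)
    fix e :: real assume e: "0 < e"
    define a where "a = lux x + e / \<bar>c\<bar>"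
    have a: "0 < a" "lux x < a" using e c lux_nonneg[OF x] by (auto simp: a_def add_nonneg_pos)
    have "rho (\<lambda>t. c * x t / (\<bar>c\<bar> * a)) = rho (\<lambda>t. x t / a)"
      unfolding rho_def using c by (intro nn_integral_cong) (simp add: abs_mult)
    then have "lux (\<lambda>t. c * x t) \<le> \<bar>c\<bar> * a" using lux_less[OF x a(2)] a c by (intro lux_le) auto
    then show "lux (\<lambda>t. c * x t) \<le> \<bar>c\<bar> * lux x + e" using c by (simp add: a_def algebra_simps)
  qed
  show "?N (\<lambda>t. ereal (c * x t)) = \<bar>c\<bar> * ?N (\<lambda>t. ereal (x t))" if x: "(\<lambda>t. ereal (x t)) \<in> ?K"
    unfolding luxemburg_norm_real
  proof (cases "c = 0")
    case True
    have "lux (\<lambda>t. 0) \<le> 0" by (rule field_le_epsilon) (auto intro: lux_le)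
    then show "lux (\<lambda>t. c * x t) = \<bar>c\<bar> * lux x"
      using True lux_nonneg[OF modular_funs_scale[OF x, of c]] by simp
  next
    case False
    have "lux (\<lambda>t. (1 / c) * (c * x t)) \<le> \<bar>1 / c\<bar> * lux (\<lambda>t. c * x t)"
      using False by (intro scale_le modular_funs_scale x) auto
    then show "lux (\<lambda>t. c * x t) = \<bar>c\<bar> * lux x"
      using scale_le[OF x False] False by (simp add: field_simps)
  qed
  show "AE t in M. x t = 0" if x: "(\<lambda>t. ereal (x t)) \<in> ?K" and "?N (\<lambda>t. ereal (x t)) = 0"
  proof -
    have z: "lux x = 0" using that luxemburg_norm_real by simp
    have [measurable]: "x \<in> borel_measurable M" using x modular_funs_real_iff by auto
    have zero: "rho (\<lambda>t. real m * x t) = 0" for m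
    proof -
      have "rho (\<lambda>t. real m * x t) \<le> 0 + ennreal e" if e: "0 < e" "e \<le> 1" for e
      proof -
        have "rho (\<lambda>t. real m * x t) \<le> rho (\<lambda>t. e * (x t / (e / (real m + 1))))"
        proof (intro rho_mono AE_I2)
          fix t
          have "e * (x t / (e / (real m + 1))) = (real m + 1) * x t" using e by simp
          then show "\<bar>real m * x t\<bar> \<le> \<bar>e * (x t / (e / (real m + 1)))\<bar>"
            by (simp add: abs_mult mult_right_mono)
        qed
        also have "\<dots> \<le> ennreal e * rho (\<lambda>t. x t / (e / (real m + 1)))"
          using e by (intro rho_scale_le) auto
        also have "\<dots> \<le> ennreal e * 1"
          using e z by (intro mult_left_mono lux_less x) auto
        finally show ?thesis by simp
      qed
      note small = this
      have "rho (\<lambda>t. real m * x t) \<le> 0 + ennreal e" if e: "0 < e" for e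
      proof -
        have "rho (\<lambda>t. real m * x t) \<le> 0 + ennreal (min e 1)" using e by (intro small) auto
        also have "\<dots> \<le> 0 + ennreal e" by (intro add_left_mono ennreal_leI) auto
        finally show ?thesis .
      qed
      then show ?thesis using ennreal_le_epsilon[of 0 "rho (\<lambda>t. real m * x t)"] by auto
    qed
    have "AE t in M. nakano p t (ennreal \<bar>real m * x t\<bar>) = 0" for m
      using zero[of m] unfolding rho_def by (subst (asm) nn_integral_0_iff_AE) auto
    then have "AE t in M. \<forall>m. nakano p t (ennreal \<bar>real m * x t\<bar>) = 0" by (simp add: AE_all_countable)
    then show ?thesis
      using AE_space
    proof eventually_elim
      case (elim t)
      show ?case
      proof (cases "p t = \<infinity>")
        case True
        have "\<bar>x t\<bar> * real m \<le> 1" for m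
          using elim True by (auto simp: nakano_infinite_exponent ennreal_le_1 abs_mult mult.commute split: if_splits)
        moreover have "\<exists>m. 1 < real m * \<bar>x t\<bar>" if "x t \<noteq> 0"
          using reals_Archimedean3[of "\<bar>x t\<bar>"] that by auto
        ultimately show ?thesis by (auto simp: mult.commute not_le[symmetric])
      next
        case False
        have "p t \<noteq> 0" using p_ge_1[OF elim(2)] by auto
        then have "0 < enn2real (p t)" using False by (simp add: enn2real_positive_iff less_top zero_less_iff_neq_zero)
        then show ?thesis using spec[OF elim(1), of 1] False
          by (auto simp: nakano_finite_exponent)
      qed
    qed
  qed
qed

end

section \<open>The deficit in the inequality of Young\<close>

text \<open>This is the gap in Young's inequality between \<open>r\<close> and 1 for the exponent \<open>P\<close>.\<close>

definition young_deficit :: "real \<Rightarrow> real \<Rightarrow> real" where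
  "young_deficit P r = \<bar>r\<bar> powr P / P + 1 - 1 / P - r"

text \<open>The mean value theorem for \<open>u\<^sup>P / P - u\<close>, whose derivative changes sign only at 1.\<close>

lemma young_deficit_pos:
  assumes P: "1 < P" and r: "r \<noteq> 1"
  shows "0 < young_deficit P r"
proof (cases "0 < r")
  case False
  then have "0 \<le> \<bar>r\<bar> powr P / P" "1 / P < 1" using P by auto
  then show ?thesis using False unfolding young_deficit_def by linarith
next
  case True
  define f where "f u = u powr P / P - u" for u :: real
  have d: "DERIV f u :> u powr (P - 1) - 1" if "0 < u" for u
    unfolding f_def using that P by (auto intro!: derivative_eq_intros simp: field_simps)
  have "f 1 < f r"
  proof (cases "r < 1")
    case less: True
    obtain z where z: "r < z" "z < 1" "f 1 - f r = (1 - r) * (z powr (P - 1) - 1)"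
      using MVT2[OF less, of f "\<lambda>u. u powr (P - 1) - 1"] d True by auto
    have "z powr (P - 1) < 1 powr (P - 1)" using z True P by (intro powr_less_mono2) auto
    then have "(1 - r) * (z powr (P - 1) - 1) < 0" using less by (intro mult_pos_neg) auto
    then show ?thesis using z by simp
  next
    case False
    then have less: "1 < r" using r by simp
    obtain z where z: "1 < z" "z < r" "f r - f 1 = (r - 1) * (z powr (P - 1) - 1)"
      using MVT2[OF less, of f "\<lambda>u. u powr (P - 1) - 1"] d by auto
    have "1 powr (P - 1) < z powr (P - 1)" using z P by (intro powr_less_mono2) auto
    then have "0 < (r - 1) * (z powr (P - 1) - 1)" using less by (intro mult_pos_pos) auto
    then show ?thesis using z by simp
  qed
  then show ?thesis using True by (simp add: f_def young_deficit_def)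
qed

lemma young_deficit_nonneg: "1 < P \<Longrightarrow> 0 \<le> young_deficit P r"
  using young_deficit_pos[of P r] by (cases "r = 1") (auto simp: young_deficit_def)

lemma powr_eventually_large:
  fixes a c :: real
  assumes "1 < a"
  obtains K where "2 \<le> K" "\<And>u P. K \<le> u \<Longrightarrow> a \<le> P \<Longrightarrow> c \<le> u powr (P - 1)"
proof -
  define K where "K = max 2 (\<bar>c\<bar> powr (1 / (a - 1)))"
  have "c \<le> u powr (P - 1)" if "K \<le> u" "a \<le> P" for u P
  proof -
    have "c \<le> (\<bar>c\<bar> powr (1 / (a - 1))) powr (a - 1)" using assms by (simp add: powr_powr)
    also have "\<dots> \<le> u powr (a - 1)" using assms that by (intro powr_mono2) (auto simp: K_def)
    also have "\<dots> \<le> u powr (P - 1)" using that by (intro powr_mono) (auto simp: K_def)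
    finally show ?thesis .
  qed
  then show thesis using that[of K] by (simp add: K_def)
qed

text \<open>Uniformity in the exponent: for \<open>r\<close> near 1 the left side is below \<open>e\<close>; on the remaining
  compact range the deficit is bounded below by continuity; for large \<open>|r|\<close> it is comparable
  with \<open>|r|\<^sup>P\<close>, which needs \<open>a > 1\<close>.\<close>

lemma young_deficit_controls_distance:
  assumes a: "1 < a" "a \<le> b" and e: "0 < (e::real)"
  obtains C where "0 < C"
    "\<And>P r. a \<le> P \<Longrightarrow> P \<le> b \<Longrightarrow> \<bar>r - 1\<bar> powr P \<le> e + C * young_deficit P r"
proof -
  define h where "h = min e 1"
  have h: "0 < h" "h \<le> 1" "h \<le> e" using e by (auto simp: h_def)
  obtain R where R: "2 \<le> R" and Rb: "\<And>u P. R \<le> u \<Longrightarrow> a \<le> P \<Longrightarrow> 2 * b \<le> u powr (P - 1)"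
    by (rule powr_eventually_large[OF a(1), of "2 * b"]) blast
  define S where "S = {a..b} \<times> ({-R..R} \<inter> {r. h \<le> \<bar>r - 1\<bar>})"
  have "compact S" unfolding S_def
    by (intro compact_Times compact_Int_closed closed_Collect_le continuous_intros) auto
  moreover have "(a, 2) \<in> S" using a R h by (auto simp: S_def)
  moreover have "continuous_on S (\<lambda>(P, r). young_deficit P r)"
    unfolding young_deficit_def case_prod_unfold using a
    by (intro continuous_intros continuous_on_powr') (auto simp: S_def)
  ultimately obtain z where z: "z \<in> S" "\<And>w. w \<in> S \<Longrightarrow> young_deficit (fst z) (snd z) \<le> young_deficit (fst w) (snd w)"
    using continuous_attains_inf[of S "\<lambda>(P, r). young_deficit P r"]
    unfolding case_prod_unfold by blast
  define c where "c = young_deficit (fst z) (snd z)"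
  have c: "0 < c" unfolding c_def using z(1) a h by (intro young_deficit_pos) (auto simp: S_def)
  define C where "C = max ((R + 1) powr b / c) (2 powr b * (2 * b))"
  have C: "0 < C" using a by (auto simp: C_def less_max_iff_disj)
  have "\<bar>r - 1\<bar> powr P \<le> e + C * young_deficit P r" if P: "a \<le> P" "P \<le> b" for P r
  proof -
    have D: "0 \<le> young_deficit P r" using a P by (intro young_deficit_nonneg) simp
    consider "\<bar>r - 1\<bar> < h" | "h \<le> \<bar>r - 1\<bar>" "\<bar>r\<bar> \<le> R" | "R < \<bar>r\<bar>" by linarith
    then show ?thesis
    proof cases
      case 1
      have "\<bar>r - 1\<bar> powr P \<le> \<bar>r - 1\<bar> powr 1" using 1 h a P by (intro powr_mono') auto
      also have "\<dots> \<le> e" using 1 h by simp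
      finally show ?thesis using C D by (simp add: add_increasing2)
    next
      case 2
      then have "(P, r) \<in> S" using P by (auto simp: S_def)
      then have cD: "c \<le> young_deficit P r" using z(2)[of "(P, r)"] by (simp add: c_def)
      have "\<bar>r - 1\<bar> powr P \<le> (R + 1) powr P" using 2 a P by (intro powr_mono2) auto
      also have "\<dots> \<le> (R + 1) powr b" using R P by (intro powr_mono) auto
      also have "\<dots> = (R + 1) powr b / c * c" using c by simp
      also have "\<dots> \<le> C * young_deficit P r" using cD c C by (intro mult_mono) (auto simp: C_def)
      finally show ?thesis using e by simp
    next
      case 3
      have pos: "0 < \<bar>r\<bar>" using 3 R by linarith
      have "2 * P * \<bar>r\<bar> \<le> \<bar>r\<bar> powr (P - 1) * \<bar>r\<bar>"
        using Rb[of "\<bar>r\<bar>" P] 3 P pos by (intro mult_right_mono) auto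
      also have "\<dots> = \<bar>r\<bar> powr P" using powr_add[of "\<bar>r\<bar>" "P - 1" 1] pos by simp
      finally have "\<bar>r\<bar> \<le> \<bar>r\<bar> powr P / (2 * P)" using a P by (simp add: field_simps)
      moreover have "1 / P \<le> 1" using a P by simp
      moreover have "\<bar>r\<bar> powr P / P = 2 * (\<bar>r\<bar> powr P / (2 * P))" by simp
      ultimately have "\<bar>r\<bar> powr P / (2 * P) \<le> young_deficit P r"
        unfolding young_deficit_def by linarith
      then have "\<bar>r\<bar> powr P \<le> (2 * P) * young_deficit P r" using a P by (simp add: field_simps)
      also have "\<dots> \<le> (2 * b) * young_deficit P r" using P D by (intro mult_right_mono) auto
      finally have q: "\<bar>r\<bar> powr P \<le> (2 * b) * young_deficit P r" .
      have "\<bar>r - 1\<bar> powr P \<le> (2 * \<bar>r\<bar>) powr P" using 3 R a P by (intro powr_mono2) auto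
      also have "\<dots> = 2 powr P * \<bar>r\<bar> powr P" by (simp add: powr_mult)
      also have "\<dots> \<le> 2 powr b * ((2 * b) * young_deficit P r)" using P q by (intro mult_mono powr_mono) auto
      also have "\<dots> \<le> C * young_deficit P r" unfolding mult.assoc[symmetric]
        using D by (intro mult_right_mono) (auto simp: C_def mult.assoc)
      finally show ?thesis using e by simp
    qed
  qed
  then show thesis using that C by blast
qed


section \<open>A gap caused by uniform convexity\<close>

lemma integral_le_of_nn_integral_le:
  fixes f :: "'a \<Rightarrow> real"
  assumes [measurable]: "f \<in> borel_measurable M" and "AE t in M. 0 \<le> f t"
    and le: "(\<integral>\<^sup>+t. ennreal (f t) \<partial>M) \<le> ennreal c" and "0 \<le> c"
  shows "integrable M f" "(\<integral>t. f t \<partial>M) \<le> c"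
proof -
  show i: "integrable M f"
    using assms le_less_trans[OF le ennreal_less_top] by (intro integrableI_nonneg) auto
  show "(\<integral>t. f t \<partial>M) \<le> c"
    using nn_integral_eq_integral[OF i assms(2)] le assms(4) by (simp add: ennreal_le_iff)
qed

lemma enn2real_between:
  assumes "ennreal a \<le> u" "u \<le> ennreal b" "0 \<le> b"
  shows "a \<le> enn2real u" "enn2real u \<le> b" "u \<noteq> \<infinity>"
proof -
  show fin: "u \<noteq> \<infinity>" using assms(2) by (auto simp: top_unique)
  then have "u = ennreal (enn2real u)" by (simp add: less_top)
  then show "a \<le> enn2real u" "enn2real u \<le> b"
    using assms by (metis enn2real_nonneg ennreal_le_iff, metis ennreal_le_iff)
qed

context exponent
begin

lemma lux_norm_interp: "normed_fun_space.norm_of (luxemburg_norm M (nakano p)) = lux"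
  using lux_space by (simp add: normed_fun_space.norm_of_def luxemburg_norm_real fun_eq_iff)

lemma rho_finite_in_space:
  "x \<in> borel_measurable M \<Longrightarrow> rho x < \<infinity> \<Longrightarrow> x \<in> normed_fun_space.V (modular_funs M (nakano p))"
  unfolding normed_fun_space.V_def[OF lux_space] mem_Collect_eq modular_funs_real_iff
  by (auto intro: exI[of _ 1])

text \<open>The dual pair is \<open>y = (p / \<mu>(C))\<^bsup>1/p\<^esup>\<close> and \<open>\<phi> = y\<^bsup>p-1\<^esup> / K\<close> on \<open>C\<close> with \<open>K\<close> the integral of
  \<open>y\<^sup>p\<close>; the modular of \<open>y\<close> is one. Young's inequality with \<open>r = g / y\<close>, multiplied by \<open>y\<^sup>p\<close> and integrated, gives
  \<open>\<integral> \<phi> |g| \<le> 1\<close>, and its deficit is at most \<open>K (1 - \<integral> \<phi> g)\<close>. When \<open>\<integral> \<phi> g\<close> is close to one, the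
  deficit is small, so \<open>g - y\<close> is small on \<open>C\<close> and \<open>g - (\<integral> \<phi> g) y\<close> has norm little more than one. When
  it is close to \<open>-1\<close>, pass to \<open>-g\<close>. Otherwise the triangle inequality suffices.\<close>

lemma convexity_gap:
  assumes C [measurable]: "C \<in> sets M" and pos: "0 < emeasure M C" and fin: "emeasure M C < \<infinity>"
    and ab: "1 < a" "a \<le> b" and p: "\<And>t. t \<in> C \<Longrightarrow> ennreal a \<le> p t \<and> p t \<le> ennreal b"
  obtains y \<phi> :: "'a \<Rightarrow> real" and B d :: real where
    "y \<in> borel_measurable M" "\<phi> \<in> borel_measurable M"
    "\<forall>t. 0 \<le> \<phi> t \<and> \<phi> t \<le> B" "\<forall>t. t \<notin> C \<longrightarrow> \<phi> t = 0"
    "rho y \<le> 1" "(\<integral>t. \<phi> t * y t \<partial>M) = 1" "0 < d"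
    "\<forall>g\<in>borel_measurable M. rho g \<le> 1 \<longrightarrow>
       integrable M (\<lambda>t. \<phi> t * g t) \<and> (\<integral>t. \<bar>\<phi> t * g t\<bar> \<partial>M) \<le> 1"
    "\<forall>g\<in>borel_measurable M. rho g \<le> 1 \<longrightarrow> lux (\<lambda>t. g t - (\<integral>t. \<phi> t * g t \<partial>M) * y t) \<le> 2 - d"
proof -
  interpret F: normed_fun_space M "modular_funs M (nakano p)" "luxemburg_norm M (nakano p)"
    by (rule lux_space)
  note F_norm = lux_norm_interp
  define m where "m = measure M C"
  have m: "0 < m" using pos fin by (simp add: m_def measure_def enn2real_positive_iff)
  have em: "emeasure M C = ennreal m" using fin by (simp add: m_def emeasure_eq_ennreal_measure)
  define P where "P t = enn2real (p t)" for t
  have [measurable]: "P \<in> borel_measurable M" unfolding P_def by measurable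
  have P: "a \<le> P t" "P t \<le> b" "p t \<noteq> \<infinity>" if "t \<in> C" for t
    using enn2real_between[of a "p t" b] p[OF that] ab by (auto simp: P_def)
  have P1: "1 < P t" if "t \<in> C" for t using P(1)[OF that] ab by simp
  have iC: "integrable M (indicator C :: 'a \<Rightarrow> real)" using fin by (simp add: less_top)
  have iP: "integrable M (\<lambda>t. indicator C t * (P t / m))"
    by (rule Bochner_Integration.integrable_bound[OF integrable_mult_left[OF iC, of "b / m"]])
      (use P P1 m in \<open>force intro!: AE_I2 divide_right_mono simp: indicator_def\<close>)+
  define K where "K = (\<integral>t. indicator C t * (P t / m) \<partial>M)"
  have "(\<integral>t. indicator C t * (1 / m) \<partial>M) \<le> K"
    unfolding K_def
  proof (intro integral_mono iP integrable_mult_left iC)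
    fix t show "indicator C t * (1 / m) \<le> indicator C t * (P t / m)"
      using P1[of t] m by (cases "t \<in> C") (auto intro!: divide_right_mono)
  qed
  then have K: "1 \<le> K" using m by (simp add: m_def)
  define y where "y t = indicator C t * (P t / m) powr (1 / P t)" for t
  define \<phi> where "\<phi> t = indicator C t * (P t / m) powr (1 - 1 / P t) / K" for t
  have [measurable]: "y \<in> borel_measurable M" "\<phi> \<in> borel_measurable M"
    unfolding y_def \<phi>_def by measurable
  have y: "0 < y t" "y t powr P t = P t / m" "K * \<phi> t * y t = P t / m" if "t \<in> C" for t
  proof -
    show "0 < y t" using that P1[OF that] m by (simp add: y_def)
    show "y t powr P t = P t / m" using that P1[OF that] m by (simp add: y_def powr_powr)
    show "K * \<phi> t * y t = P t / m"
      using that P1[OF that] m K by (simp add: y_def \<phi>_def flip: powr_add)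
  qed
  have off: "y t = 0" "\<phi> t = 0" if "t \<notin> C" for t using that by (auto simp: y_def \<phi>_def)
  have phi0: "0 \<le> \<phi> t" for t using K by (simp add: \<phi>_def)
  define B where "B = max 1 (b / m)"
  have phiB: "\<phi> t \<le> B" for t
  proof (cases "t \<in> C")
    case True
    have e: "0 \<le> 1 - 1 / P t" "1 - 1 / P t \<le> 1" using P1[OF True] by auto
    have "(P t / m) powr (1 - 1 / P t) \<le> B powr (1 - 1 / P t)"
      using e P[OF True] P1[OF True] m by (intro powr_mono2) (auto simp: B_def divide_right_mono le_max_iff_disj)
    also have "\<dots> \<le> B powr 1" using e by (intro powr_mono) (auto simp: B_def)
    finally have le: "(P t / m) powr (1 - 1 / P t) \<le> B" by (simp add: B_def)
    have "\<phi> t \<le> (P t / m) powr (1 - 1 / P t)"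
      using True K by (simp add: \<phi>_def divide_le_eq mult_le_cancel_left1)
    then show ?thesis using le by simp
  qed (simp add: off B_def)
  have rho_y: "rho y \<le> 1"
  proof -
    have "rho y = (\<integral>\<^sup>+t. ennreal (1 / m) * indicator C t \<partial>M)"
      unfolding rho_def
    proof (intro nn_integral_cong)
      fix t
      show "nakano p t (ennreal \<bar>y t\<bar>) = ennreal (1 / m) * indicator C t"
        using y(1,2)[of t] P(3)[of t] P1[of t] off(1)[of t]
        by (cases "t \<in> C") (auto simp: nakano_finite_exponent simp flip: P_def)
    qed
    also have "\<dots> = 1"
      using m by (subst nn_integral_cmult_indicator) (auto simp: em simp flip: ennreal_mult)
    finally show ?thesis by simp
  qed
  have y_V: "y \<in> F.V" using rho_y by (intro rho_finite_in_space) (auto intro: le_less_trans)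
  have lux_y: "lux y \<le> 1" using rho_y by (intro lux_le) auto
  have int_phi_y: "(\<integral>t. \<phi> t * y t \<partial>M) = 1"
  proof -
    have "(\<integral>t. \<phi> t * y t \<partial>M) = (\<integral>t. (indicator C t * (P t / m)) / K \<partial>M)"
    proof (rule Bochner_Integration.integral_cong[OF refl])
      fix t
      have "indicator C t * (P t / m) = K * (\<phi> t * y t)"
        using y(3)[of t] off[of t] by (cases "t \<in> C") (auto simp: mult.assoc)
      then show "\<phi> t * y t = (indicator C t * (P t / m)) / K" using K by simp
    qed
    also have "\<dots> = K / K" unfolding K_def by simp
    finally show ?thesis using K by simp
  qed
  define G where "G g t = indicator C t * (\<bar>g t\<bar> powr P t / P t)" for g :: "'a \<Rightarrow> real" and t
  have G_meas [measurable]: "G g \<in> borel_measurable M" if [measurable]: "g \<in> borel_measurable M" for g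
    unfolding G_def by measurable
  have G: "integrable M (G g)" "(\<integral>t. G g t \<partial>M) \<le> 1"
    if [measurable]: "g \<in> borel_measurable M" and g: "rho g \<le> 1" for g
  proof -
    have "(\<integral>\<^sup>+t. ennreal (G g t) \<partial>M) \<le> rho g" unfolding rho_def
    proof (intro nn_integral_mono)
      fix t show "ennreal (G g t) \<le> nakano p t (ennreal \<bar>g t\<bar>)"
        using P(3)[of t] by (cases "t \<in> C") (auto simp: G_def nakano_finite_exponent simp flip: P_def)
    qed
    then have le: "(\<integral>\<^sup>+t. ennreal (G g t) \<partial>M) \<le> ennreal 1" using g by simp
    have nn: "AE t in M. 0 \<le> G g t" using P1 by (auto simp: G_def indicator_def intro!: AE_I2 divide_nonneg_pos dest: P1)
    show "integrable M (G g)" "(\<integral>t. G g t \<partial>M) \<le> 1"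
      using integral_le_of_nn_integral_le[OF _ nn le] by auto
  qed
  \<comment> \<open>the deficit in the inequality of Young between \<open>g / y\<close> and 1, weighted by \<open>y\<^sup>p\<close>\<close>
  define H where "H g t = indicator C t * ((P t / m) * young_deficit (P t) (g t / y t))" for g :: "'a \<Rightarrow> real" and t
  have H_eq: "H g t = G g t + indicator C t * (P t / m) - indicator C t * (1 / m) - K * (\<phi> t * g t)" for g t
  proof (cases "t \<in> C")
    case True
    note yt = y[OF True] and Pt = P1[OF True]
    have 1: "(P t / m) * (\<bar>g t / y t\<bar> powr P t / P t) = \<bar>g t\<bar> powr P t / P t"
      using yt Pt m by (simp add: powr_divide)
    have 2: "(P t / m) * (g t / y t) = K * (\<phi> t * g t)"
      unfolding yt(3)[symmetric] using yt(1) by simp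
    have "(P t / m) * young_deficit (P t) (g t / y t) =
      (P t / m) * (\<bar>g t / y t\<bar> powr P t / P t) + P t / m - (P t / m) * (1 / P t) - (P t / m) * (g t / y t)"
      unfolding young_deficit_def by (simp add: algebra_simps)
    then show ?thesis unfolding H_def G_def 1 2 using True Pt by simp
  qed (simp add: H_def G_def off)
  have H_nonneg: "0 \<le> H g t" for g t
    using young_deficit_nonneg[OF P1] P1 m by (fastforce simp: H_def indicator_def)
  have pairing: "integrable M (\<lambda>t. \<phi> t * g t)" "(\<integral>t. \<bar>\<phi> t * g t\<bar> \<partial>M) \<le> 1"
    if [measurable]: "g \<in> borel_measurable M" and g: "rho g \<le> 1" for g
  proof -
    define U where "U t = (G g t + indicator C t * (P t / m) - indicator C t * (1 / m)) / K" for t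
    have iU: "integrable M U" unfolding U_def using G(1)[OF that] iP iC by (intro integrable_divide Bochner_Integration.integrable_diff Bochner_Integration.integrable_add integrable_mult_left) auto
    have bound: "\<bar>\<phi> t * g t\<bar> \<le> U t" for t
    proof -
      have "G (\<lambda>t. \<bar>g t\<bar>) t = G g t" by (simp add: G_def)
      then have "K * (\<phi> t * \<bar>g t\<bar>) \<le> G g t + indicator C t * (P t / m) - indicator C t * (1 / m)"
        using H_nonneg[of "\<lambda>t. \<bar>g t\<bar>" t] H_eq[of "\<lambda>t. \<bar>g t\<bar>" t] by simp
      then show ?thesis using K phi0[of t] by (simp add: U_def abs_mult field_simps)
    qed
    show i: "integrable M (\<lambda>t. \<phi> t * g t)"
      using bound by (intro Bochner_Integration.integrable_bound[OF iU]) (auto intro!: AE_I2 intro: order_trans[OF bound abs_ge_self])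
    have "(\<integral>t. \<bar>\<phi> t * g t\<bar> \<partial>M) \<le> (\<integral>t. U t \<partial>M)"
      using i iU bound by (intro integral_mono) auto
    also have "\<dots> = ((\<integral>t. G g t \<partial>M) + K - 1) / K"
      unfolding U_def K_def using G(1)[OF that] iP iC m by (simp add: m_def)
    also have "\<dots> \<le> 1" using G(2)[OF that] K by simp
    finally show "(\<integral>t. \<bar>\<phi> t * g t\<bar> \<partial>M) \<le> 1" .
  qed
  define L where "L g = (\<integral>t. \<phi> t * g t \<partial>M)" for g
  have L1: "\<bar>L g\<bar> \<le> 1" if "g \<in> borel_measurable M" "rho g \<le> 1" for g
    using pairing(2)[OF that] integral_abs_bound[of M "\<lambda>t. \<phi> t * g t"] unfolding L_def by linarith
  have H_int: "integrable M (H g)" "(\<integral>t. H g t \<partial>M) \<le> K * (1 - L g)"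
    if g: "g \<in> borel_measurable M" "rho g \<le> 1" for g
  proof -
    show "integrable M (H g)" unfolding H_eq using G(1)[OF g] iP iC pairing(1)[OF g]
      by (intro Bochner_Integration.integrable_diff Bochner_Integration.integrable_add integrable_mult_left integrable_mult_right) auto
    have "(\<integral>t. H g t \<partial>M) = (\<integral>t. G g t \<partial>M) + K - 1 - K * L g"
      unfolding H_eq K_def L_def using G(1)[OF g] iP iC pairing(1)[OF g] m by (simp add: m_def)
    then show "(\<integral>t. H g t \<partial>M) \<le> K * (1 - L g)" using G(2)[OF g] by (simp add: algebra_simps)
  qed
  \<comment> \<open>chosen so that each of the two error terms in the modular of \<open>4 (g - y)\<close> is at most one half\<close>
  define e where "e = 1 / (2 * 4 powr b)"
  have e: "0 < e" by (simp add: e_def)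
  obtain D where D: "0 < D"
    "\<And>P r. a \<le> P \<Longrightarrow> P \<le> b \<Longrightarrow> \<bar>r - 1\<bar> powr P \<le> e + D * young_deficit P r"
    using young_deficit_controls_distance[OF ab e] by blast
  define d where "d = min (1 / 4) (1 / (2 * 4 powr b * D * K))"
  have d: "0 < d" "d \<le> 1 / 4" using D(1) K by (auto simp: d_def)
  have dK: "4 powr b * (D * (K * d)) \<le> 1 / 2"
  proof -
    have "4 powr b * (D * (K * d)) \<le> 4 powr b * (D * (K * (1 / (2 * 4 powr b * D * K))))"
      using D(1) K by (intro mult_left_mono) (auto simp: d_def)
    also have "\<dots> = 1 / 2" using D(1) K by (simp add: field_simps)
    finally show ?thesis .
  qed
  \<comment> \<open>on \<open>C\<close> the error \<open>g - y\<close> has norm at most 1/4, and so has \<open>(1 - L g) y\<close>; off \<open>C\<close> nothing changes\<close>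
  have near: "lux (\<lambda>t. g t - L g * y t) \<le> 3 / 2"
    if [measurable]: "g \<in> borel_measurable M" and g: "rho g \<le> 1" and Lg: "1 - d \<le> L g" for g
  proof -
    define w where "w t = indicator C t * (g t - y t)" for t
    have [measurable]: "w \<in> borel_measurable M" unfolding w_def by measurable
    define W where "W t = 4 powr b * (e * (indicator C t * (1 / m)) + D * H g t)" for t
    have iW: "integrable M W" unfolding W_def using iC H_int(1)[OF that(1) g] by simp
    have "rho (\<lambda>t. w t / (1 / 4)) \<le> (\<integral>\<^sup>+t. ennreal (W t) \<partial>M)"
      unfolding rho_def
    proof (intro nn_integral_mono)
      fix t
      show "nakano p t (ennreal \<bar>w t / (1 / 4)\<bar>) \<le> ennreal (W t)"
      proof (cases "t \<in> C")
        case True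
        note yt = y[OF True] and Pt = P1[OF True] P[OF True]
        have "\<bar>w t / (1 / 4)\<bar> = 4 * (y t * \<bar>g t / y t - 1\<bar>)"
        proof -
          have "y t * \<bar>g t / y t - 1\<bar> = \<bar>y t * (g t / y t - 1)\<bar>" using yt by (simp add: abs_mult)
          also have "\<dots> = \<bar>g t - y t\<bar>" using yt by (simp add: right_diff_distrib)
          finally show ?thesis using True by (auto simp: w_def abs_if)
        qed
        then have "\<bar>w t / (1 / 4)\<bar> powr P t / P t =
            4 powr P t * ((P t / m) * \<bar>g t / y t - 1\<bar> powr P t) / P t"
          using yt by (simp add: powr_mult)
        also have "\<dots> = 4 powr P t * (\<bar>g t / y t - 1\<bar> powr P t * (1 / m))" using Pt by simp
        also have "\<dots> \<le> 4 powr b * ((e + D * young_deficit (P t) (g t / y t)) * (1 / m))"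
          using D(2)[of "P t" "g t / y t"] Pt m by (intro mult_mono powr_mono mult_right_mono) auto
        also have "\<dots> \<le> W t"
        proof -
          have "young_deficit (P t) (g t / y t) * (1 / m) \<le> young_deficit (P t) (g t / y t) * (P t / m)"
            using young_deficit_nonneg[OF Pt(1)] Pt m by (intro mult_left_mono divide_right_mono) auto
          also have "\<dots> = H g t" using True by (simp add: H_def)
          finally have "D * (young_deficit (P t) (g t / y t) * (1 / m)) \<le> D * H g t"
            using D(1) by (intro mult_left_mono) auto
          then show ?thesis using True unfolding W_def
            by (intro mult_left_mono) (simp_all add: add_divide_distrib)
        qed
        finally show ?thesis using Pt by (simp add: nakano_finite_exponent ennreal_leI flip: P_def)
      qed (simp add: w_def)
    qed
    also have "\<dots> = ennreal (\<integral>t. W t \<partial>M)"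
    proof (intro nn_integral_eq_integral[OF iW] AE_I2)
      fix t show "0 \<le> W t" using H_nonneg[of g t] D(1) e m by (simp add: W_def)
    qed
    finally have rho_w_le: "rho (\<lambda>t. w t / (1 / 4)) \<le> ennreal (\<integral>t. W t \<partial>M)" .
    have "(\<integral>t. W t \<partial>M) = 4 powr b * (e + D * (\<integral>t. H g t \<partial>M))"
      unfolding W_def using iC H_int(1)[OF that(1) g] m by (simp add: m_def)
    also have "4 powr b * (e + D * (\<integral>t. H g t \<partial>M)) \<le> 1"
    proof -
      have "(\<integral>t. H g t \<partial>M) \<le> K * d"
        using H_int(2)[OF that(1) g] mult_left_mono[of "1 - L g" d K] Lg K by linarith
      then have "4 powr b * (D * (\<integral>t. H g t \<partial>M)) \<le> 4 powr b * (D * (K * d))"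
        using D(1) by (intro mult_left_mono) auto
      moreover have "4 powr b * e = 1 / 2" by (simp add: e_def)
      ultimately show ?thesis unfolding distrib_left using dK by linarith
    qed
    finally have "ennreal (\<integral>t. W t \<partial>M) \<le> 1" by (simp add: ennreal_le_1)
    then have rho_w: "rho (\<lambda>t. w t / (1 / 4)) \<le> 1" by (rule order_trans[OF rho_w_le])
    have lux_w: "lux w \<le> 1 / 4" using rho_w by (intro lux_le) auto
    have "(\<lambda>t. w t / (1 / 4)) \<in> F.V" using rho_w by (intro rho_finite_in_space) (auto intro: le_less_trans)
    from F.V_scale[OF this, of "1/4"] have w_V: "w \<in> F.V" by simp
    define v where "v t = indicator (- C) t * g t" for t
    have v_meas: "v \<in> borel_measurable M"
    proof -
      have "v = (\<lambda>t. g t - indicator C t * g t)" by (auto simp: v_def indicator_def)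
      then show ?thesis by simp
    qed
    have "rho v \<le> rho g" by (intro rho_mono AE_I2) (auto simp: v_def indicator_def)
    then have rho_v: "rho v \<le> 1" using g by simp
    have v_V: "v \<in> F.V" using rho_v v_meas by (intro rho_finite_in_space) (auto intro: le_less_trans)
    have lux_v: "lux v \<le> 1" using rho_v by (intro lux_le) auto
    have split: "(\<lambda>t. g t - L g * y t) = (\<lambda>t. (v t + w t) + (1 - L g) * y t)"
      using off by (auto simp: v_def w_def indicator_def algebra_simps)
    have "lux (\<lambda>t. g t - L g * y t) \<le> lux v + lux w + \<bar>1 - L g\<bar> * lux y"
      unfolding split
      using F.norm_triangle[OF F.V_add[OF v_V w_V] F.V_scale[OF y_V, of "1 - L g"]]
        F.norm_triangle[OF v_V w_V] F.norm_scale[OF y_V, of "1 - L g"] by (simp add: F_norm)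
    also have "\<bar>1 - L g\<bar> * lux y \<le> 1 / 4 * 1"
      using L1[OF that(1) g] Lg d lux_y F.norm_nonneg[OF y_V] by (intro mult_mono) (auto simp: F_norm)
    finally show ?thesis using lux_v lux_w by simp
  qed
  have gap: "lux (\<lambda>t. g t - L g * y t) \<le> 2 - d"
    if [measurable]: "g \<in> borel_measurable M" and g: "rho g \<le> 1" for g
  proof -
    have g_V: "g \<in> F.V" using g by (intro rho_finite_in_space) (auto intro: le_less_trans)
    have neg: "rho (\<lambda>t. - g t) = rho g" "L (\<lambda>t. - g t) = - L g" by (simp_all add: rho_def L_def)
    consider "1 - d \<le> L g" | "1 - d \<le> - L g" | "\<bar>L g\<bar> \<le> 1 - d" by linarith
    then show ?thesis
    proof cases
      case 1
      then show ?thesis using near[OF that] d by simp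
    next
      case 2
      have eq: "(\<lambda>t. g t - L g * y t) = (\<lambda>t. (-1) * (- g t - (- L g) * y t))" by auto
      have V: "(\<lambda>t. - g t - (- L g) * y t) \<in> F.V"
        using F.V_diff[OF F.V_scale[OF g_V, of "-1"] F.V_scale[OF y_V, of "- L g"]] by simp
      have "lux (\<lambda>t. - g t - (- L g) * y t) \<le> 3 / 2"
        using near[of "\<lambda>t. - g t"] 2 g by (simp add: neg)
      then show ?thesis unfolding eq using F.norm_scale[OF V, of "-1"] d by (simp add: F_norm)
    next
      case 3
      have "lux (\<lambda>t. g t + (- L g) * y t) \<le> lux g + \<bar>L g\<bar> * lux y"
        using F.norm_triangle[OF g_V F.V_scale[OF y_V, of "- L g"]] F.norm_scale[OF y_V, of "- L g"]
        by (simp add: F_norm)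
      also have "\<dots> \<le> 1 + (1 - d) * 1"
        using 3 lux_y F.norm_nonneg[OF y_V] lux_le[of 1 g] g
        by (intro add_mono mult_mono) (auto simp: F_norm)
      finally show ?thesis by simp
    qed
  qed
  show thesis
    by (rule that[of y \<phi> B d])
      (use phi0 phiB off rho_y int_phi_y d pairing gap in \<open>auto simp: L_def\<close>)
qed

end


section \<open>The Orlicz norm\<close>

definition conj_exp :: "('a \<Rightarrow> ennreal) \<Rightarrow> 'a \<Rightarrow> ennreal" where
  "conj_exp p t = (if p t = 1 then \<infinity> else if p t = \<infinity> then 1
     else ennreal (enn2real (p t) / (enn2real (p t) - 1)))"

lemma conj_exp_unique:
  assumes "1 \<le> p t" "1 / p t + 1 / q t = 1"
  shows "q t = conj_exp p t"
proof -
  consider "p t = 1" | "p t = \<infinity>" | P where "p t = ennreal P" "1 < P"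
    using assms(1) by (cases "p t") (auto simp: ennreal_le_iff2 less_le simp flip: ennreal_1)
  then show ?thesis
  proof cases
    case 1
    then have "1 + 1 / q t = 1 + 0" using assms(2) by simp
    then have "1 / q t = 0" by (subst (asm) ennreal_add_left_cancel) auto
    then show ?thesis using 1 by (simp add: conj_exp_def ennreal_divide_eq_0_iff)
  next
    case 2
    then have q1: "1 / q t = 1" using assms(2) by simp
    then have "q t \<noteq> 0" "q t \<noteq> \<infinity>" by (auto simp: ennreal_divide_zero)
    then obtain Q where Q: "q t = ennreal Q" "0 < Q" by (cases "q t") (auto simp: less_le)
    then have "ennreal (1 / Q) = 1" using q1 divide_ennreal[of 1 Q] by simp
    then show ?thesis using 2 Q by (simp add: conj_exp_def ennreal_eq_1)
  next
    case 3
    have "q t \<noteq> 0" using assms(2) by (auto simp: ennreal_divide_zero)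
    moreover have "q t \<noteq> \<infinity>"
    proof
      assume "q t = \<infinity>"
      then have "ennreal (1 / P) = 1"
        using assms(2) 3 divide_ennreal[of 1 P] by simp
      then show False using 3 by (simp add: ennreal_eq_1)
    qed
    ultimately obtain Q where Q: "q t = ennreal Q" "0 < Q"
      by (cases "q t") (auto simp: less_le)
    have "ennreal (1 / P) + ennreal (1 / Q) = 1"
      using assms(2) 3 Q divide_ennreal[of 1 P] divide_ennreal[of 1 Q] by simp
    then have "ennreal (1 / P + 1 / Q) = 1" using 3 Q by simp
    then have "1 / P + 1 / Q = 1" by (simp add: ennreal_eq_1)
    then have "Q = P / (P - 1)" using 3 Q by (simp add: field_simps)
    then show ?thesis using 3 Q by (simp add: conj_exp_def ennreal_eq_1)
  qed
qed

lemma conj_exp_ge_1: "1 \<le> p t \<Longrightarrow> 1 \<le> conj_exp p t"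
proof -
  assume "1 \<le> p t"
  then consider "p t = 1" | "p t = \<infinity>" | P where "p t = ennreal P" "1 < P"
    by (cases "p t") (auto simp: ennreal_le_iff2 less_le simp flip: ennreal_1)
  then show ?thesis
    by cases (auto simp: conj_exp_def ennreal_eq_1 field_simps simp flip: ennreal_1 intro!: ennreal_leI)
qed

lemma nakano_young:
  assumes "1 \<le> p t" "0 \<le> a" "0 \<le> b"
  shows "ennreal (a * b) \<le> nakano p t (ennreal a) + nakano (conj_exp p) t (ennreal b)"
proof -
  consider "p t = 1" | "p t = \<infinity>" | P where "p t = ennreal P" "1 < P"
    using assms(1) by (cases "p t") (auto simp: ennreal_le_iff2 less_le simp flip: ennreal_1)
  then show ?thesis
  proof cases
    case 1
    have "ennreal (a * b) \<le> ennreal a" if "b \<le> 1" using that assms by (intro ennreal_leI) (simp add: mult_left_le)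
    then show ?thesis using 1 assms
      by (auto simp: nakano_infinite_exponent nakano_finite_exponent conj_exp_def ennreal_le_1 top_add)
  next
    case 2
    have "ennreal (a * b) \<le> ennreal b" if "a \<le> 1" using that assms by (intro ennreal_leI) (simp add: mult_left_le_one_le)
    then show ?thesis using 2 assms
      by (auto simp: nakano_infinite_exponent nakano_finite_exponent conj_exp_def ennreal_le_1 top_add)
  next
    case 3
    define Q where "Q = P / (P - 1)"
    have Q: "1 < Q" "1 / P + 1 / Q = 1" "conj_exp p t = ennreal Q" using 3
      by (auto simp: Q_def conj_exp_def ennreal_eq_1 field_simps)
    have "a * b \<le> a powr P / P + b powr Q / Q"
      using 3 Q assms by (intro Youngs_inequality) auto
    then show ?thesis using 3 Q assms
      by (simp add: nakano_finite_exponent ennreal_leI flip: ennreal_plus)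
  qed
qed

locale sigma_finite_exponent = exponent M p + sigma_finite_measure M
  for M :: "'a measure" and p :: "'a \<Rightarrow> ennreal"
begin

lemma conj_exponent: "exponent M (conj_exp p)"
proof
  have "(\<lambda>t. if p t = 1 then \<infinity> else if p t = \<infinity> then 1
      else ennreal (enn2real (p t) / (enn2real (p t) - 1))) \<in> borel_measurable M"
    by measurable
  then show "conj_exp p \<in> borel_measurable M" by (simp add: conj_exp_def[abs_def])
  show "1 \<le> conj_exp p t" if "t \<in> space M" for t by (rule conj_exp_ge_1[of p t, OF p_ge_1[OF that]])
qed

text \<open>The supremum that defines the Orlicz norm, over real-valued test functions. It is kept as an
  extended value since \<open>enn2real\<close> maps an infinite supremum to zero; \<open>osup_finite\<close> rules that out.\<close>

definition osup :: "('a \<Rightarrow> real) \<Rightarrow> ennreal" where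
  "osup x = (SUP g\<in>{g \<in> borel_measurable M. rho g \<le> 1}. \<integral>\<^sup>+t. ennreal \<bar>x t * g t\<bar> \<partial>M)"

definition orl :: "('a \<Rightarrow> real) \<Rightarrow> real" where
  "orl x = enn2real (osup x)"

lemma orl_nonneg: "0 \<le> orl x"
  by (simp add: orl_def)

lemma osup_upper: "g \<in> borel_measurable M \<Longrightarrow> rho g \<le> 1 \<Longrightarrow> (\<integral>\<^sup>+t. ennreal \<bar>x t * g t\<bar> \<partial>M) \<le> osup x"
  unfolding osup_def by (intro SUP_upper) auto

lemma osup_least:
  "(\<And>g. g \<in> borel_measurable M \<Longrightarrow> rho g \<le> 1 \<Longrightarrow> (\<integral>\<^sup>+t. ennreal \<bar>x t * g t\<bar> \<partial>M) \<le> c) \<Longrightarrow> osup x \<le> c"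
  unfolding osup_def by (intro SUP_least) auto

text \<open>Test functions of modular at most one are finite almost everywhere, so real-valued ones suffice.\<close>

lemma orlicz_norm_real: "orlicz_norm M (nakano p) (\<lambda>t. ereal (x t)) = orl x"
proof -
  have "(SUP g\<in>{g \<in> borel_measurable M. modular M (nakano p) g \<le> 1}. \<integral>\<^sup>+t. e2ennreal \<bar>ereal (x t) * g t\<bar> \<partial>M) = osup x"
  proof (rule antisym)
    show "osup x \<le> (SUP g\<in>{g \<in> borel_measurable M. modular M (nakano p) g \<le> 1}. \<integral>\<^sup>+t. e2ennreal \<bar>ereal (x t) * g t\<bar> \<partial>M)"
    proof (rule osup_least)
      fix g assume "g \<in> borel_measurable M" "rho g \<le> 1"
      then show "(\<integral>\<^sup>+t. ennreal \<bar>x t * g t\<bar> \<partial>M) \<le> (SUP g\<in>{g \<in> borel_measurable M. modular M (nakano p) g \<le> 1}. \<integral>\<^sup>+t. e2ennreal \<bar>ereal (x t) * g t\<bar> \<partial>M)"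
        by (intro SUP_upper2[of "\<lambda>t. ereal (g t)"]) (auto simp: modular_rho)
    qed
    show "(SUP g\<in>{g \<in> borel_measurable M. modular M (nakano p) g \<le> 1}. \<integral>\<^sup>+t. e2ennreal \<bar>ereal (x t) * g t\<bar> \<partial>M) \<le> osup x"
    proof (rule SUP_least)
      fix g assume "g \<in> {g \<in> borel_measurable M. modular M (nakano p) g \<le> 1}"
      then have g [measurable]: "g \<in> borel_measurable M" and le: "modular M (nakano p) g \<le> 1" by auto
      have "modular M (nakano p) (\<lambda>t. ereal 1 * g t) < \<infinity>"
        using le by (simp add: one_ereal_def[symmetric] le_less_trans[OF _ ennreal_one_less_top])
      then have "g \<in> modular_funs M (nakano p)"
        unfolding modular_funs_def using g by (intro CollectI conjI exI[of _ "1::real"]) auto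
      from modular_funs_finite[OF this] have eq: "AE t in M. ereal (real_of_ereal (g t)) = g t"
        by eventually_elim (auto simp: ereal_real)
      have "rho (\<lambda>t. real_of_ereal (g t)) \<le> 1"
        using modular_cong[OF eq, of "nakano p"] le by (simp add: modular_rho)
      then have "(\<integral>\<^sup>+t. ennreal \<bar>x t * real_of_ereal (g t)\<bar> \<partial>M) \<le> osup x"
        by (intro osup_upper) auto
      moreover have "(\<integral>\<^sup>+t. e2ennreal \<bar>ereal (x t) * g t\<bar> \<partial>M) = (\<integral>\<^sup>+t. ennreal \<bar>x t * real_of_ereal (g t)\<bar> \<partial>M)"
      proof (rule nn_integral_cong_AE, use eq in eventually_elim)
        case (elim t)
        then show ?case by (cases "g t") auto
      qed
      ultimately show "(\<integral>\<^sup>+t. e2ennreal \<bar>ereal (x t) * g t\<bar> \<partial>M) \<le> osup x" by simp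
    qed
  qed
  then show ?thesis by (simp add: orlicz_norm_def orl_def)
qed

text \<open>The inequality of Young bounds the integral of \<open>c x g\<close> by the sum of the two modulars.\<close>

lemma osup_finite:
  assumes x: "(\<lambda>t. ereal (x t)) \<in> modular_funs M (nakano (conj_exp p))"
  shows "osup x < \<infinity>"
proof -
  interpret Q: exponent M "conj_exp p" by (rule conj_exponent)
  obtain c where c: "0 < c" "Q.rho (\<lambda>t. c * x t) < \<infinity>" and [measurable]: "x \<in> borel_measurable M"
    using x Q.modular_funs_real_iff by auto
  have "osup x \<le> ennreal (1 / c) * (1 + Q.rho (\<lambda>t. c * x t))"
  proof (rule osup_least)
    fix g assume [measurable]: "g \<in> borel_measurable M" and g: "rho g \<le> 1"
    have "(\<integral>\<^sup>+t. ennreal \<bar>x t * g t\<bar> \<partial>M) = (\<integral>\<^sup>+t. ennreal (1 / c) * ennreal (\<bar>g t\<bar> * \<bar>c * x t\<bar>) \<partial>M)"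
      using c(1) by (intro nn_integral_cong) (simp add: abs_mult flip: ennreal_mult)
    also have "\<dots> = ennreal (1 / c) * (\<integral>\<^sup>+t. ennreal (\<bar>g t\<bar> * \<bar>c * x t\<bar>) \<partial>M)"
      by (intro nn_integral_cmult) auto
    also have "(\<integral>\<^sup>+t. ennreal (\<bar>g t\<bar> * \<bar>c * x t\<bar>) \<partial>M) \<le>
      (\<integral>\<^sup>+t. nakano p t (ennreal \<bar>g t\<bar>) + nakano (conj_exp p) t (ennreal \<bar>c * x t\<bar>) \<partial>M)"
      using p_ge_1 by (intro nn_integral_mono nakano_young) auto
    also have "\<dots> = rho g + Q.rho (\<lambda>t. c * x t)"
      unfolding rho_def Q.rho_def by (intro nn_integral_add) (auto intro!: measurable_nakano)
    also have "\<dots> \<le> 1 + Q.rho (\<lambda>t. c * x t)" using g by (intro add_right_mono)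
    finally show "(\<integral>\<^sup>+t. ennreal \<bar>x t * g t\<bar> \<partial>M) \<le> ennreal (1 / c) * (1 + Q.rho (\<lambda>t. c * x t))"
      by (simp add: mult_left_mono)
  qed
  also have "\<dots> < \<infinity>" using c by (auto simp: ennreal_mult_less_top)
  finally show ?thesis .
qed

lemma osup_orl: "(\<lambda>t. ereal (x t)) \<in> modular_funs M (nakano (conj_exp p)) \<Longrightarrow> osup x = ennreal (orl x)"
  unfolding orl_def by (subst ennreal_enn2real) (use osup_finite[of x] in auto)

text \<open>On a \<open>\<sigma>\<close>-finite space there is a test function that vanishes nowhere: a strictly positive \<open>w \<le> 1\<close>
  with integral at most one has modular at most one for every exponent.\<close>

lemma osup_definite:
  assumes [measurable]: "x \<in> borel_measurable M" and z: "osup x = 0"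
  shows "AE t in M. x t = 0"
proof -
  obtain w :: "'a \<Rightarrow> real" where w [measurable]: "w \<in> borel_measurable M" and w01: "\<And>t. 0 < w t" "\<And>t. w t \<le> 1"
    and iw: "integrable M w" by (rule obtain_positive_integrable_function) blast
  define c where "c = 1 / (1 + (\<integral>t. w t \<partial>M))"
  have iw0: "0 \<le> (\<integral>t. w t \<partial>M)" using w01 by (intro integral_nonneg_AE AE_I2 less_imp_le)
  have c: "0 < c" "c \<le> 1" "c * (\<integral>t. w t \<partial>M) \<le> 1" using iw0 by (auto simp: c_def field_simps)
  have "rho (\<lambda>t. c * w t) \<le> (\<integral>\<^sup>+t. ennreal (c * w t) \<partial>M)"
    unfolding rho_def
  proof (intro nn_integral_mono)
    fix t assume t: "t \<in> space M"
    have cw: "0 < c * w t" "c * w t \<le> 1" using c w01[of t] mult_le_one[of c "w t"] by (auto simp: less_imp_le)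
    show "nakano p t (ennreal \<bar>c * w t\<bar>) \<le> ennreal (c * w t)"
    proof (cases "p t = \<infinity>")
      case True
      then show ?thesis using cw by (simp add: nakano_infinite_exponent ennreal_le_1)
    next
      case False
      define P where "P = enn2real (p t)"
      have P: "1 \<le> P" using enn2real_mono[of 1 "p t"] p_ge_1[OF t] False by (simp add: P_def less_top)
      have "(c * w t) powr P / P \<le> (c * w t) powr P / 1" using P by (intro divide_left_mono) auto
      also have "\<dots> \<le> (c * w t) powr 1" using powr_mono'[of 1 P "c * w t"] P cw by simp
      finally show ?thesis using False cw by (simp add: nakano_finite_exponent ennreal_leI flip: P_def)
    qed
  qed
  also have "\<dots> = ennreal (\<integral>t. c * w t \<partial>M)"
    using iw c w01 by (intro nn_integral_eq_integral) (auto simp: less_imp_le)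
  also have "\<dots> \<le> 1" using c by (simp add: ennreal_le_1)
  finally have "(\<integral>\<^sup>+t. ennreal \<bar>x t * (c * w t)\<bar> \<partial>M) \<le> 0"
    using osup_upper[of "\<lambda>t. c * w t" x] z by simp
  then have "AE t in M. ennreal \<bar>x t * (c * w t)\<bar> = 0" by (subst (asm) le_zero_eq, subst (asm) nn_integral_0_iff_AE) auto
  then show ?thesis by eventually_elim (use c w01 in \<open>auto simp: less_le\<close>)
qed

lemma osup_add:
  assumes [measurable]: "x \<in> borel_measurable M" "y \<in> borel_measurable M"
  shows "osup (\<lambda>t. x t + y t) \<le> osup x + osup y"
proof (rule osup_least)
  fix g assume [measurable]: "g \<in> borel_measurable M" and g: "rho g \<le> 1"
  have "(\<integral>\<^sup>+t. ennreal \<bar>(x t + y t) * g t\<bar> \<partial>M) \<le> (\<integral>\<^sup>+t. ennreal \<bar>x t * g t\<bar> + ennreal \<bar>y t * g t\<bar> \<partial>M)"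
    by (intro nn_integral_mono) (simp add: distrib_right ennreal_leI flip: ennreal_plus)
  also have "\<dots> = (\<integral>\<^sup>+t. ennreal \<bar>x t * g t\<bar> \<partial>M) + (\<integral>\<^sup>+t. ennreal \<bar>y t * g t\<bar> \<partial>M)"
    by (intro nn_integral_add) auto
  also have "\<dots> \<le> osup x + osup y" using g by (intro add_mono osup_upper) auto
  finally show "(\<integral>\<^sup>+t. ennreal \<bar>(x t + y t) * g t\<bar> \<partial>M) \<le> osup x + osup y" .
qed

lemma osup_scale:
  assumes [measurable]: "x \<in> borel_measurable M"
  shows "osup (\<lambda>t. c * x t) = ennreal \<bar>c\<bar> * osup x"
proof -
  have "(\<integral>\<^sup>+t. ennreal \<bar>c * x t * g t\<bar> \<partial>M) = ennreal \<bar>c\<bar> * (\<integral>\<^sup>+t. ennreal \<bar>x t * g t\<bar> \<partial>M)"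
    if [measurable]: "g \<in> borel_measurable M" for g
    by (simp add: abs_mult mult.assoc ennreal_mult nn_integral_cmult)
  then have "osup (\<lambda>t. c * x t) = (SUP g\<in>{g \<in> borel_measurable M. rho g \<le> 1}. ennreal \<bar>c\<bar> * (\<integral>\<^sup>+t. ennreal \<bar>x t * g t\<bar> \<partial>M))"
    unfolding osup_def by (intro SUP_cong) auto
  also have "\<dots> = ennreal \<bar>c\<bar> * osup x"
    unfolding osup_def by (simp add: SUP_mult_left_ennreal)
  finally show ?thesis .
qed

lemma orl_space: "normed_fun_space M (modular_funs M (nakano (conj_exp p))) (orlicz_norm M (nakano p))"
proof -
  interpret Q: exponent M "conj_exp p" by (rule conj_exponent)
  interpret Q: normed_fun_space M "modular_funs M (nakano (conj_exp p))" "luxemburg_norm M (nakano (conj_exp p))"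
    by (rule Q.lux_space)
  let ?K = "modular_funs M (nakano (conj_exp p))" and ?N = "orlicz_norm M (nakano p)"
  have meas: "x \<in> borel_measurable M" if "(\<lambda>t. ereal (x t)) \<in> ?K" for x
    using that Q.modular_funs_real_iff by auto
  show ?thesis
  proof
    fix f g :: "'a \<Rightarrow> ereal" and x y :: "'a \<Rightarrow> real" and c :: real
    show "f \<in> ?K \<Longrightarrow> f \<in> borel_measurable M" by (rule Q.K_measurable)
    show "f \<in> ?K \<Longrightarrow> AE t in M. \<bar>f t\<bar> \<noteq> \<infinity>" by (rule Q.K_finite)
    show "f \<in> ?K \<Longrightarrow> g \<in> borel_measurable M \<Longrightarrow> AE t in M. f t = g t \<Longrightarrow> g \<in> ?K" by (rule Q.K_cong)
    show "?N g = ?N f" if "AE t in M. f t = g t"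
    proof -
      have "(\<integral>\<^sup>+t. e2ennreal \<bar>g t * h t\<bar> \<partial>M) = (\<integral>\<^sup>+t. e2ennreal \<bar>f t * h t\<bar> \<partial>M)" for h
        using that by (intro nn_integral_cong_AE) auto
      then show ?thesis unfolding orlicz_norm_def by simp
    qed
    show "(\<lambda>t. 0) \<in> ?K" by (rule Q.K_zero)
    show "(\<lambda>t. ereal (x t)) \<in> ?K \<Longrightarrow> (\<lambda>t. ereal (y t)) \<in> ?K \<Longrightarrow> (\<lambda>t. ereal (x t + y t)) \<in> ?K"
      by (rule Q.K_add)
    show "(\<lambda>t. ereal (x t)) \<in> ?K \<Longrightarrow> (\<lambda>t. ereal (c * x t)) \<in> ?K"
      by (rule Q.K_scale)
    show "?N (\<lambda>t. ereal (x t + y t)) \<le> ?N (\<lambda>t. ereal (x t)) + ?N (\<lambda>t. ereal (y t))"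
      if x: "(\<lambda>t. ereal (x t)) \<in> ?K" and y: "(\<lambda>t. ereal (y t)) \<in> ?K"
    proof -
      have "ennreal (orl (\<lambda>t. x t + y t)) \<le> ennreal (orl x + orl y)"
        using osup_add[of x y] meas[OF x] meas[OF y]
        unfolding osup_orl[OF x] osup_orl[OF y] osup_orl[OF Q.K_add[OF x y]]
        by (simp add: orl_nonneg)
      moreover have "0 \<le> orl x + orl y" by (simp add: orl_nonneg)
      ultimately show ?thesis by (simp add: orlicz_norm_real ennreal_le_iff)
    qed
    show "?N (\<lambda>t. ereal (c * x t)) = \<bar>c\<bar> * ?N (\<lambda>t. ereal (x t))" if x: "(\<lambda>t. ereal (x t)) \<in> ?K"
      using osup_scale[OF meas[OF x], of c] unfolding orlicz_norm_real orl_def by (simp add: enn2real_mult)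
    show "AE t in M. x t = 0" if x: "(\<lambda>t. ereal (x t)) \<in> ?K" and "?N (\<lambda>t. ereal (x t)) = 0"
      using osup_definite[OF meas[OF x]] osup_orl[OF x] that(2) by (simp add: orlicz_norm_real)
  qed
qed

lemma orl_norm_interp: "normed_fun_space.norm_of (orlicz_norm M (nakano p)) = orl"
  using orl_space by (simp add: normed_fun_space.norm_of_def orlicz_norm_real fun_eq_iff)

lemma orlicz_hoelder:
  assumes x: "(\<lambda>t. ereal (x t)) \<in> modular_funs M (nakano (conj_exp p))"
    and g: "(\<lambda>t. ereal (g t)) \<in> modular_funs M (nakano p)"
  shows "integrable M (\<lambda>t. x t * g t)" "(\<integral>t. \<bar>x t * g t\<bar> \<partial>M) \<le> orl x * lux g"
proof -
  interpret Q: exponent M "conj_exp p" by (rule conj_exponent)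
  have [measurable]: "x \<in> borel_measurable M" using x unfolding Q.modular_funs_real_iff by blast
  have [measurable]: "g \<in> borel_measurable M" using g unfolding modular_funs_real_iff by blast
  have le: "(\<integral>\<^sup>+t. ennreal \<bar>x t * g t\<bar> \<partial>M) \<le> ennreal (orl x * c)" if c: "lux g < c" for c
  proof -
    have c0: "0 < c" using c lux_nonneg[OF g] by simp
    have "(\<integral>\<^sup>+t. ennreal \<bar>x t * g t\<bar> \<partial>M) = (\<integral>\<^sup>+t. ennreal c * ennreal \<bar>x t * (g t / c)\<bar> \<partial>M)"
      using c0 by (intro nn_integral_cong) (simp add: abs_mult flip: ennreal_mult)
    also have "\<dots> = ennreal c * (\<integral>\<^sup>+t. ennreal \<bar>x t * (g t / c)\<bar> \<partial>M)"
      by (intro nn_integral_cmult) auto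
    also have "\<dots> \<le> ennreal c * osup x"
      using lux_less[OF g c] by (intro mult_left_mono osup_upper) auto
    also have "\<dots> = ennreal (orl x * c)"
      using c0 by (simp add: osup_orl[OF x] ennreal_mult' mult.commute)
    finally show ?thesis .
  qed
  have "(\<integral>\<^sup>+t. ennreal (norm (x t * g t)) \<partial>M) < \<infinity>"
    using le[of "lux g + 1"] by (auto intro: le_less_trans)
  then show i: "integrable M (\<lambda>t. x t * g t)" by (intro integrableI_bounded) auto
  have le': "(\<integral>t. \<bar>x t * g t\<bar> \<partial>M) \<le> orl x * c" if "lux g < c" for c
  proof (rule integral_le_of_nn_integral_le(2)[OF _ _ le[OF that]])
    show "0 \<le> orl x * c" using that lux_nonneg[OF g] by (intro mult_nonneg_nonneg) (auto simp: orl_nonneg)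
  qed auto
  have "(\<integral>t. \<bar>x t * g t\<bar> \<partial>M) \<le> orl x * lux g + e" if e: "0 < e" for e
  proof -
    note o = orl_nonneg[of x]
    have "(\<integral>t. \<bar>x t * g t\<bar> \<partial>M) \<le> orl x * (lux g + e / (orl x + 1))"
      using e o by (intro le') (auto intro!: divide_pos_pos)
    also have "\<dots> \<le> orl x * lux g + e"
      using e o by (simp add: distrib_left field_simps)
    finally show ?thesis .
  qed
  then show "(\<integral>t. \<bar>x t * g t\<bar> \<partial>M) \<le> orl x * lux g" by (rule field_le_epsilon)
qed

end


section \<open>Exponents with intermediate values\<close>

context sigma_finite_exponent
begin

text \<open>The points with \<open>1 < p < \<infinity>\<close> are covered by countably many sets of finite measure on which \<open>p\<close>
  is bounded and bounded away from 1; they cannot all be null.\<close>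

lemma intermediate_exponent_set:
  assumes "\<not> (AE t in M. p t = 1 \<or> p t = \<infinity>)"
  obtains C a b where "C \<in> sets M" "0 < emeasure M C" "emeasure M C < \<infinity>" "1 < (a::real)" "a \<le> b"
    "\<And>t. t \<in> C \<Longrightarrow> ennreal a \<le> p t \<and> p t \<le> ennreal b"
proof -
  obtain A :: "nat \<Rightarrow> 'a set" where A: "range A \<subseteq> sets M" "(\<Union>i. A i) = space M" "\<And>i. emeasure M (A i) \<noteq> \<infinity>"
    using sigma_finite by blast
  have [measurable]: "A i \<in> sets M" for i using A by auto
  define E where "E n i = {t \<in> space M. ennreal (1 + 1 / Suc n) \<le> p t \<and> p t \<le> ennreal (real n + 2)} \<inter> A i" for n i
  have E [measurable]: "E n i \<in> sets M" for n i unfolding E_def by measurable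
  have "\<exists>n i. 0 < emeasure M (E n i)"
  proof (rule ccontr)
    assume "\<not> ?thesis"
    then have "AE t in M. t \<notin> E n i" for n i
      using E by (intro AE_not_in) (auto simp: null_sets_def)
    then have "AE t in M. \<forall>n i. t \<notin> E n i" by (simp add: AE_all_countable)
    then have "AE t in M. p t = 1 \<or> p t = \<infinity>"
      using AE_space
    proof eventually_elim
      case (elim t)
      show ?case
      proof (rule ccontr)
        assume no: "\<not> ?thesis"
        then obtain P where P: "p t = ennreal P" "1 < P"
          using p_ge_1[OF elim(2)] by (cases "p t") (auto simp: ennreal_le_iff2 less_le simp flip: ennreal_1)
        obtain n1 where n1: "1 / Suc n1 < P - 1" using P nat_approx_posE[of "P - 1"] by auto
        obtain n2 where n2: "P \<le> real n2" using real_arch_simple by blast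
        define n where "n = max n1 n2"
        have "1 / real (Suc n) \<le> 1 / real (Suc n1)" by (intro divide_left_mono) (auto simp: n_def)
        then have "ennreal (1 + 1 / Suc n) \<le> p t" unfolding P(1) using n1 by (intro ennreal_leI) simp
        moreover have "p t \<le> ennreal (real n + 2)" unfolding P(1) using n2 by (intro ennreal_leI) (auto simp: n_def)
        moreover obtain i where "t \<in> A i" using A(2) elim(2) by blast
        ultimately have "t \<in> E n i" using elim(2) unfolding E_def by blast
        then show False using elim(1) by blast
      qed
    qed
    then show False using assms by simp
  qed
  then obtain n i where pos: "0 < emeasure M (E n i)" by blast
  have "emeasure M (E n i) \<le> emeasure M (A i)" by (intro emeasure_mono) (auto simp: E_def)
  then have "emeasure M (E n i) < \<infinity>" using A(3)[of i] by (metis infinity_ennreal_def le_less_trans less_top)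
  moreover have "1 + 1 / real (Suc n) \<le> real n + 2" by (simp add: field_simps)
  moreover have "ennreal (1 + 1 / real (Suc n)) \<le> p t \<and> p t \<le> ennreal (real n + 2)" if "t \<in> E n i" for t
    using that unfolding E_def by blast
  ultimately show thesis
    using that[of "E n i" "1 + 1 / real (Suc n)" "real n + 2"] pos E by simp
qed

lemma not_daugavet_luxemburg:
  assumes bad: "\<not> (AE t in M. p t = 1 \<or> p t = \<infinity>)"
  shows "\<not> daugavet (nakano_space M p)"
proof -
  obtain C a b where C: "C \<in> sets M" "0 < emeasure M C" "emeasure M C < \<infinity>" "1 < (a::real)" "a \<le> b"
    "\<And>t. t \<in> C \<Longrightarrow> ennreal a \<le> p t \<and> p t \<le> ennreal b"
    by (rule intermediate_exponent_set[OF bad]) blast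
  obtain y \<phi> :: "'a \<Rightarrow> real" and B d :: real where
    meas [measurable]: "y \<in> borel_measurable M" "\<phi> \<in> borel_measurable M" and
    "\<forall>t. 0 \<le> \<phi> t \<and> \<phi> t \<le> B" "\<forall>t. t \<notin> C \<longrightarrow> \<phi> t = 0" and
    y: "rho y \<le> 1" "(\<integral>t. \<phi> t * y t \<partial>M) = 1" and d: "0 < d" and
    pair0: "\<forall>g\<in>borel_measurable M. rho g \<le> 1 \<longrightarrow> integrable M (\<lambda>t. \<phi> t * g t) \<and> (\<integral>t. \<bar>\<phi> t * g t\<bar> \<partial>M) \<le> 1" and
    gap0: "\<forall>g\<in>borel_measurable M. rho g \<le> 1 \<longrightarrow> lux (\<lambda>t. g t - (\<integral>t. \<phi> t * g t \<partial>M) * y t) \<le> 2 - d"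
    by (rule convexity_gap[OF C]) blast
  have pair: "integrable M (\<lambda>t. \<phi> t * g t)" "(\<integral>t. \<bar>\<phi> t * g t\<bar> \<partial>M) \<le> 1"
    and gap: "lux (\<lambda>t. g t - (\<integral>t. \<phi> t * g t \<partial>M) * y t) \<le> 2 - d"
    if "g \<in> borel_measurable M" "rho g \<le> 1" for g
    using pair0 gap0 that by blast+
  interpret F: normed_fun_space M "modular_funs M (nakano p)" "luxemburg_norm M (nakano p)"
    by (rule lux_space)
  define L where "L g = (\<integral>t. \<phi> t * g t \<partial>M)" for g
  have VK: "x \<in> F.V \<longleftrightarrow> (\<lambda>t. ereal (x t)) \<in> modular_funs M (nakano p)" for x by (simp add: F.V_def)
  have unit: "rho (\<lambda>t. x t / c) \<le> 1" if "x \<in> F.V" "lux x < c" for x c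
    using lux_less that VK by blast
  have scaleV: "(\<lambda>t. x t / c) \<in> F.V" if "x \<in> F.V" for x c
    using F.V_scale[OF that, of "1 / c"] by simp
  have i: "integrable M (\<lambda>t. \<phi> t * x t)" and Lb: "\<bar>L x\<bar> \<le> lux x" if x: "x \<in> F.V" for x
  proof -
    have c: "integrable M (\<lambda>t. \<phi> t * x t) \<and> \<bar>L x\<bar> \<le> c" if xc: "lux x < c" for c
    proof -
      have c0: "0 < c" using F.norm_nonneg[OF x] xc by (simp add: lux_norm_interp)
      have p: "integrable M (\<lambda>t. \<phi> t * (x t / c))" "(\<integral>t. \<bar>\<phi> t * (x t / c)\<bar> \<partial>M) \<le> 1"
        using pair[OF F.V_measurable[OF scaleV[OF x]] unit[OF x xc]] by auto
      have "(\<lambda>t. c * (\<phi> t * (x t / c))) = (\<lambda>t. \<phi> t * x t)" using c0 by auto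
      then have int: "integrable M (\<lambda>t. \<phi> t * x t)" using integrable_mult_right[OF p(1), of c] by simp
      have "\<bar>\<integral>t. \<phi> t * (x t / c) \<partial>M\<bar> \<le> 1" using p(2) integral_abs_bound[of M "\<lambda>t. \<phi> t * (x t / c)"] by linarith
      moreover have "(\<integral>t. \<phi> t * (x t / c) \<partial>M) = L x / c" unfolding L_def by simp
      ultimately show ?thesis using c0 int by (simp add: abs_divide divide_le_eq)
    qed
    show "integrable M (\<lambda>t. \<phi> t * x t)" using c[of "lux x + 1"] by simp
    show "\<bar>L x\<bar> \<le> lux x"
    proof (rule field_le_epsilon)
      fix e :: real assume "0 < e"
      then show "\<bar>L x\<bar> \<le> lux x + e" using c[of "lux x + e"] by simp
    qed
  qed
  have yV: "y \<in> F.V" using y(1) by (intro rho_finite_in_space) (auto intro: le_less_trans)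
  have "lux y \<le> 1" using y(1) by (intro lux_le) auto
  moreover have "1 \<le> lux y" using Lb[OF yV] y(2) by (simp add: L_def)
  ultimately have ly: "lux y = 1" by simp
  show ?thesis unfolding nakano_space_def
  proof (rule F.not_daugavet_criterion[where L=L and y=y and d=d])
    show "y \<in> F.V" by fact
    show "F.norm_of y = 1" using ly by (simp add: lux_norm_interp)
    show "L y = 1" using y by (simp add: L_def)
    show "0 < d" by fact
    fix x x' c assume x: "x \<in> F.V"
    note xm [measurable] = F.V_measurable[OF x]
    have "(\<lambda>t. \<phi> t * (c * x t)) = (\<lambda>t. c * (\<phi> t * x t))" by auto
    then show "L (\<lambda>t. c * x t) = c * L x" unfolding L_def by simp
    show "\<bar>L x\<bar> \<le> F.norm_of x" using Lb[OF x] by (simp add: lux_norm_interp)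
    show "F.norm_of (\<lambda>t. x t - L x * y t) \<le> 2 - d" if "F.norm_of x \<le> 1"
    proof (rule field_le_epsilon)
      fix e :: real assume e: "0 < e"
      define s where "s = 1 + e / (\<bar>2 - d\<bar> + 1)"
      have s: "1 < s" using e by (simp add: s_def)
      have lt: "lux x < s" using that s by (simp add: lux_norm_interp)
      have "lux (\<lambda>t. x t / s - L (\<lambda>t. x t / s) * y t) \<le> 2 - d"
        unfolding L_def by (rule gap[OF F.V_measurable[OF scaleV[OF x]] unit[OF x lt]])
      moreover have "(\<lambda>t. x t - L x * y t) = (\<lambda>t. s * (x t / s - L (\<lambda>t. x t / s) * y t))"
      proof -
        have "L (\<lambda>t. x t / s) = L x / s" unfolding L_def by simp
        then show ?thesis using s by (simp add: right_diff_distrib)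
      qed
      moreover have "(\<lambda>t. x t / s - L (\<lambda>t. x t / s) * y t) \<in> F.V"
        by (intro F.V_diff scaleV x F.V_scale yV)
      ultimately have "lux (\<lambda>t. x t - L x * y t) \<le> s * (2 - d)"
        using F.norm_scale[of "\<lambda>t. x t / s - L (\<lambda>t. x t / s) * y t" s] s by (simp add: lux_norm_interp)
      also have "\<dots> = (2 - d) + (2 - d) / (\<bar>2 - d\<bar> + 1) * e" by (simp add: s_def algebra_simps)
      also have "\<dots> \<le> (2 - d) + 1 * e"
        using e by (intro add_left_mono mult_right_mono) (auto simp: divide_le_eq)
      finally show "F.norm_of (\<lambda>t. x t - L x * y t) \<le> 2 - d + e" by (simp add: lux_norm_interp)
    qed
    assume x': "x' \<in> F.V"
    note [measurable] = F.V_measurable[OF x']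
    show "L (\<lambda>t. x t + x' t) = L x + L x'"
      unfolding L_def using i[OF x] i[OF x'] by (simp add: distrib_left)
    show "L x = L x'" if "AE t in M. x t = x' t"
      unfolding L_def using that by (intro integral_cong_AE) auto
  qed
qed

text \<open>The roles of \<open>y\<close> and \<open>\<phi>\<close> are exchanged. For a test function \<open>g\<close>, given the sign of
  \<open>h = x - (\<integral> x y) \<phi>\<close>, moving the operator to the other side gives
  \<open>\<integral> h g = \<integral> x (g - (\<integral> \<phi> g) y)\<close>, and \<open>convexity_gap\<close> bounds the norm of the second factor.\<close>

lemma not_daugavet_orlicz:
  assumes bad: "\<not> (AE t in M. p t = 1 \<or> p t = \<infinity>)"
  shows "\<not> daugavet (nakano_orlicz_space M (conj_exp p) p)"
proof -
  obtain C a b where C: "C \<in> sets M" "0 < emeasure M C" "emeasure M C < \<infinity>" "1 < (a::real)" "a \<le> b"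
    "\<And>t. t \<in> C \<Longrightarrow> ennreal a \<le> p t \<and> p t \<le> ennreal b"
    by (rule intermediate_exponent_set[OF bad]) blast
  obtain y \<phi> :: "'a \<Rightarrow> real" and B d :: real where
    meas [measurable]: "y \<in> borel_measurable M" "\<phi> \<in> borel_measurable M" and
    phiB0: "\<forall>t. 0 \<le> \<phi> t \<and> \<phi> t \<le> B" and phi_off0: "\<forall>t. t \<notin> C \<longrightarrow> \<phi> t = 0" and
    y: "rho y \<le> 1" "(\<integral>t. \<phi> t * y t \<partial>M) = 1" and d: "0 < d" and
    pair0: "\<forall>g\<in>borel_measurable M. rho g \<le> 1 \<longrightarrow> integrable M (\<lambda>t. \<phi> t * g t) \<and> (\<integral>t. \<bar>\<phi> t * g t\<bar> \<partial>M) \<le> 1" and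
    gap0: "\<forall>g\<in>borel_measurable M. rho g \<le> 1 \<longrightarrow> lux (\<lambda>t. g t - (\<integral>t. \<phi> t * g t \<partial>M) * y t) \<le> 2 - d"
    by (rule convexity_gap[OF C]) blast
  have pair: "integrable M (\<lambda>t. \<phi> t * g t)" "(\<integral>t. \<bar>\<phi> t * g t\<bar> \<partial>M) \<le> 1"
    and gap: "lux (\<lambda>t. g t - (\<integral>t. \<phi> t * g t \<partial>M) * y t) \<le> 2 - d"
    if "g \<in> borel_measurable M" "rho g \<le> 1" for g
    using pair0 gap0 that by blast+
  have phiB: "0 \<le> \<phi> t \<and> \<phi> t \<le> B" and phi_off: "t \<notin> C \<Longrightarrow> \<phi> t = 0" for t
    using phiB0 phi_off0 by blast+
  interpret F: normed_fun_space M "modular_funs M (nakano p)" "luxemburg_norm M (nakano p)"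
    by (rule lux_space)
  interpret Q: exponent M "conj_exp p" by (rule conj_exponent)
  interpret O: normed_fun_space M "modular_funs M (nakano (conj_exp p))" "orlicz_norm M (nakano p)"
    by (rule orl_space)
  have VK: "x \<in> O.V \<longleftrightarrow> (\<lambda>t. ereal (x t)) \<in> modular_funs M (nakano (conj_exp p))" for x by (simp add: O.V_def)
  have yV: "y \<in> F.V" using y(1) by (intro rho_finite_in_space) (auto intro: le_less_trans)
  have yK: "(\<lambda>t. ereal (y t)) \<in> modular_funs M (nakano p)" using yV by (simp add: F.V_def)
  have lux_y: "lux y \<le> 1" using y(1) by (intro lux_le) auto
  have phiV: "\<phi> \<in> O.V"
  proof -
    define c where "c = 1 / (\<bar>B\<bar> + 1)"
    have c: "0 < c" by (simp add: c_def)
    have "Q.rho (\<lambda>t. c * \<phi> t) \<le> (\<integral>\<^sup>+t. indicator C t \<partial>M)"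
      unfolding Q.rho_def
    proof (intro nn_integral_mono)
      fix t assume t: "t \<in> space M"
      show "nakano (conj_exp p) t (ennreal \<bar>c * \<phi> t\<bar>) \<le> indicator C t"
      proof (cases "t \<in> C")
        case True
        have le: "\<bar>c * \<phi> t\<bar> \<le> 1" using phiB[of t] c by (simp add: c_def abs_mult divide_le_eq)
        have "nakano (conj_exp p) t (ennreal \<bar>c * \<phi> t\<bar>) \<le> nakano (conj_exp p) t (ennreal 1)"
          using le by (intro nakano_mono ennreal_leI)
        also have "\<dots> \<le> 1" using nakano_one_le[of "conj_exp p" t, OF Q.p_ge_1[OF t]] by simp
        finally show ?thesis using True by simp
      qed (simp add: phi_off)
    qed
    also have "\<dots> < \<infinity>" using C by simp
    finally show ?thesis unfolding VK Q.modular_funs_real_iff using c by auto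
  qed
  define L where "L x = (\<integral>t. x t * y t \<partial>M)" for x
  have Lb: "integrable M (\<lambda>t. x t * y t)" "\<bar>L x\<bar> \<le> orl x" if x: "x \<in> O.V" for x
  proof -
    have xK: "(\<lambda>t. ereal (x t)) \<in> modular_funs M (nakano (conj_exp p))" using x VK by simp
    show "integrable M (\<lambda>t. x t * y t)" by (rule orlicz_hoelder(1)[OF xK yK])
    have "\<bar>L x\<bar> \<le> (\<integral>t. \<bar>x t * y t\<bar> \<partial>M)" unfolding L_def by (rule integral_abs_bound)
    also have "\<dots> \<le> orl x * lux y" by (rule orlicz_hoelder(2)[OF xK yK])
    also have "\<dots> \<le> orl x" using lux_y orl_nonneg[of x] by (simp add: mult_left_le)
    finally show "\<bar>L x\<bar> \<le> orl x" .
  qed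
  have phi_L: "L \<phi> = 1" using y by (simp add: L_def)
  have phiK: "(\<lambda>t. ereal (\<phi> t)) \<in> modular_funs M (nakano (conj_exp p))" using phiV VK by simp
  have orl_phi: "orl \<phi> = 1"
  proof (rule antisym)
    have "osup \<phi> \<le> 1"
    proof (rule osup_least)
      fix g assume g: "g \<in> borel_measurable M" "rho g \<le> 1"
      have "(\<integral>\<^sup>+t. ennreal \<bar>\<phi> t * g t\<bar> \<partial>M) = ennreal (\<integral>t. \<bar>\<phi> t * g t\<bar> \<partial>M)"
        using pair[OF g] by (intro nn_integral_eq_integral) auto
      then show "(\<integral>\<^sup>+t. ennreal \<bar>\<phi> t * g t\<bar> \<partial>M) \<le> 1" using pair[OF g] by (simp add: ennreal_le_1)
    qed
    then show "orl \<phi> \<le> 1" using osup_orl[OF phiK] by (simp add: ennreal_le_1)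
    show "1 \<le> orl \<phi>" using Lb(2)[OF phiV] phi_L by simp
  qed
  show ?thesis unfolding nakano_orlicz_space_def
  proof (rule O.not_daugavet_criterion[where L=L and y=\<phi> and d=d])
    show "\<phi> \<in> O.V" by fact
    show "O.norm_of \<phi> = 1" using orl_phi by (simp add: orl_norm_interp)
    show "L \<phi> = 1" by fact
    show "0 < d" by fact
    fix x x' c assume x: "x \<in> O.V"
    note xm [measurable] = O.V_measurable[OF x]
    show "L (\<lambda>t. c * x t) = c * L x" unfolding L_def by (simp add: mult.assoc)
    show "\<bar>L x\<bar> \<le> O.norm_of x" using Lb[OF x] by (simp add: orl_norm_interp)
    show "O.norm_of (\<lambda>t. x t - L x * \<phi> t) \<le> 2 - d" if nx: "O.norm_of x \<le> 1"
    proof -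
      have xK: "(\<lambda>t. ereal (x t)) \<in> modular_funs M (nakano (conj_exp p))" using x VK by simp
      define h where "h t = x t - L x * \<phi> t" for t
      have hV: "h \<in> O.V" unfolding h_def by (intro O.V_diff O.V_scale x phiV)
      have hK: "(\<lambda>t. ereal (h t)) \<in> modular_funs M (nakano (conj_exp p))" using hV VK by simp
      note [measurable] = O.V_measurable[OF hV]
      have "osup h \<le> ennreal (2 - d)"
      proof (rule osup_least)
        fix g assume [measurable]: "g \<in> borel_measurable M" and g: "rho g \<le> 1"
        \<comment> \<open>the modular ignores signs, so the test function may be given the sign of \<open>h\<close>\<close>
        define g' where "g' t = sgn (h t) * \<bar>g t\<bar>" for t
        have g'm [measurable]: "g' \<in> borel_measurable M" unfolding g'_def by measurable
        have "rho g' \<le> rho g" by (intro rho_mono AE_I2) (simp add: g'_def abs_mult sgn_if)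
        then have g': "rho g' \<le> 1" using g by simp
        then have g'V: "g' \<in> F.V" by (intro rho_finite_in_space) (auto intro: le_less_trans)
        have g'K: "(\<lambda>t. ereal (g' t)) \<in> modular_funs M (nakano p)" using g'V by (simp add: F.V_def)
        have hg: "\<bar>h t * g t\<bar> = h t * g' t" for t
          by (simp add: g'_def abs_mult) (simp add: abs_sgn mult.assoc)
        define m where "m = (\<integral>t. \<phi> t * g' t \<partial>M)"
        define k where "k t = g' t - m * y t" for t
        have kV: "k \<in> F.V" unfolding k_def by (intro F.V_diff F.V_scale g'V yV)
        have kK: "(\<lambda>t. ereal (k t)) \<in> modular_funs M (nakano p)" using kV by (simp add: F.V_def)
        have lk: "lux k \<le> 2 - d" unfolding k_def m_def by (rule gap[OF g'm g'])
        have i1: "integrable M (\<lambda>t. x t * g' t)" by (rule orlicz_hoelder(1)[OF xK g'K])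
        have i2: "integrable M (\<lambda>t. \<phi> t * g' t)" by (rule orlicz_hoelder(1)[OF phiK g'K])
        have i3: "integrable M (\<lambda>t. x t * y t)" by (rule orlicz_hoelder(1)[OF xK yK])
        have ih: "integrable M (\<lambda>t. h t * g' t)" by (rule orlicz_hoelder(1)[OF hK g'K])
        have "(\<integral>t. h t * g' t \<partial>M) = (\<integral>t. x t * g' t - L x * (\<phi> t * g' t) \<partial>M)"
          by (intro Bochner_Integration.integral_cong) (auto simp: h_def algebra_simps)
        also have "\<dots> = (\<integral>t. x t * g' t \<partial>M) - L x * m" using i1 i2 by (simp add: m_def)
        also have "\<dots> = (\<integral>t. x t * g' t - m * (x t * y t) \<partial>M)" using i1 i3 by (simp add: L_def)
        also have "\<dots> = (\<integral>t. x t * k t \<partial>M)"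
          by (intro Bochner_Integration.integral_cong) (auto simp: k_def algebra_simps)
        also have "\<dots> \<le> (\<integral>t. \<bar>x t * k t\<bar> \<partial>M)" using integral_abs_bound[of M "\<lambda>t. x t * k t"] by linarith
        also have "\<dots> \<le> orl x * lux k" by (rule orlicz_hoelder(2)[OF xK kK])
        also have "\<dots> \<le> 1 * (2 - d)"
          using nx lk orl_nonneg[of x] F.norm_nonneg[OF kV]
          by (intro mult_mono) (auto simp: orl_norm_interp lux_norm_interp)
        finally have le: "(\<integral>t. h t * g' t \<partial>M) \<le> 2 - d" by simp
        have "(\<integral>\<^sup>+t. ennreal \<bar>h t * g t\<bar> \<partial>M) = ennreal (\<integral>t. h t * g' t \<partial>M)"
          unfolding hg using ih by (intro nn_integral_eq_integral) (auto simp flip: hg)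
        then show "(\<integral>\<^sup>+t. ennreal \<bar>h t * g t\<bar> \<partial>M) \<le> ennreal (2 - d)" using le by (simp add: ennreal_leI)
      qed
      moreover have "0 \<le> 2 - d"
        using gap[of "\<lambda>t. 0"] F.norm_zero by (simp add: lux_norm_interp)
      ultimately have "orl h \<le> 2 - d" using osup_orl[OF hK] by (simp add: ennreal_le_iff)
      then show ?thesis by (simp add: orl_norm_interp h_def[abs_def])
    qed
    assume x': "x' \<in> O.V"
    note [measurable] = O.V_measurable[OF x']
    show "L (\<lambda>t. x t + x' t) = L x + L x'"
      unfolding L_def using Lb(1)[OF x] Lb(1)[OF x'] by (simp add: distrib_right)
    show "L x = L x'" if "AE t in M. x t = x' t"
      unfolding L_def using that by (intro integral_cong_AE) auto
  qed
qed

end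


section \<open>Spaces that are of type L1 on one part and of type Linf on the other\<close>

definition part_int :: "'a measure \<Rightarrow> 'a set \<Rightarrow> ('a \<Rightarrow> real) \<Rightarrow> real" where
  "part_int M U x = (\<integral>t. \<bar>x t\<bar> * indicator U t \<partial>M)"

definition part_sup :: "'a measure \<Rightarrow> 'a set \<Rightarrow> ('a \<Rightarrow> real) \<Rightarrow> real" where
  "part_sup M W x = enn2real (esssup (restrict_space M W) (\<lambda>t. ennreal \<bar>x t\<bar>))"

lemma part_sup_nonneg: "0 \<le> part_sup M W x"
  by (simp add: part_sup_def)

lemma esssup_restrict_le_iff:
  assumes [measurable]: "x \<in> borel_measurable M" "W \<in> sets M" and c: "0 \<le> c"
  shows "esssup (restrict_space M W) (\<lambda>t. ennreal \<bar>x t\<bar>) \<le> ennreal c \<longleftrightarrow>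
    (AE t in M. t \<in> W \<longrightarrow> \<bar>x t\<bar> \<le> c)"
proof -
  have meas: "(\<lambda>t. ennreal \<bar>x t\<bar>) \<in> borel_measurable (restrict_space M W)"
    by (intro measurable_restrict_space1) measurable
  have "W \<inter> space M \<in> sets M" by simp
  note AE_r = AE_restrict_space_iff[OF this]
  have "esssup (restrict_space M W) (\<lambda>t. ennreal \<bar>x t\<bar>) \<le> ennreal c \<longleftrightarrow>
    (AE t in restrict_space M W. ennreal \<bar>x t\<bar> \<le> ennreal c)"
  proof
    assume le: "esssup (restrict_space M W) (\<lambda>t. ennreal \<bar>x t\<bar>) \<le> ennreal c"
    show "AE t in restrict_space M W. ennreal \<bar>x t\<bar> \<le> ennreal c"
      using esssup_AE[of "\<lambda>t. ennreal \<bar>x t\<bar>" "restrict_space M W"]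
      by eventually_elim (rule order_trans[OF _ le])
  qed (intro esssup_I meas)
  also have "\<dots> \<longleftrightarrow> (AE t in M. t \<in> W \<longrightarrow> \<bar>x t\<bar> \<le> c)"
    unfolding AE_r using c by (simp add: ennreal_le_iff)
  finally show ?thesis .
qed

lemma part_sup_le_iff:
  assumes x: "x \<in> borel_measurable M" and W: "W \<in> sets M" and bnd: "AE t in M. t \<in> W \<longrightarrow> \<bar>x t\<bar> \<le> b"
    and c: "0 \<le> c"
  shows "part_sup M W x \<le> c \<longleftrightarrow> (AE t in M. t \<in> W \<longrightarrow> \<bar>x t\<bar> \<le> c)"
proof -
  have "AE t in M. t \<in> W \<longrightarrow> \<bar>x t\<bar> \<le> \<bar>b\<bar>" using bnd by eventually_elim auto
  then have "esssup (restrict_space M W) (\<lambda>t. ennreal \<bar>x t\<bar>) \<le> ennreal \<bar>b\<bar>"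
    using esssup_restrict_le_iff[OF x W, of "\<bar>b\<bar>"] by simp
  then have fin: "esssup (restrict_space M W) (\<lambda>t. ennreal \<bar>x t\<bar>) < top"
    by (rule le_less_trans) simp
  then have eq: "ennreal (part_sup M W x) = esssup (restrict_space M W) (\<lambda>t. ennreal \<bar>x t\<bar>)"
    unfolding part_sup_def by (rule ennreal_enn2real)
  show ?thesis
    using esssup_restrict_le_iff[OF x W c] ennreal_le_iff[OF c, of "part_sup M W x"] unfolding eq by simp
qed

text \<open>The functions are integrable on \<open>U\<close> and essentially bounded on \<open>W\<close>. The norm is bounded by
  the sum of the two partial norms, which covers the maximum as well as the sum.\<close>

locale mixed_fun_space = normed_fun_space M K N
  for M :: "'a measure" and K :: "('a \<Rightarrow> ereal) set" and N :: "('a \<Rightarrow> ereal) \<Rightarrow> real" +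
  fixes U W :: "'a set"
  assumes na: "non_atomic M"
    and U_sets [measurable]: "U \<in> sets M" and W_sets [measurable]: "W \<in> sets M"
    and disj: "U \<inter> W = {}" and cover: "U \<union> W = space M"
    and V_iff: "x \<in> V \<longleftrightarrow> x \<in> borel_measurable M \<and> integrable M (\<lambda>t. \<bar>x t\<bar> * indicator U t) \<and>
      (\<exists>c. AE t in M. t \<in> W \<longrightarrow> \<bar>x t\<bar> \<le> c)"
    and norm_le: "x \<in> V \<Longrightarrow> norm_of x \<le> part_int M U x + part_sup M W x"
begin

lemma sup_le_iff: "x \<in> V \<Longrightarrow> 0 \<le> c \<Longrightarrow> part_sup M W x \<le> c \<longleftrightarrow> (AE t in M. t \<in> W \<longrightarrow> \<bar>x t\<bar> \<le> c)"
  using part_sup_le_iff[of x M W] W_sets unfolding V_iff by blast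

lemma sup_AE: "x \<in> V \<Longrightarrow> AE t in M. t \<in> W \<longrightarrow> \<bar>x t\<bar> \<le> part_sup M W x"
  using sup_le_iff[of x "part_sup M W x"] part_sup_nonneg[of M W x] by simp

lemma sup_positive_measure:
  assumes x: "x \<in> V" and r: "r < part_sup M W x" "0 \<le> r"
  shows "0 < emeasure M {t \<in> W. r < \<bar>x t\<bar>}"
proof (rule ccontr)
  note [measurable] = V_measurable[OF x]
  have m: "{t \<in> W. r < \<bar>x t\<bar>} \<in> sets M"
  proof -
    have "{t \<in> W. r < \<bar>x t\<bar>} = W \<inter> {t \<in> space M. r < \<bar>x t\<bar>}" using cover by auto
    then show ?thesis by simp
  qed
  assume "\<not> ?thesis"
  then have "{t \<in> W. r < \<bar>x t\<bar>} \<in> null_sets M" using m by (auto simp: null_sets_def)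
  then have "AE t in M. t \<notin> {t \<in> W. r < \<bar>x t\<bar>}" by (rule AE_not_in)
  then have "AE t in M. t \<in> W \<longrightarrow> \<bar>x t\<bar> \<le> r" by eventually_elim auto
  then show False using sup_le_iff[OF x r(2)] r by simp
qed

lemma sup_ge:
  assumes x: "x \<in> V" and E: "E \<in> sets M" "E \<subseteq> W" "0 < emeasure M E" "\<And>t. t \<in> E \<Longrightarrow> k \<le> \<bar>x t\<bar>"
  shows "k \<le> part_sup M W x"
proof (rule ccontr)
  assume lt: "\<not> ?thesis"
  have "AE t in M. t \<notin> E"
    using sup_AE[OF x] by eventually_elim (use E lt in force)
  then have "emeasure M E = 0" using E(1) AE_iff_null_sets by blast
  then show False using E by simp
qed

lemma sup_cong: "x \<in> V \<Longrightarrow> y \<in> V \<Longrightarrow> (\<And>t. t \<in> W \<Longrightarrow> x t = y t) \<Longrightarrow> part_sup M W x = part_sup M W y"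
proof -
  assume x: "x \<in> V" and y: "y \<in> V" and eq: "\<And>t. t \<in> W \<Longrightarrow> x t = y t"
  have "part_sup M W x \<le> part_sup M W y"
    unfolding sup_le_iff[OF x part_sup_nonneg] using sup_AE[OF y] by eventually_elim (simp add: eq)
  moreover have "part_sup M W y \<le> part_sup M W x"
    unfolding sup_le_iff[OF y part_sup_nonneg] using sup_AE[OF x] by eventually_elim (simp add: eq)
  ultimately show ?thesis by simp
qed

lemma int_cong: "(\<And>t. t \<in> U \<Longrightarrow> x t = y t) \<Longrightarrow> part_int M U x = part_int M U y"
  unfolding part_int_def by (intro Bochner_Integration.integral_cong) (auto simp: indicator_def)

lemma int_nonneg: "0 \<le> part_int M U x"
  unfolding part_int_def by (intro integral_nonneg_AE) auto

lemma V_integrable: "x \<in> V \<Longrightarrow> integrable M (\<lambda>t. \<bar>x t\<bar> * indicator U t)"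
  by (simp add: V_iff)

lemma V_cut: "x \<in> V \<Longrightarrow> E \<in> sets M \<Longrightarrow> (\<lambda>t. x t * indicator E t) \<in> V"
proof -
  assume x: "x \<in> V" and [measurable]: "E \<in> sets M"
  note [measurable] = V_measurable[OF x]
  obtain c where c: "AE t in M. t \<in> W \<longrightarrow> \<bar>x t\<bar> \<le> c" using x V_iff by blast
  have "AE t in M. t \<in> W \<longrightarrow> \<bar>x t * indicator E t\<bar> \<le> \<bar>c\<bar>"
    using c by eventually_elim (auto simp: indicator_def)
  moreover have "integrable M (\<lambda>t. \<bar>x t * indicator E t\<bar> * indicator U t)"
    by (rule Bochner_Integration.integrable_bound[OF V_integrable[OF x]])
      (measurable, auto simp: indicator_def)
  ultimately show ?thesis unfolding V_iff by auto
qed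

lemma norm_zero_AE: "x \<in> V \<Longrightarrow> AE t in M. x t = 0 \<Longrightarrow> norm_of x = 0"
  using norm_cong[of x "\<lambda>t. 0"] norm_zero V_zero V_measurable by fastforce

lemma functional_parts:
  assumes L_add: "\<And>x x'. x \<in> V \<Longrightarrow> x' \<in> V \<Longrightarrow> L (\<lambda>t. x t + x' t) = L x + L x'"
    and L_bound: "\<And>x. x \<in> V \<Longrightarrow> \<bar>L x\<bar> \<le> C * norm_of x"
    and x: "x \<in> V"
  shows "L x = L (\<lambda>t. x t * indicator W t) + L (\<lambda>t. x t * indicator U t)"
proof -
  let ?y = "\<lambda>t. x t * indicator W t + x t * indicator U t"
  have y: "?y \<in> V" by (intro V_add V_cut x) auto
  have "AE t in M. x t - ?y t = 0" using cover disj by (intro AE_I2) (auto simp: indicator_def)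
  then have "norm_of (\<lambda>t. x t - ?y t) = 0" by (rule norm_zero_AE[OF V_diff[OF x y]])
  then have "L (\<lambda>t. x t - ?y t) = 0" using L_bound[OF V_diff[OF x y]] by simp
  then have "L x = L ?y" using L_add[OF V_diff[OF x y] y] by simp
  also have "\<dots> = L (\<lambda>t. x t * indicator W t) + L (\<lambda>t. x t * indicator U t)"
    by (intro L_add V_cut x) auto
  finally show ?thesis .
qed

text \<open>For \<open>v(E) = L(x \<chi>\<^sub>E)\<close> and \<open>w(E) = \<integral>\<^sub>E |x|\<close> the ratio of \<open>v\<close> to \<open>w\<close> on some small set is at least the ratio on
  all of \<open>U\<close>. Small refers to the measure with density \<open>|x| + |z|\<close>. The new vector is the
  restriction of \<open>x\<close> to that set, rescaled to the old integral.\<close>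

lemma concentrate_L1_part:
  assumes L_add: "\<And>x x'. x \<in> V \<Longrightarrow> x' \<in> V \<Longrightarrow> L (\<lambda>t. x t + x' t) = L x + L x'"
    and L_scale: "\<And>x c. x \<in> V \<Longrightarrow> L (\<lambda>t. c * x t) = c * L x"
    and L_bound: "\<And>x. x \<in> V \<Longrightarrow> \<bar>L x\<bar> \<le> C * norm_of x"
    and x: "x \<in> V" and z: "z \<in> V" and e: "0 < (e::real)"
  obtains x' where "x' \<in> V" "\<And>t. t \<in> W \<Longrightarrow> x' t = x t" "part_int M U x' = part_int M U x"
    "L x \<le> L x'" "part_int M U x + part_int M U z - e \<le> part_int M U (\<lambda>t. x' t + z t)"
proof (cases "part_int M U x = 0")
  case True
  have "part_int M U z \<le> (\<integral>t. \<bar>x t + z t\<bar> * indicator U t + \<bar>x t\<bar> * indicator U t \<partial>M)"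
    unfolding part_int_def
    using V_integrable[OF z] V_integrable[OF x] V_integrable[OF V_add[OF x z]]
    by (intro integral_mono) (auto simp: indicator_def)
  also have "\<dots> = part_int M U (\<lambda>t. x t + z t) + part_int M U x"
    unfolding part_int_def using V_integrable[OF x] V_integrable[OF V_add[OF x z]] by simp
  finally show ?thesis using that[of x] x True e by simp
next
  case False
  note [measurable] = V_measurable[OF x] V_measurable[OF z]
  define w where "w E = (\<integral>t. \<bar>x t\<bar> * indicator (E \<inter> U) t \<partial>M)" for E
  define v where "v E = L (\<lambda>t. x t * indicator (E \<inter> U) t)" for E
  define g where "g t = (\<bar>z t\<bar> + \<bar>x t\<bar>) * indicator U t" for t
  have [measurable]: "g \<in> borel_measurable M" unfolding g_def by measurable
  have g0: "0 \<le> g t" for t by (simp add: g_def)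
  have ig: "integrable M g"
    unfolding g_def distrib_right using V_integrable[OF x] V_integrable[OF z] by simp
  have gfin: "(\<integral>\<^sup>+t. ennreal (g t) \<partial>M) < \<infinity>"
    using ig g0 by (simp add: nn_integral_eq_integral)
  \<comment> \<open>smallness is measured by the mass of \<open>|x| + |z|\<close>, a finite non-atomic measure\<close>
  define D where "D = density M (\<lambda>t. ennreal (g t))"
  have na': "non_atomic D" unfolding D_def by (intro non_atomic_density na gfin) measurable
  have fin: "finite_measure D"
    by (rule finite_measureI) (use gfin in \<open>simp add: D_def emeasure_density cong: nn_integral_cong\<close>)
  have setsD: "sets D = sets M" "space D = space M" by (simp_all add: D_def)
  have xE: "(\<lambda>t. x t * indicator (E \<inter> U) t) \<in> V" if "E \<in> sets M" for E
    using V_cut[OF x] that by auto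
  have iE: "integrable M (\<lambda>t. \<bar>x t\<bar> * indicator (E \<inter> U) t)" if [measurable]: "E \<in> sets M" for E
    by (rule Bochner_Integration.integrable_bound[OF V_integrable[OF x]])
      (measurable, auto simp: indicator_def)
  have w_top: "w (space M) = part_int M U x"
    using cover by (simp add: w_def part_int_def Int_absorb1)
  have w_pos: "0 < w (space M)" using False int_nonneg[of x] w_top by simp
  define k where "k = v (space M) / w (space M)"
  obtain E where E: "E \<in> sets D" "0 < w E" "k * w E \<le> v E" "measure D E < e / 2"
  proof (rule concentrate_on_small_set[OF na' fin, of v w k "e / 2"])
    fix A B assume "A \<in> sets D" "B \<in> sets D" "A \<inter> B = {}"
    then have AB: "A \<in> sets M" "B \<in> sets M" "A \<inter> B = {}" by (auto simp: setsD)
    have ind: "indicator ((A \<union> B) \<inter> U) t = (indicator (A \<inter> U) t + indicator (B \<inter> U) t :: real)" for t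
      using AB by (auto simp: indicator_def)
    show "v (A \<union> B) = v A + v B" unfolding v_def
      using L_add[OF xE[OF AB(1)] xE[OF AB(2)]] by (simp add: ind distrib_left)
    show "w (A \<union> B) = w A + w B" unfolding w_def
      using iE[OF AB(1)] iE[OF AB(2)] by (simp add: ind distrib_left)
  next
    fix A assume "A \<in> sets D"
    then have A [measurable]: "A \<in> sets M" by (simp add: setsD)
    show "0 \<le> w A" unfolding w_def by (intro integral_nonneg_AE) auto
    show "v A = 0" if "w A = 0"
    proof -
      have "AE t in M. \<bar>x t\<bar> * indicator (A \<inter> U) t = 0"
        using that iE[OF A] unfolding w_def by (subst (asm) integral_nonneg_eq_0_iff_AE) auto
      then have "AE t in M. x t * indicator (A \<inter> U) t = 0"
        by eventually_elim auto
      then have "norm_of (\<lambda>t. x t * indicator (A \<inter> U) t) = 0" by (rule norm_zero_AE[OF xE[OF A]])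
      then show ?thesis using L_bound[OF xE[OF A]] unfolding v_def by simp
    qed
  next
    show "0 < w (space D)" using w_pos by (simp add: setsD)
    show "k * w (space D) \<le> v (space D)" using w_pos by (simp add: setsD k_def)
    show "0 < e / 2" using e by simp
  qed blast
  have Em [measurable]: "E \<in> sets M" using E by (simp add: setsD)
  define c where "c = w (space M) / w E"
  have c: "0 < c" "c * w E = w (space M)" using E w_pos by (auto simp: c_def)
  define x' where "x' t = x t * indicator W t + c * (x t * indicator (E \<inter> U) t)" for t
  have x'V: "x' \<in> V" unfolding x'_def by (intro V_add V_cut V_scale x) auto
  have onU: "x' t = c * (x t * indicator E t)" if "t \<in> U" for t
    using that disj by (auto simp: x'_def indicator_def)
  have int_x': "part_int M U x' = part_int M U x"
  proof -
    have "part_int M U x' = (\<integral>t. c * (\<bar>x t\<bar> * indicator (E \<inter> U) t) \<partial>M)"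
      unfolding part_int_def
      by (intro Bochner_Integration.integral_cong refl) (use c onU in \<open>auto simp: indicator_def abs_mult\<close>)
    then show ?thesis using c by (simp add: w_def[symmetric] w_top)
  qed
  have L_ge: "L x \<le> L x'"
  proof -
    have "space M \<inter> U = U" using cover by auto
    then have "L x = L (\<lambda>t. x t * indicator W t) + v (space M)"
      unfolding v_def by (simp only:) (rule functional_parts[OF L_add L_bound x])
    also have "v (space M) = c * (k * w E)" using c w_pos by (simp add: k_def field_simps)
    also have "L (\<lambda>t. x t * indicator W t) + c * (k * w E) \<le> L (\<lambda>t. x t * indicator W t) + c * v E"
      using E c by (intro add_left_mono mult_left_mono) auto
    also have "\<dots> = L x'" unfolding x'_def v_def
      using L_add[OF V_cut[OF x W_sets] V_scale[OF xE[OF Em]]] L_scale[OF xE[OF Em]] by simp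
    finally show ?thesis .
  qed
  have igE: "integrable M (\<lambda>t. g t * indicator E t)"
    using integrable_mult_indicator[OF Em ig] by (simp add: mult.commute)
  have small: "(\<integral>t. g t * indicator E t \<partial>M) < e / 2"
  proof -
    have "emeasure D E = (\<integral>\<^sup>+t. ennreal (g t * indicator E t) \<partial>M)"
      unfolding D_def by (subst emeasure_density) (auto intro!: nn_integral_cong simp: indicator_def)
    also have "\<dots> = ennreal (\<integral>t. g t * indicator E t \<partial>M)"
      using igE g0 by (intro nn_integral_eq_integral) auto
    finally have "measure D E = (\<integral>t. g t * indicator E t \<partial>M)"
      using g0 by (simp add: measure_def integral_nonneg_AE)
    then show ?thesis using E by simp
  qed
  have "part_int M U x' + part_int M U z - 2 * (\<integral>t. g t * indicator E t \<partial>M) =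
    (\<integral>t. \<bar>x' t\<bar> * indicator U t + \<bar>z t\<bar> * indicator U t - 2 * (g t * indicator E t) \<partial>M)"
    unfolding part_int_def using V_integrable[OF x'V] V_integrable[OF z] igE by simp
  also have "\<dots> \<le> part_int M U (\<lambda>t. x' t + z t)"
    unfolding part_int_def
  proof (rule integral_mono)
    show "integrable M (\<lambda>t. \<bar>x' t\<bar> * indicator U t + \<bar>z t\<bar> * indicator U t - 2 * (g t * indicator E t))"
      using V_integrable[OF x'V] V_integrable[OF z] igE by simp
    show "integrable M (\<lambda>t. \<bar>x' t + z t\<bar> * indicator U t)" by (rule V_integrable[OF V_add[OF x'V z]])
    fix t
    show "\<bar>x' t\<bar> * indicator U t + \<bar>z t\<bar> * indicator U t - 2 * (g t * indicator E t) \<le> \<bar>x' t + z t\<bar> * indicator U t"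
    proof (cases "t \<in> U")
      case True
      show ?thesis
      proof (cases "t \<in> E")
        case True
        then show ?thesis using \<open>t \<in> U\<close> by (simp add: g_def)
      next
        case False
        then show ?thesis using \<open>t \<in> U\<close> onU by simp
      qed
    qed (simp add: g_def)
  qed
  finally have "part_int M U x + part_int M U z - e \<le> part_int M U (\<lambda>t. x' t + z t)"
    using small int_x' by simp
  moreover have "x' t = x t" if "t \<in> W" for t using that disj by (auto simp: x'_def indicator_def)
  ultimately show thesis using that[of x'] x'V int_x' L_ge by blast
qed

text \<open>On a subset of \<open>{|z| > s - e}\<close> where \<open>z\<close> has constant sign \<open>\<sigma>\<close>, the values of \<open>x\<close> are replaced by
  \<open>\<sigma> r\<close>. The change, as a function of the subset, is a vector of norm at most \<open>2 r\<close> depending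
  additively on it, so \<open>bounded_additive_small\<close> makes its image under \<open>L\<close> small. A null set \<open>W\<close>
  leaves no room for a change, hence \<open>r = 0\<close> in that case.\<close>

lemma modify_Linf_part:
  assumes L_add: "\<And>x x'. x \<in> V \<Longrightarrow> x' \<in> V \<Longrightarrow> L (\<lambda>t. x t + x' t) = L x + L x'"
    and L_scale: "\<And>x c. x \<in> V \<Longrightarrow> L (\<lambda>t. c * x t) = c * L x"
    and L_bound: "\<And>x. x \<in> V \<Longrightarrow> \<bar>L x\<bar> \<le> C * norm_of x"
    and x: "x \<in> V" and z: "z \<in> V" and e: "0 < (e::real)"
    and r: "part_sup M W x \<le> r" and W: "emeasure M W = 0 \<Longrightarrow> r = 0"
  obtains x' where "x' \<in> V" "\<And>t. t \<in> U \<Longrightarrow> x' t = x t" "part_sup M W x' \<le> r"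
    "\<bar>L x' - L x\<bar> \<le> e" "r + part_sup M W z - e \<le> part_sup M W (\<lambda>t. x' t + z t)"
proof (cases "emeasure M W = 0")
  case True
  have null: "AE t in M. t \<notin> W" using True by (intro AE_not_in) (auto simp: null_sets_def)
  then have "AE t in M. t \<in> W \<longrightarrow> \<bar>z t\<bar> \<le> 0" by eventually_elim auto
  then have "part_sup M W z \<le> 0" using sup_le_iff[OF z, of 0] by simp
  then show ?thesis using that[of x] x r W[OF True] e part_sup_nonneg[of M W "\<lambda>t. x t + z t"] by simp
next
  case False
  have r0: "0 \<le> r" using r part_sup_nonneg[of M W x] by simp
  note [measurable] = V_measurable[OF x] V_measurable[OF z]
  define s where "s = part_sup M W z"
  define D where "D = W \<inter> {t \<in> space M. s - e < \<bar>z t\<bar>}"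
  have Dm [measurable]: "D \<in> sets M" unfolding D_def by measurable
  have D_pos: "0 < emeasure M D"
  proof (cases "s - e < 0")
    case True
    then have "D = W" using cover by (auto simp: D_def intro: less_le_trans)
    then show ?thesis using False by (simp add: zero_less_iff_neq_zero)
  next
    case nonneg: False
    have "D = {t \<in> W. s - e < \<bar>z t\<bar>}" using cover by (auto simp: D_def)
    then show ?thesis using sup_positive_measure[OF z, of "s - e"] nonneg e by (simp add: s_def)
  qed
  define P where "P = D \<inter> {t \<in> space M. 0 \<le> z t}"
  have Pm [measurable]: "P \<in> sets M" unfolding P_def by measurable
  have "emeasure M D \<le> emeasure M P + emeasure M (D - P)"
    using emeasure_subadditive[of P M "D - P"] by (simp add: P_def Un_Diff_cancel Un_absorb1)
  then have "0 < emeasure M P \<or> 0 < emeasure M (D - P)" using D_pos by (auto simp: zero_less_iff_neq_zero)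
  then obtain F \<sigma> where F: "F \<in> sets M" "F \<subseteq> D" "0 < emeasure M F" "\<bar>\<sigma>\<bar> = (1::real)"
    "\<And>t. t \<in> F \<Longrightarrow> \<sigma> * z t = \<bar>z t\<bar>"
  proof
    assume "0 < emeasure M P"
    then show ?thesis using that[of P 1] by (auto simp: P_def)
  next
    assume "0 < emeasure M (D - P)"
    moreover have "- z t = \<bar>z t\<bar>" if "t \<in> D - P" for t using that cover by (auto simp: P_def D_def)
    ultimately show ?thesis using that[of "D - P" "-1"] by auto
  qed
  have FW: "F \<subseteq> W" using F by (auto simp: D_def)
  define u where "u E t = (\<sigma> * r - x t) * indicator (E \<inter> F) t" for E t
  have u_U: "u E t = 0" if "t \<in> U" for t E using that FW disj by (auto simp: u_def indicator_def)
  have uV: "u E \<in> V" and u_sup: "part_sup M W (u E) \<le> 2 * r" if [measurable]: "E \<in> sets M" for E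
  proof -
    note [measurable] = F(1)
    have [measurable]: "u E \<in> borel_measurable M" unfolding u_def by measurable
    have "AE t in M. t \<in> W \<longrightarrow> \<bar>x t\<bar> \<le> r" using sup_le_iff[OF x r0] r by simp
    then have ae: "AE t in M. t \<in> W \<longrightarrow> \<bar>u E t\<bar> \<le> 2 * r"
    proof eventually_elim
      case (elim t)
      have "\<bar>\<sigma> * r - x t\<bar> \<le> \<bar>\<sigma> * r\<bar> + \<bar>x t\<bar>" by (rule abs_triangle_ineq4)
      then show ?case using elim F(4) r0 by (auto simp: u_def indicator_def abs_mult)
    qed
    moreover have "integrable M (\<lambda>t. \<bar>u E t\<bar> * indicator U t)"
    proof -
      have "\<bar>u E t\<bar> * indicator U t = 0" for t using u_U[of t E] by (cases "t \<in> U") auto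
      then show ?thesis by (simp only: integrable_zero)
    qed
    ultimately show "u E \<in> V" unfolding V_iff by auto
    then show "part_sup M W (u E) \<le> 2 * r" using sup_le_iff[of "u E" "2 * r"] ae r0 by simp
  qed
  have u_int: "part_int M U (u E) = 0" for E
    using int_cong[of "u E" "\<lambda>t. 0"] u_U by (simp add: part_int_def)
  obtain E where E: "E \<in> sets M" "E \<subseteq> F" "0 < emeasure M E" "\<bar>L (u E)\<bar> \<le> e"
  proof (rule bounded_additive_small[OF na F(1,3), of "\<lambda>E. L (u E)" "\<bar>C\<bar> * (2 * r)" e])
    fix A B assume AB: "A \<in> sets M" "B \<in> sets M" "A \<inter> B = {}"
    have "u (A \<union> B) = (\<lambda>t. u A t + u B t)" using AB(3) by (auto simp: u_def indicator_def fun_eq_iff)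
    then show "L (u (A \<union> B)) = L (u A) + L (u B)" using L_add[OF uV uV] AB by simp
  next
    fix A assume A: "A \<in> sets M"
    have "\<bar>L (u A)\<bar> \<le> C * norm_of (u A)" by (rule L_bound[OF uV[OF A]])
    also have "\<dots> \<le> \<bar>C\<bar> * norm_of (u A)" using norm_nonneg[OF uV[OF A]] by (intro mult_right_mono) auto
    also have "\<dots> \<le> \<bar>C\<bar> * (2 * r)"
      using norm_le[OF uV[OF A]] u_sup[OF A] u_int[of A] by (intro mult_left_mono) auto
    finally show "\<bar>L (u A)\<bar> \<le> \<bar>C\<bar> * (2 * r)" .
  qed (use e in auto)
  define x' where "x' t = x t + u E t" for t
  have x'V: "x' \<in> V" unfolding x'_def by (intro V_add x uV E)
  have onE: "x' t = \<sigma> * r" if "t \<in> E" for t using that E(2) by (auto simp: x'_def u_def)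
  have offE: "x' t = x t" if "t \<notin> E" for t using that by (auto simp: x'_def u_def)
  have "AE t in M. t \<in> W \<longrightarrow> \<bar>x t\<bar> \<le> r" using sup_le_iff[OF x r0] r by simp
  then have "AE t in M. t \<in> W \<longrightarrow> \<bar>x' t\<bar> \<le> r"
  proof eventually_elim
    case (elim t)
    then show ?case using onE[of t] offE[of t] F(4) r0 by (cases "t \<in> E") (auto simp: abs_mult)
  qed
  then have "part_sup M W x' \<le> r" using sup_le_iff[OF x'V r0] by simp
  moreover have "r + s - e \<le> part_sup M W (\<lambda>t. x' t + z t)"
  proof (rule sup_ge[OF V_add[OF x'V z], of E])
    fix t assume t: "t \<in> E"
    then have tF: "t \<in> F" using E by auto
    have ss: "\<sigma> * \<sigma> = 1" using F(4) by (auto simp: abs_if split: if_splits)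
    have "\<sigma> * (x' t + z t) = \<sigma> * \<sigma> * r + \<bar>z t\<bar>" using onE[OF t] F(5)[OF tF] by (simp add: distrib_left)
    also have "\<dots> = r + \<bar>z t\<bar>" using ss by simp
    finally have "\<sigma> * (x' t + z t) = r + \<bar>z t\<bar>" .
    moreover have "\<bar>\<sigma> * (x' t + z t)\<bar> = \<bar>x' t + z t\<bar>" using F(4) by (simp add: abs_mult)
    moreover have "s - e < \<bar>z t\<bar>" using tF F(2) by (auto simp: D_def)
    ultimately show "r + s - e \<le> \<bar>x' t + z t\<bar>" using r0 by linarith
  qed (use E FW in auto)
  moreover have "\<bar>L x' - L x\<bar> \<le> e" unfolding x'_def using L_add[OF x uV[OF E(1)]] E(4) by simp
  moreover have "x' t = x t" if "t \<in> U" for t using that E(2) FW disj offE by blast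
  ultimately show thesis using that[of x'] x'V by (simp add: s_def)
qed

text \<open>It suffices to act on the part where \<open>z\<close> attains its norm. On \<open>W\<close> the modulus 1 is admissible.
  On \<open>U\<close> the integral of \<open>x\<close> has first to be raised to 1 without lowering \<open>L\<close>: rescale the
  restriction of \<open>x\<close> to \<open>U\<close>, or that of \<open>z\<close> if \<open>x\<close> vanishes there, and adjust the sign.\<close>

lemma daugavet_max_norm:
  assumes norm: "\<And>x. x \<in> V \<Longrightarrow> norm_of x = max (part_int M U x) (part_sup M W x)"
  shows "daugavet space_of"
proof (rule daugavet_criterion)
  fix L :: "('a \<Rightarrow> real) \<Rightarrow> real" and C z x and e :: real
  assume L_add: "\<And>x x'. x \<in> V \<Longrightarrow> x' \<in> V \<Longrightarrow> L (\<lambda>t. x t + x' t) = L x + L x'"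
    and L_scale: "\<And>x c. x \<in> V \<Longrightarrow> L (\<lambda>t. c * x t) = c * L x"
    and L_bound: "\<And>x. x \<in> V \<Longrightarrow> \<bar>L x\<bar> \<le> C * norm_of x"
    and z: "z \<in> V" and x: "x \<in> V" and x1: "norm_of x = 1" and e: "0 < e"
  have int_x: "part_int M U x \<le> 1" and sup_x: "part_sup M W x \<le> 1" using norm[OF x] x1 by auto
  consider "part_int M U z \<le> part_sup M W z" "emeasure M W \<noteq> 0"
    | "part_sup M W z < part_int M U z" | "norm_of z = 0"
  proof (cases "emeasure M W = 0")
    case True
    have "AE t in M. t \<notin> W" using True by (intro AE_not_in) (auto simp: null_sets_def)
    then have "AE t in M. t \<in> W \<longrightarrow> \<bar>z t\<bar> \<le> 0" by eventually_elim auto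
    then have "part_sup M W z = 0" using sup_le_iff[OF z, of 0] part_sup_nonneg[of M W z] by simp
    then show ?thesis using that norm[OF z] int_nonneg[of z] by (cases "part_int M U z = 0") auto
  qed (use that in linarith)
  then show "\<exists>x'\<in>V. norm_of x' \<le> 1 \<and> L x - e \<le> L x' \<and> 1 + norm_of z - e \<le> norm_of (\<lambda>t. x' t + z t)"
  proof cases
    case 1
    obtain x' where x': "x' \<in> V" "\<And>t. t \<in> U \<Longrightarrow> x' t = x t" "part_sup M W x' \<le> 1"
      "\<bar>L x' - L x\<bar> \<le> e" "1 + part_sup M W z - e \<le> part_sup M W (\<lambda>t. x' t + z t)"
      by (rule modify_Linf_part[OF L_add L_scale L_bound x z e sup_x]) (use 1 in auto)
    have "part_int M U x' = part_int M U x" using x'(2) by (rule int_cong)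
    then have "norm_of x' \<le> 1" using x'(3) int_x norm[OF x'(1)] by simp
    moreover have "norm_of z = part_sup M W z" using norm[OF z] 1 by simp
    moreover have "part_sup M W (\<lambda>t. x' t + z t) \<le> norm_of (\<lambda>t. x' t + z t)"
      using norm[OF V_add[OF x'(1) z]] by simp
    ultimately show ?thesis using x' by (intro bexI[of _ x']) auto
  next
    case 2
    then have nz: "norm_of z = part_int M U z" "0 < part_int M U z"
      using norm[OF z] part_sup_nonneg[of M W z] by auto
    define b where "b = (if part_int M U x = 0 then z else x)"
    have bV: "b \<in> V" using x z by (simp add: b_def)
    have b_pos: "0 < part_int M U b" using nz int_nonneg[of x] by (auto simp: b_def)
    define w where "w = (\<lambda>t. b t * indicator U t)"
    have wV: "w \<in> V" unfolding w_def by (rule V_cut[OF bV U_sets])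
    define c where "c = (if L w < 0 then - 1 else 1) / part_int M U b"
    have c: "\<bar>c\<bar> * part_int M U b = 1" using b_pos by (simp add: c_def)
    define y where "y = (\<lambda>t. x t * indicator W t + c * w t)"
    have yV: "y \<in> V" unfolding y_def by (intro V_add V_cut V_scale x wV) simp
    have y_int: "part_int M U y = 1"
    proof -
      have "part_int M U y = (\<integral>t. \<bar>c\<bar> * (\<bar>b t\<bar> * indicator U t) \<partial>M)"
        unfolding part_int_def using disj
        by (intro Bochner_Integration.integral_cong refl) (auto simp: y_def w_def indicator_def abs_mult)
      then show ?thesis using c by (simp add: part_int_def)
    qed
    have y_W: "y t = x t" if "t \<in> W" for t using that disj by (auto simp: y_def w_def indicator_def)
    have L_cut: "L (\<lambda>t. x t * indicator U t) \<le> c * L w"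
    proof (cases "part_int M U x = 0")
      case True
      have "AE t in M. \<bar>x t\<bar> * indicator U t = 0"
        using True V_integrable[OF x] unfolding part_int_def
        by (subst (asm) integral_nonneg_eq_0_iff_AE) auto
      then have "AE t in M. x t * indicator U t = 0" by eventually_elim auto
      then have "norm_of (\<lambda>t. x t * indicator U t) = 0" by (rule norm_zero_AE[OF V_cut[OF x U_sets]])
      then have "L (\<lambda>t. x t * indicator U t) = 0" using L_bound[OF V_cut[OF x U_sets]] by simp
      moreover have "0 \<le> c * L w" using b_pos by (auto simp: c_def divide_nonneg_pos divide_nonpos_pos)
      ultimately show ?thesis by simp
    next
      case False
      then have bx: "b = x" by (simp add: b_def)
      then have "L (\<lambda>t. x t * indicator U t) = L w" by (simp add: w_def)
      also have "\<dots> \<le> \<bar>L w\<bar> * 1" by simp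
      also have "\<dots> \<le> \<bar>L w\<bar> * (1 / part_int M U x)"
        using int_x b_pos bx by (intro mult_left_mono) auto
      also have "\<dots> = c * L w" using bx by (auto simp: c_def)
      finally show ?thesis .
    qed
    have L_le: "L x \<le> L y"
    proof -
      have "L x = L (\<lambda>t. x t * indicator W t) + L (\<lambda>t. x t * indicator U t)"
        by (rule functional_parts[OF L_add L_bound x])
      also have "\<dots> \<le> L (\<lambda>t. x t * indicator W t) + c * L w" using L_cut by simp
      also have "\<dots> = L y" unfolding y_def
        using L_add[OF V_cut[OF x W_sets] V_scale[OF wV]] L_scale[OF wV] by simp
      finally show ?thesis .
    qed
    obtain x' where x': "x' \<in> V" "\<And>t. t \<in> W \<Longrightarrow> x' t = y t" "part_int M U x' = part_int M U y"
      "L y \<le> L x'" "part_int M U y + part_int M U z - e \<le> part_int M U (\<lambda>t. x' t + z t)"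
      by (rule concentrate_L1_part[OF L_add L_scale L_bound yV z e]) blast+
    have "part_sup M W x' = part_sup M W x" using x'(2) y_W by (intro sup_cong x'(1) x) simp
    then have "norm_of x' \<le> 1" using norm[OF x'(1)] sup_x x'(3) y_int by simp
    moreover have "part_int M U (\<lambda>t. x' t + z t) \<le> norm_of (\<lambda>t. x' t + z t)"
      using norm[OF V_add[OF x'(1) z]] by simp
    ultimately show ?thesis using x' y_int nz L_le e by (intro bexI[of _ x']) auto
  next
    case 3
    have "norm_of x \<le> norm_of (\<lambda>t. x t + z t) + norm_of (\<lambda>t. - 1 * z t)"
      using norm_triangle[OF V_add[OF x z] V_scale[OF z, of "- 1"]] by simp
    then show ?thesis using 3 x1 x e norm_scale[OF z, of "- 1"] by (intro bexI[of _ x]) auto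
  qed
qed

text \<open>Both parts are modified, neither of them increasing its share of the norm.\<close>

lemma daugavet_sum_norm:
  assumes norm: "\<And>x. x \<in> V \<Longrightarrow> norm_of x = part_sup M W x + part_int M U x"
  shows "daugavet space_of"
proof (rule daugavet_criterion)
  fix L :: "('a \<Rightarrow> real) \<Rightarrow> real" and C z x and e :: real
  assume L_add: "\<And>x x'. x \<in> V \<Longrightarrow> x' \<in> V \<Longrightarrow> L (\<lambda>t. x t + x' t) = L x + L x'"
    and L_scale: "\<And>x c. x \<in> V \<Longrightarrow> L (\<lambda>t. c * x t) = c * L x"
    and L_bound: "\<And>x. x \<in> V \<Longrightarrow> \<bar>L x\<bar> \<le> C * norm_of x"
    and z: "z \<in> V" and x: "x \<in> V" and x1: "norm_of x = 1" and e: "0 < e"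
  have W0: "part_sup M W x = 0" if "emeasure M W = 0"
  proof -
    have "AE t in M. t \<notin> W" using that by (intro AE_not_in) (auto simp: null_sets_def)
    then have "AE t in M. t \<in> W \<longrightarrow> \<bar>x t\<bar> \<le> 0" by eventually_elim auto
    then show ?thesis using sup_le_iff[OF x, of 0] part_sup_nonneg[of M W x] by simp
  qed
  have e2: "0 < e / 2" using e by simp
  obtain y where y: "y \<in> V" "\<And>t. t \<in> U \<Longrightarrow> y t = x t" "part_sup M W y \<le> part_sup M W x"
      "\<bar>L y - L x\<bar> \<le> e / 2" "part_sup M W x + part_sup M W z - e / 2 \<le> part_sup M W (\<lambda>t. y t + z t)"
    by (rule modify_Linf_part[OF L_add L_scale L_bound x z e2 order_refl W0]) blast+
  have y_int: "part_int M U y = part_int M U x" using y(2) by (rule int_cong)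
  obtain x' where x': "x' \<in> V" "\<And>t. t \<in> W \<Longrightarrow> x' t = y t" "part_int M U x' = part_int M U y"
      "L y \<le> L x'" "part_int M U y + part_int M U z - e / 2 \<le> part_int M U (\<lambda>t. x' t + z t)"
    by (rule concentrate_L1_part[OF L_add L_scale L_bound y(1) z e2]) blast+
  have s1: "part_sup M W x' = part_sup M W y" using x'(2) by (intro sup_cong x'(1) y(1))
  have s2: "part_sup M W (\<lambda>t. x' t + z t) = part_sup M W (\<lambda>t. y t + z t)"
    using x'(2) by (intro sup_cong V_add x'(1) y(1) z) simp
  have "norm_of x' \<le> 1" using norm[OF x'(1)] norm[OF x] x1 y(3) y_int x'(3) s1 by simp
  moreover have "L x - e \<le> L x'" using x'(4) y(4) e by linarith
  moreover have "1 + norm_of z - e \<le> norm_of (\<lambda>t. x' t + z t)"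
    using norm[OF V_add[OF x'(1) z]] norm[OF z] norm[OF x] x1 y(5) x'(5) s2 y_int by simp
  ultimately show "\<exists>x'\<in>V. norm_of x' \<le> 1 \<and> L x - e \<le> L x' \<and> 1 + norm_of z - e \<le> norm_of (\<lambda>t. x' t + z t)"
    using x'(1) by blast
qed

end


section \<open>Exponents with values one and infinity\<close>

text \<open>The two parts are parameters, because passing to the conjugate exponent exchanges them.\<close>

locale extreme_exponent = exponent M p
  for M :: "'a measure" and p :: "'a \<Rightarrow> ennreal" +
  fixes U W :: "'a set"
  assumes U_sets [measurable]: "U \<in> sets M" and W_sets [measurable]: "W \<in> sets M"
    and disj: "U \<inter> W = {}" and cover: "U \<union> W = space M"
    and on_U: "AE t in M. t \<in> U \<longrightarrow> p t = 1" and on_W: "AE t in M. t \<in> W \<longrightarrow> p t = \<infinity>"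
begin

lemma rho_extreme:
  assumes "AE t in M. t \<in> W \<longrightarrow> \<bar>x t\<bar> \<le> 1"
  shows "rho x = (\<integral>\<^sup>+t. ennreal (\<bar>x t\<bar> * indicator U t) \<partial>M)"
  unfolding rho_def
proof (rule nn_integral_cong_AE)
  show "AE t in M. nakano p t (ennreal \<bar>x t\<bar>) = ennreal (\<bar>x t\<bar> * indicator U t)"
    using assms on_U on_W AE_space
  proof eventually_elim
    case (elim t)
    show ?case
    proof (cases "t \<in> W")
      case True
      then show ?thesis using elim disj by (auto simp: nakano_infinite_exponent ennreal_le_1)
    next
      case False
      then have "t \<in> U" using elim(4) cover by auto
      then show ?thesis using elim by (simp add: nakano_finite_exponent)
    qed
  qed
qed

lemma rho_finite_bounded:
  assumes [measurable]: "x \<in> borel_measurable M" and fin: "rho x < \<infinity>"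
  shows "AE t in M. t \<in> W \<longrightarrow> \<bar>x t\<bar> \<le> 1"
proof -
  have "AE t in M. nakano p t (ennreal \<bar>x t\<bar>) \<noteq> \<infinity>"
    using fin unfolding rho_def by (intro nn_integral_PInf_AE) auto
  then show ?thesis using on_W
    by eventually_elim (auto simp: nakano_infinite_exponent ennreal_le_1 split: if_splits)
qed

lemma rho_finite_integrable:
  assumes [measurable]: "x \<in> borel_measurable M" and fin: "rho x < \<infinity>"
  shows "integrable M (\<lambda>t. \<bar>x t\<bar> * indicator U t)"
proof (rule integrableI_nonneg)
  show "(\<integral>\<^sup>+t. ennreal (\<bar>x t\<bar> * indicator U t) \<partial>M) < \<infinity>"
    using fin rho_extreme[OF rho_finite_bounded[OF assms]] by simp
qed auto

lemma rho_part_int: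
  assumes "AE t in M. t \<in> W \<longrightarrow> \<bar>x t\<bar> \<le> 1" "integrable M (\<lambda>t. \<bar>x t\<bar> * indicator U t)"
  shows "rho x = ennreal (part_int M U x)"
  unfolding rho_extreme[OF assms(1)] part_int_def
  using assms(2) by (intro nn_integral_eq_integral) auto

lemma part_int_scale: "part_int M U (\<lambda>t. c * x t) = \<bar>c\<bar> * part_int M U x"
  by (simp add: part_int_def abs_mult mult.assoc)

lemma modular_funs_extreme_iff:
  "(\<lambda>t. ereal (x t)) \<in> modular_funs M (nakano p) \<longleftrightarrow>
    x \<in> borel_measurable M \<and> integrable M (\<lambda>t. \<bar>x t\<bar> * indicator U t) \<and>
    (\<exists>c. AE t in M. t \<in> W \<longrightarrow> \<bar>x t\<bar> \<le> c)"
proof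
  assume "(\<lambda>t. ereal (x t)) \<in> modular_funs M (nakano p)"
  then obtain c where x [measurable]: "x \<in> borel_measurable M" and c: "0 < c" "rho (\<lambda>t. c * x t) < \<infinity>"
    unfolding modular_funs_real_iff by blast
  have cx: "(\<lambda>t. c * x t) \<in> borel_measurable M" by measurable
  have "integrable M (\<lambda>t. (1 / c) * (\<bar>c * x t\<bar> * indicator U t))"
    using rho_finite_integrable[OF cx c(2)] by (rule integrable_mult_right)
  moreover have "(\<lambda>t. (1 / c) * (\<bar>c * x t\<bar> * indicator U t)) = (\<lambda>t. \<bar>x t\<bar> * indicator U t)"
    using c by (auto simp: abs_mult)
  moreover have "AE t in M. t \<in> W \<longrightarrow> \<bar>x t\<bar> \<le> 1 / c"
    using rho_finite_bounded[OF cx c(2)]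
    by eventually_elim (use c in \<open>auto simp: abs_mult field_simps\<close>)
  ultimately show "x \<in> borel_measurable M \<and> integrable M (\<lambda>t. \<bar>x t\<bar> * indicator U t) \<and>
    (\<exists>c. AE t in M. t \<in> W \<longrightarrow> \<bar>x t\<bar> \<le> c)" using x by auto
next
  assume "x \<in> borel_measurable M \<and> integrable M (\<lambda>t. \<bar>x t\<bar> * indicator U t) \<and>
    (\<exists>c. AE t in M. t \<in> W \<longrightarrow> \<bar>x t\<bar> \<le> c)"
  then obtain k where x [measurable]: "x \<in> borel_measurable M" and i: "integrable M (\<lambda>t. \<bar>x t\<bar> * indicator U t)"
    and k: "AE t in M. t \<in> W \<longrightarrow> \<bar>x t\<bar> \<le> k" by blast
  define c where "c = 1 / (\<bar>k\<bar> + 1)"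
  have c: "0 < c" by (simp add: c_def)
  have "AE t in M. t \<in> W \<longrightarrow> \<bar>c * x t\<bar> \<le> 1"
    using k by eventually_elim (auto simp: c_def abs_mult divide_le_eq)
  moreover have "integrable M (\<lambda>t. \<bar>c * x t\<bar> * indicator U t)"
    using integrable_mult_right[OF i, of "\<bar>c\<bar>"] by (simp add: abs_mult mult.assoc)
  ultimately have "rho (\<lambda>t. c * x t) < \<infinity>" by (simp add: rho_part_int)
  then show "(\<lambda>t. ereal (x t)) \<in> modular_funs M (nakano p)"
    unfolding modular_funs_real_iff using x c by blast
qed

lemma lux_extreme:
  assumes x: "(\<lambda>t. ereal (x t)) \<in> modular_funs M (nakano p)"
  shows "lux x = max (part_int M U x) (part_sup M W x)"
proof -
  obtain b where xm [measurable]: "x \<in> borel_measurable M" and i: "integrable M (\<lambda>t. \<bar>x t\<bar> * indicator U t)"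
    and b: "AE t in M. t \<in> W \<longrightarrow> \<bar>x t\<bar> \<le> b" using x unfolding modular_funs_extreme_iff by blast
  note sup_iff = part_sup_le_iff[OF xm W_sets b]
  have part_c: "part_int M U (\<lambda>t. x t / c) = part_int M U x / c" if "0 < c" for c
    using part_int_scale[of "1 / c" x] that by simp
  have i_c: "integrable M (\<lambda>t. \<bar>x t / c\<bar> * indicator U t)" for c
    using integrable_mult_right[OF i, of "\<bar>1 / c\<bar>"] by (simp add: mult.assoc)
  show ?thesis
  proof (rule antisym)
    show "lux x \<le> max (part_int M U x) (part_sup M W x)"
    proof (rule field_le_epsilon)
      fix e :: real assume e: "0 < e"
      define c where "c = max (part_int M U x) (part_sup M W x) + e"
      have c: "0 < c" "part_int M U x \<le> c" "part_sup M W x \<le> c"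
        using e part_sup_nonneg[of M W x] by (auto simp: c_def)
      have "AE t in M. t \<in> W \<longrightarrow> \<bar>x t\<bar> \<le> c" using sup_iff[of c] c by simp
      then have "AE t in M. t \<in> W \<longrightarrow> \<bar>x t / c\<bar> \<le> 1"
        by eventually_elim (use c in \<open>auto simp: divide_le_eq\<close>)
      then have "rho (\<lambda>t. x t / c) = ennreal (part_int M U x / c)"
        using rho_part_int[OF _ i_c, of c] part_c[OF c(1)] by simp
      also have "\<dots> \<le> 1" using c by (simp add: ennreal_le_1)
      finally show "lux x \<le> max (part_int M U x) (part_sup M W x) + e"
        using c by (intro lux_le) (auto simp: c_def)
    qed
    show "max (part_int M U x) (part_sup M W x) \<le> lux x"
    proof (rule field_le_epsilon)
      fix e :: real assume e: "0 < e"
      define c where "c = lux x + e"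
      have c: "0 < c" "lux x < c" using e lux_nonneg[OF x] by (auto simp: c_def)
      have r: "rho (\<lambda>t. x t / c) \<le> 1" by (rule lux_less[OF x c(2)])
      have bd: "AE t in M. t \<in> W \<longrightarrow> \<bar>x t / c\<bar> \<le> 1"
        using r by (intro rho_finite_bounded) (auto intro: le_less_trans)
      then have "rho (\<lambda>t. x t / c) = ennreal (part_int M U x / c)"
        using rho_part_int[OF _ i_c, of c] part_c[OF c(1)] by simp
      then have "part_int M U x \<le> c" using r c by (simp add: ennreal_le_1 divide_le_eq)
      moreover have "AE t in M. t \<in> W \<longrightarrow> \<bar>x t\<bar> \<le> c"
        using bd by eventually_elim (use c in \<open>auto simp: divide_le_eq\<close>)
      then have "part_sup M W x \<le> c" using sup_iff[of c] c by simp
      ultimately show "max (part_int M U x) (part_sup M W x) \<le> lux x + e" by (simp add: c_def)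
    qed
  qed
qed

lemma daugavet_luxemburg:
  assumes "non_atomic M"
  shows "daugavet (nakano_space M p)"
proof -
  interpret F: normed_fun_space M "modular_funs M (nakano p)" "luxemburg_norm M (nakano p)"
    by (rule lux_space)
  have norm: "F.norm_of x = max (part_int M U x) (part_sup M W x)" if "x \<in> F.V" for x
    using lux_extreme[of x] that by (simp add: lux_norm_interp F.V_def)
  interpret F: mixed_fun_space M "modular_funs M (nakano p)" "luxemburg_norm M (nakano p)" U W
  proof
    fix x
    show "x \<in> F.V \<longleftrightarrow> x \<in> borel_measurable M \<and> integrable M (\<lambda>t. \<bar>x t\<bar> * indicator U t) \<and>
      (\<exists>c. AE t in M. t \<in> W \<longrightarrow> \<bar>x t\<bar> \<le> c)"
      using modular_funs_extreme_iff[of x] by (simp add: F.V_def)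
    show "x \<in> F.V \<Longrightarrow> F.norm_of x \<le> part_int M U x + part_sup M W x"
      using norm[of x] part_sup_nonneg[of M W x]
      by (simp add: part_int_def integral_nonneg_AE)
  qed (use assms U_sets W_sets disj cover in auto)
  show ?thesis unfolding nakano_space_def by (rule F.daugavet_max_norm[OF norm])
qed

end

locale sigma_finite_extreme_exponent = extreme_exponent M p U W + sigma_finite_exponent M p
  for M :: "'a measure" and p :: "'a \<Rightarrow> ennreal" and U W :: "'a set"
begin

lemma conj_extreme: "extreme_exponent M (conj_exp p) W U"
proof -
  interpret Q: exponent M "conj_exp p" by (rule conj_exponent)
  have "AE t in M. t \<in> U \<longrightarrow> conj_exp p t = \<infinity>"
    using on_U by eventually_elim (auto simp: conj_exp_def)
  moreover have "AE t in M. t \<in> W \<longrightarrow> conj_exp p t = 1"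
    using on_W by eventually_elim (auto simp: conj_exp_def)
  ultimately show ?thesis
    by unfold_locales (use U_sets W_sets disj cover in auto)
qed

lemma orl_extreme_le:
  assumes x: "(\<lambda>t. ereal (x t)) \<in> modular_funs M (nakano (conj_exp p))"
  shows "orl x \<le> part_int M W x + part_sup M U x"
proof -
  interpret Q: extreme_exponent M "conj_exp p" W U by (rule conj_extreme)
  obtain b where xm [measurable]: "x \<in> borel_measurable M" and i: "integrable M (\<lambda>t. \<bar>x t\<bar> * indicator W t)"
    and b: "AE t in M. t \<in> U \<longrightarrow> \<bar>x t\<bar> \<le> b" using x unfolding Q.modular_funs_extreme_iff by blast
  define s where "s = part_sup M U x"
  have s: "0 \<le> s" by (simp add: s_def part_sup_nonneg)
  have xs: "AE t in M. t \<in> U \<longrightarrow> \<bar>x t\<bar> \<le> s"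
    using part_sup_le_iff[OF xm U_sets b s] by (simp add: s_def)
  have J: "0 \<le> part_int M W x" by (simp add: part_int_def integral_nonneg_AE)
  have "osup x \<le> ennreal (part_int M W x + s)"
  proof (rule osup_least)
    fix g assume g [measurable]: "g \<in> borel_measurable M" and r: "rho g \<le> 1"
    have fin: "rho g < \<infinity>" using r by (auto intro: le_less_trans)
    have ig: "integrable M (\<lambda>t. \<bar>g t\<bar> * indicator U t)" by (rule rho_finite_integrable[OF g fin])
    note bd = rho_finite_bounded[OF g fin]
    have gU: "part_int M U g \<le> 1" using r rho_part_int[OF bd ig] by (simp add: ennreal_le_1)
    have iS: "integrable M (\<lambda>t. \<bar>x t\<bar> * indicator W t + s * (\<bar>g t\<bar> * indicator U t))"
      using i ig by simp
    have "(\<integral>\<^sup>+t. ennreal \<bar>x t * g t\<bar> \<partial>M) \<le>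
      (\<integral>\<^sup>+t. ennreal (\<bar>x t\<bar> * indicator W t + s * (\<bar>g t\<bar> * indicator U t)) \<partial>M)"
    proof (rule nn_integral_mono_AE, use bd xs AE_space in eventually_elim)
      case (elim t)
      show ?case
      proof (cases "t \<in> W")
        case True
        then have "\<bar>x t\<bar> * \<bar>g t\<bar> \<le> \<bar>x t\<bar>" using elim by (simp add: mult_left_le)
        then show ?thesis using True disj by (auto simp: abs_mult indicator_def intro!: ennreal_leI)
      next
        case False
        then have "t \<in> U" using elim cover by auto
        then have "\<bar>x t\<bar> * \<bar>g t\<bar> \<le> s * \<bar>g t\<bar>" using elim by (intro mult_right_mono) auto
        then show ?thesis using False \<open>t \<in> U\<close> by (auto simp: abs_mult indicator_def intro!: ennreal_leI)
      qed
    qed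
    also have "\<dots> = ennreal (\<integral>t. \<bar>x t\<bar> * indicator W t + s * (\<bar>g t\<bar> * indicator U t) \<partial>M)"
      using iS s by (intro nn_integral_eq_integral) auto
    also have "(\<integral>t. \<bar>x t\<bar> * indicator W t + s * (\<bar>g t\<bar> * indicator U t) \<partial>M) = part_int M W x + s * part_int M U g"
      using i ig by (simp add: part_int_def)
    also have "ennreal (part_int M W x + s * part_int M U g) \<le> ennreal (part_int M W x + s)"
      using gU s by (intro ennreal_leI add_left_mono) (simp add: mult_left_le)
    finally show "(\<integral>\<^sup>+t. ennreal \<bar>x t * g t\<bar> \<partial>M) \<le> ennreal (part_int M W x + s)" .
  qed
  then have "orl x \<le> part_int M W x + s"
    unfolding osup_orl[OF x] by (subst (asm) ennreal_le_iff) (use J s in auto)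
  then show ?thesis by (simp add: s_def)
qed

lemma orl_mixed_space:
  assumes "non_atomic M"
  shows "mixed_fun_space M (modular_funs M (nakano (conj_exp p))) (orlicz_norm M (nakano p)) W U"
proof -
  interpret Q: extreme_exponent M "conj_exp p" W U by (rule conj_extreme)
  interpret O: normed_fun_space M "modular_funs M (nakano (conj_exp p))" "orlicz_norm M (nakano p)"
    by (rule orl_space)
  show ?thesis
  proof
    fix x
    show "x \<in> O.V \<longleftrightarrow> x \<in> borel_measurable M \<and> integrable M (\<lambda>t. \<bar>x t\<bar> * indicator W t) \<and>
      (\<exists>c. AE t in M. t \<in> U \<longrightarrow> \<bar>x t\<bar> \<le> c)"
      using Q.modular_funs_extreme_iff[of x] by (simp add: O.V_def)
    show "x \<in> O.V \<Longrightarrow> O.norm_of x \<le> part_int M W x + part_sup M U x"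
      using orl_extreme_le[of x] by (simp add: orl_norm_interp O.V_def)
  qed (use assms U_sets W_sets disj cover in auto)
qed

text \<open>For the lower bound, test with the function that is 1 on \<open>W\<close> and the normalised indicator of a set
  of finite measure in \<open>{|x| > r}\<close> on \<open>U\<close>. Such a set exists because a
  set of positive measure has a part of strictly smaller positive, hence finite, measure.\<close>

lemma orl_extreme:
  assumes na: "non_atomic M" and x: "(\<lambda>t. ereal (x t)) \<in> modular_funs M (nakano (conj_exp p))"
  shows "orl x = part_sup M U x + part_int M W x"
proof (rule antisym)
  show "orl x \<le> part_sup M U x + part_int M W x" using orl_extreme_le[OF x] by simp
  interpret O: mixed_fun_space M "modular_funs M (nakano (conj_exp p))" "orlicz_norm M (nakano p)" W U
    by (rule orl_mixed_space[OF na])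
  have xV: "x \<in> O.V" using x by (simp add: O.V_def)
  note [measurable] = O.V_measurable[OF xV]
  have i: "integrable M (\<lambda>t. \<bar>x t\<bar> * indicator W t)" by (rule O.V_integrable[OF xV])
  have test: "r + part_int M W x \<le> orl x"
    if F [measurable]: "F \<in> sets M" and FU: "F \<subseteq> U" and m: "emeasure M F = ennreal m" "0 < m"
      and r: "0 \<le> r" "\<And>t. t \<in> F \<Longrightarrow> r \<le> \<bar>x t\<bar>" for F m r
  proof -
    define g where "g t = indicator F t / m + indicator W t" for t
    have gm [measurable]: "g \<in> borel_measurable M" unfolding g_def by measurable
    have iF: "integrable M (indicator F :: 'a \<Rightarrow> real)" using m by simp
    have mF: "measure M F = m" using m by (simp add: measure_def)
    have gU: "\<bar>g t\<bar> * indicator U t = indicator F t / m" for t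
      using FU disj m(2) by (auto simp: g_def indicator_def)
    have "rho g = ennreal (part_int M U g)"
    proof (rule rho_part_int)
      have "\<bar>g t\<bar> \<le> 1" if "t \<in> W" for t
        using that FU disj m(2) by (auto simp: g_def indicator_def)
      then show "AE t in M. t \<in> W \<longrightarrow> \<bar>g t\<bar> \<le> 1" by simp
      show "integrable M (\<lambda>t. \<bar>g t\<bar> * indicator U t)" unfolding gU using iF by simp
    qed
    also have "part_int M U g = 1" unfolding part_int_def gU using m(2) by (simp add: mF)
    finally have "rho g \<le> 1" by simp
    have iS: "integrable M (\<lambda>t. r * (indicator F t / m) + \<bar>x t\<bar> * indicator W t)"
      using i iF by simp
    have "ennreal (r + part_int M W x) = ennreal (\<integral>t. r * (indicator F t / m) + \<bar>x t\<bar> * indicator W t \<partial>M)"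
      using i iF m(2) by (simp add: part_int_def mF)
    also have "\<dots> = (\<integral>\<^sup>+t. ennreal (r * (indicator F t / m) + \<bar>x t\<bar> * indicator W t) \<partial>M)"
      using iS r m(2) by (intro nn_integral_eq_integral[symmetric]) auto
    also have "\<dots> \<le> (\<integral>\<^sup>+t. ennreal \<bar>x t * g t\<bar> \<partial>M)"
    proof (intro nn_integral_mono ennreal_leI)
      fix t
      have "r * (indicator F t / m) \<le> \<bar>x t\<bar> * (indicator F t / m)"
        using r(2)[of t] m(2) by (cases "t \<in> F") (auto intro: divide_right_mono)
      moreover have "\<bar>x t * g t\<bar> = \<bar>x t\<bar> * (indicator F t / m) + \<bar>x t\<bar> * indicator W t"
      proof -
        have "0 \<le> g t" using m(2) by (simp add: g_def)
        then show ?thesis by (simp add: abs_mult) (simp add: g_def distrib_left)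
      qed
      ultimately show "r * (indicator F t / m) + \<bar>x t\<bar> * indicator W t \<le> \<bar>x t * g t\<bar>" by simp
    qed
    also have "\<dots> \<le> osup x" by (rule osup_upper[OF gm \<open>rho g \<le> 1\<close>])
    finally show ?thesis unfolding osup_orl[OF x] using orl_nonneg[of x] by (simp add: ennreal_le_iff)
  qed
  have base: "part_int M W x \<le> orl x"
  proof -
    have zero: "\<bar>indicator W t\<bar> * indicator U t = (0::real)" for t using disj by (auto simp: indicator_def)
    have "rho (indicator W) = ennreal (part_int M U (indicator W))"
      by (intro rho_part_int) (simp_all only: zero integrable_zero, simp)
    also have "part_int M U (indicator W) = 0" unfolding part_int_def zero by simp
    finally have r: "rho (indicator W) \<le> 1" by simp
    have "ennreal (part_int M W x) = (\<integral>\<^sup>+t. ennreal (\<bar>x t\<bar> * indicator W t) \<partial>M)"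
      unfolding part_int_def using i by (intro nn_integral_eq_integral[symmetric]) auto
    also have "\<dots> = (\<integral>\<^sup>+t. ennreal \<bar>x t * indicator W t\<bar> \<partial>M)"
      by (intro nn_integral_cong) (simp add: abs_mult)
    also have "\<dots> \<le> osup x" using r by (intro osup_upper) auto
    finally show ?thesis unfolding osup_orl[OF x] using orl_nonneg[of x] by (simp add: ennreal_le_iff)
  qed
  show "part_sup M U x + part_int M W x \<le> orl x"
  proof (rule field_le_epsilon)
    fix e :: real assume e: "0 < e"
    show "part_sup M U x + part_int M W x \<le> orl x + e"
    proof (cases "part_sup M U x \<le> e")
      case True
      then show ?thesis using base by simp
    next
      case False
      define r where "r = part_sup M U x - e"
      have r: "0 \<le> r" "r < part_sup M U x" using False e by (auto simp: r_def)
      define E where "E = {t \<in> U. r < \<bar>x t\<bar>}"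
      have "E = U \<inter> {t \<in> space M. r < \<bar>x t\<bar>}" using cover by (auto simp: E_def)
      then have Em: "E \<in> sets M" by simp
      have "0 < emeasure M E" unfolding E_def by (rule O.sup_positive_measure[OF xV r(2,1)])
      then obtain F where F: "F \<in> sets M" "F \<subseteq> E" "0 < emeasure M F" "emeasure M F < emeasure M E"
        using na Em unfolding non_atomic_def by blast
      then have "emeasure M F < top" by (auto intro: less_le_trans)
      then have m: "emeasure M F = ennreal (measure M F)" by (simp add: emeasure_eq_ennreal_measure)
      then have "0 < measure M F" using F(3) by simp
      have "r + part_int M W x \<le> orl x"
        by (rule test[OF F(1) _ m \<open>0 < measure M F\<close> r(1)]) (use F(2) in \<open>auto simp: E_def\<close>)
      then show ?thesis by (simp add: r_def)
    qed
  qed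
qed

lemma daugavet_orlicz:
  assumes "non_atomic M"
  shows "daugavet (nakano_orlicz_space M (conj_exp p) p)"
proof -
  interpret O: mixed_fun_space M "modular_funs M (nakano (conj_exp p))" "orlicz_norm M (nakano p)" W U
    by (rule orl_mixed_space[OF assms])
  have norm: "O.norm_of x = part_sup M U x + part_int M W x" if "x \<in> O.V" for x
    using orl_extreme[OF assms, of x] that by (simp add: orl_norm_interp O.V_def)
  show ?thesis unfolding nakano_orlicz_space_def by (rule O.daugavet_sum_norm[OF norm])
qed

end


section \<open>Identification of the spaces\<close>

text \<open>Membership and norm depend only on the class of a function, and its values are finite almost
  everywhere. This is what makes the choice of representatives irrelevant.\<close>

definition ae_invariant :: "'a measure \<Rightarrow> ('a \<Rightarrow> ereal) set \<Rightarrow> (('a \<Rightarrow> ereal) \<Rightarrow> real) \<Rightarrow> bool" where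
  "ae_invariant M K N \<longleftrightarrow> (\<forall>f\<in>K. f \<in> borel_measurable M \<and> (AE t in M. \<bar>f t\<bar> \<noteq> \<infinity>) \<and>
     (\<forall>g\<in>borel_measurable M. (AE t in M. f t = g t) \<longrightarrow> g \<in> K \<and> N g = N f))"

lemma ae_invariantD:
  assumes "ae_invariant M K N" "f \<in> K"
  shows "f \<in> borel_measurable M" "AE t in M. \<bar>f t\<bar> \<noteq> \<infinity>"
    "g \<in> borel_measurable M \<Longrightarrow> AE t in M. f t = g t \<Longrightarrow> g \<in> K"
    "g \<in> borel_measurable M \<Longrightarrow> AE t in M. f t = g t \<Longrightarrow> N g = N f"
  using assms unfolding ae_invariant_def by blast+

lemma (in normed_fun_space) ae_invariant: "ae_invariant M K N"
  unfolding ae_invariant_def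
  by (intro ballI conjI impI) (rule K_measurable K_finite, assumption | erule (2) K_cong N_cong)+

lemma ae_invariant_L1:
  "ae_invariant M {f \<in> borel_measurable M. (\<integral>\<^sup>+t. e2ennreal \<bar>f t\<bar> \<partial>M) < \<infinity>}
     (\<lambda>f. enn2real (\<integral>\<^sup>+t. e2ennreal \<bar>f t\<bar> \<partial>M))"
  unfolding ae_invariant_def
proof (intro ballI conjI impI)
  fix f g :: "'a \<Rightarrow> ereal" assume "f \<in> {f \<in> borel_measurable M. (\<integral>\<^sup>+t. e2ennreal \<bar>f t\<bar> \<partial>M) < \<infinity>}"
  then have f [measurable]: "f \<in> borel_measurable M" and fin: "(\<integral>\<^sup>+t. e2ennreal \<bar>f t\<bar> \<partial>M) < \<infinity>" by auto
  show "f \<in> borel_measurable M" by fact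
  have "AE t in M. e2ennreal \<bar>f t\<bar> \<noteq> \<infinity>" using fin by (intro nn_integral_PInf_AE) auto
  then show "AE t in M. \<bar>f t\<bar> \<noteq> \<infinity>" by eventually_elim (auto simp: top_ennreal.rep_eq)
  assume g: "g \<in> borel_measurable M" and "AE t in M. f t = g t"
  then have eq: "(\<integral>\<^sup>+t. e2ennreal \<bar>g t\<bar> \<partial>M) = (\<integral>\<^sup>+t. e2ennreal \<bar>f t\<bar> \<partial>M)"
    by (intro nn_integral_cong_AE) auto
  show "g \<in> {f \<in> borel_measurable M. (\<integral>\<^sup>+t. e2ennreal \<bar>f t\<bar> \<partial>M) < \<infinity>}"
    and "enn2real (\<integral>\<^sup>+t. e2ennreal \<bar>g t\<bar> \<partial>M) = enn2real (\<integral>\<^sup>+t. e2ennreal \<bar>f t\<bar> \<partial>M)"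
    using g eq fin by auto
qed

lemma ae_invariant_Linf:
  "ae_invariant M {f \<in> borel_measurable M. esssup M (\<lambda>t. e2ennreal \<bar>f t\<bar>) < \<infinity>}
     (\<lambda>f. enn2real (esssup M (\<lambda>t. e2ennreal \<bar>f t\<bar>)))"
  unfolding ae_invariant_def
proof (intro ballI conjI impI)
  fix f g :: "'a \<Rightarrow> ereal" assume "f \<in> {f \<in> borel_measurable M. esssup M (\<lambda>t. e2ennreal \<bar>f t\<bar>) < \<infinity>}"
  then have f [measurable]: "f \<in> borel_measurable M" and fin: "esssup M (\<lambda>t. e2ennreal \<bar>f t\<bar>) < \<infinity>" by auto
  show "f \<in> borel_measurable M" by fact
  have "AE t in M. e2ennreal \<bar>f t\<bar> \<noteq> \<infinity>"
    using esssup_AE[of "\<lambda>t. e2ennreal \<bar>f t\<bar>" M] by eventually_elim (use fin in auto)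
  then show "AE t in M. \<bar>f t\<bar> \<noteq> \<infinity>" by eventually_elim (auto simp: top_ennreal.rep_eq)
  assume g [measurable]: "g \<in> borel_measurable M" and ae: "AE t in M. f t = g t"
  have eq: "esssup M (\<lambda>t. e2ennreal \<bar>g t\<bar>) = esssup M (\<lambda>t. e2ennreal \<bar>f t\<bar>)"
    using ae by (intro esssup_AE_cong) auto
  show "g \<in> {f \<in> borel_measurable M. esssup M (\<lambda>t. e2ennreal \<bar>f t\<bar>) < \<infinity>}"
    and "enn2real (esssup M (\<lambda>t. e2ennreal \<bar>g t\<bar>)) = enn2real (esssup M (\<lambda>t. e2ennreal \<bar>f t\<bar>))"
    using g eq fin by auto
qed

lemma rep_in:
  assumes inv: "ae_invariant M K N" and f: "f \<in> K"
  shows "rep (ae_class M f) \<in> K" "N (rep (ae_class M f)) = N f"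
proof -
  note r = rep_ae_class[OF ae_invariantD(1)[OF inv f]]
  show "rep (ae_class M f) \<in> K" "N (rep (ae_class M f)) = N f"
    using ae_invariantD(3,4)[OF inv f r] .
qed

lemma nrm_ae_class:
  "ae_invariant M K N \<Longrightarrow> f \<in> K \<Longrightarrow> nrm (fun_space M K N) (ae_class M f) = N f"
  using rep_in(2)[of M K N f] by (simp add: fun_space_def)

lemma AE_restrict_spaceI: "A \<in> sets M \<Longrightarrow> AE t in M. P t \<Longrightarrow> AE t in restrict_space M A. P t"
  by (subst AE_restrict_space_iff) auto

lemma ae_class_restrict_rep:
  assumes f: "f \<in> borel_measurable M" and A: "A \<in> sets M"
  shows "ae_class (restrict_space M A) (rep (ae_class M f)) = ae_class (restrict_space M A) f"
  using rep_ae_class[OF f] f A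
  by (subst ae_class_eq_iff) (auto intro!: measurable_restrict_space1 AE_restrict_spaceI)

lemma nrm_restr_pair:
  assumes f: "f \<in> borel_measurable M" and A: "A \<in> sets M"
    and inv1: "ae_invariant (restrict_space M (space M - A)) K1 N1" and f1: "f \<in> K1"
    and inv2: "ae_invariant (restrict_space M A) K2 N2" and f2: "f \<in> K2"
  shows "nrm (direct_sum h (fun_space (restrict_space M (space M - A)) K1 N1)
      (fun_space (restrict_space M A) K2 N2)) (restr_pair M A (ae_class M f)) = h (N1 f) (N2 f)"
  using nrm_ae_class[OF inv1 f1] nrm_ae_class[OF inv2 f2] A
  by (simp add: direct_sum_def restr_pair_def ae_class_restrict_rep[OF f])

text \<open>By invariance it is enough to compare real-valued functions. For surjectivity, two functions on
  complementary parts are glued; the glued function is measurable piece by piece.\<close>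

lemma equal_via_restr_pair:
  assumes A [measurable]: "A \<in> sets M"
    and inv: "ae_invariant M K N"
    and inv1: "ae_invariant (restrict_space M (space M - A)) K1 N1"
    and inv2: "ae_invariant (restrict_space M A) K2 N2"
    and memb: "\<And>x. x \<in> borel_measurable M \<Longrightarrow>
      (\<lambda>t. ereal (x t)) \<in> K \<longleftrightarrow> (\<lambda>t. ereal (x t)) \<in> K1 \<and> (\<lambda>t. ereal (x t)) \<in> K2"
    and norm: "\<And>x. (\<lambda>t. ereal (x t)) \<in> K \<Longrightarrow>
      N (\<lambda>t. ereal (x t)) = h (N1 (\<lambda>t. ereal (x t))) (N2 (\<lambda>t. ereal (x t)))"
  shows "equal_via (restr_pair M A) (fun_space M K N)
    (direct_sum h (fun_space (restrict_space M (space M - A)) K1 N1) (fun_space (restrict_space M A) K2 N2))"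
proof -
  let ?M1 = "restrict_space M (space M - A)" and ?M2 = "restrict_space M A"
  have B: "space M - A \<in> sets M" by simp
  have AE_iff: "(AE t in M. P t) \<longleftrightarrow> (AE t in ?M1. P t) \<and> (AE t in ?M2. P t)" for P
  proof
    show "(AE t in M. P t) \<Longrightarrow> (AE t in ?M1. P t) \<and> (AE t in ?M2. P t)"
      using AE_restrict_spaceI A B by blast
    assume "(AE t in ?M1. P t) \<and> (AE t in ?M2. P t)"
    then have "AE t in M. t \<in> space M - A \<longrightarrow> P t" "AE t in M. t \<in> A \<longrightarrow> P t"
      using A B by (auto simp: AE_restrict_space_iff)
    then show "AE t in M. P t" using AE_space by eventually_elim auto
  qed
  have real_version: "\<exists>x. x \<in> borel_measurable M \<and> (AE t in M. f t = ereal (x t))"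
    if [measurable]: "f \<in> borel_measurable M" and "AE t in M. \<bar>f t\<bar> \<noteq> \<infinity>" for f :: "'a \<Rightarrow> ereal"
    by (intro exI[of _ "\<lambda>t. real_of_ereal (f t)"] conjI, measurable)
      (use that(2) in eventually_elim, auto simp: ereal_real)
  have restr: "f \<in> borel_measurable ?M1" "f \<in> borel_measurable ?M2"
    if "f \<in> borel_measurable M" for f :: "'a \<Rightarrow> ereal"
    using that by (auto intro: measurable_restrict_space1)
  have K_imp: "f \<in> K1 \<and> f \<in> K2 \<and> N f = h (N1 f) (N2 f)" if f: "f \<in> K" for f
  proof -
    note fm = ae_invariantD(1)[OF inv f]
    obtain x where x: "x \<in> borel_measurable M" and eq: "AE t in M. f t = ereal (x t)"
      using real_version[OF fm ae_invariantD(2)[OF inv f]] by blast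
    have xm: "(\<lambda>t. ereal (x t)) \<in> borel_measurable M" using x by simp
    have xK: "(\<lambda>t. ereal (x t)) \<in> K" and Nx: "N (\<lambda>t. ereal (x t)) = N f"
      using ae_invariantD(3,4)[OF inv f xm eq] by auto
    have x12: "(\<lambda>t. ereal (x t)) \<in> K1" "(\<lambda>t. ereal (x t)) \<in> K2" using memb[OF x] xK by auto
    have "AE t in M. ereal (x t) = f t" using eq by eventually_elim simp
    then have e1: "AE t in ?M1. ereal (x t) = f t" and e2: "AE t in ?M2. ereal (x t) = f t"
      using AE_iff by auto
    show ?thesis
      using ae_invariantD(3,4)[OF inv1 x12(1) restr(1)[OF fm] e1]
        ae_invariantD(3,4)[OF inv2 x12(2) restr(2)[OF fm] e2] norm[OF xK] Nx by simp
  qed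
  have K_conv: "f \<in> K" if f1: "f \<in> K1" and f2: "f \<in> K2" and fm: "f \<in> borel_measurable M" for f
  proof -
    have "AE t in M. \<bar>f t\<bar> \<noteq> \<infinity>"
      using AE_iff ae_invariantD(2)[OF inv1 f1] ae_invariantD(2)[OF inv2 f2] by blast
    then obtain x where x: "x \<in> borel_measurable M" and eq: "AE t in M. f t = ereal (x t)"
      using real_version[OF fm] by blast
    have xm: "(\<lambda>t. ereal (x t)) \<in> borel_measurable M" using x by simp
    have "(\<lambda>t. ereal (x t)) \<in> K1" "(\<lambda>t. ereal (x t)) \<in> K2"
      using ae_invariantD(3)[OF inv1 f1 restr(1)[OF xm]] ae_invariantD(3)[OF inv2 f2 restr(2)[OF xm]] eq AE_iff
      by auto
    then have xK: "(\<lambda>t. ereal (x t)) \<in> K" using memb[OF x] by simp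
    have "AE t in M. ereal (x t) = f t" using eq by eventually_elim simp
    then show ?thesis using ae_invariantD(3)[OF inv xK fm] by simp
  qed
  have pair: "restr_pair M A (ae_class M f) = (ae_class ?M1 f, ae_class ?M2 f)" if "f \<in> K" for f
    using ae_class_restrict_rep[OF ae_invariantD(1)[OF inv that]] A B by (simp add: restr_pair_def)
  show ?thesis
    unfolding equal_via_def
  proof (intro conjI ballI)
    fix F assume "F \<in> elems (fun_space M K N)"
    then obtain f where f: "f \<in> K" "F = ae_class M f" by (auto simp: fun_space_def)
    show "nrm (direct_sum h (fun_space ?M1 K1 N1) (fun_space ?M2 K2 N2)) (restr_pair M A F) = nrm (fun_space M K N) F"
      using nrm_restr_pair[OF ae_invariantD(1)[OF inv f(1)] A inv1 _ inv2, of h] K_imp[OF f(1)]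
        nrm_ae_class[OF inv f(1)] f(2) by simp
  next
    show "bij_betw (restr_pair M A) (elems (fun_space M K N))
      (elems (direct_sum h (fun_space ?M1 K1 N1) (fun_space ?M2 K2 N2)))"
      unfolding bij_betw_def
    proof
      show "inj_on (restr_pair M A) (elems (fun_space M K N))"
      proof (rule inj_onI)
        fix F G assume "F \<in> elems (fun_space M K N)" "G \<in> elems (fun_space M K N)"
          and eq: "restr_pair M A F = restr_pair M A G"
        then obtain f g where f: "f \<in> K" "F = ae_class M f" and g: "g \<in> K" "G = ae_class M g"
          by (auto simp: fun_space_def)
        note fm = ae_invariantD(1)[OF inv f(1)] and gm = ae_invariantD(1)[OF inv g(1)]
        have "ae_class ?M1 f = ae_class ?M1 g" "ae_class ?M2 f = ae_class ?M2 g"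
          using eq pair f g by auto
        then have "AE t in M. f t = g t"
          unfolding AE_iff using ae_class_eq_iff restr[OF fm] restr[OF gm] by blast
        then show "F = G" using f g ae_class_eq_iff[OF fm gm] by simp
      qed
      show "restr_pair M A ` elems (fun_space M K N) =
        elems (direct_sum h (fun_space ?M1 K1 N1) (fun_space ?M2 K2 N2))"
      proof (intro equalityI subsetI)
        fix Z assume "Z \<in> restr_pair M A ` elems (fun_space M K N)"
        then obtain f where f: "f \<in> K" "Z = restr_pair M A (ae_class M f)" by (auto simp: fun_space_def)
        show "Z \<in> elems (direct_sum h (fun_space ?M1 K1 N1) (fun_space ?M2 K2 N2))"
          using K_imp[OF f(1)] pair[OF f(1)] f(2) by (auto simp: direct_sum_def fun_space_def)
      next
        fix Z assume "Z \<in> elems (direct_sum h (fun_space ?M1 K1 N1) (fun_space ?M2 K2 N2))"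
        then obtain f1 f2 where f1: "f1 \<in> K1" and f2: "f2 \<in> K2" and Z: "Z = (ae_class ?M1 f1, ae_class ?M2 f2)"
          by (auto simp: direct_sum_def fun_space_def)
        note m1 = ae_invariantD(1)[OF inv1 f1] and m2 = ae_invariantD(1)[OF inv2 f2]
        define f where "f t = (if t \<in> A then f2 t else f1 t)" for t
        have fm: "f \<in> borel_measurable M"
        proof -
          have "f \<in> borel_measurable ?M1"
            using m1 by (rule measurable_cong[THEN iffD1, rotated]) (auto simp: f_def space_restrict_space)
          moreover have "f \<in> borel_measurable ?M2"
            using m2 by (rule measurable_cong[THEN iffD1, rotated]) (auto simp: f_def space_restrict_space)
          ultimately have on_pieces: "f \<in> borel_measurable (restrict_space M X)" if "X \<in> {space M - A, A}" for X
            using that by blast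
          show ?thesis
            by (rule measurable_piecewise_restrict[of "{space M - A, A}"]) (auto intro: on_pieces)
        qed
        have e1: "AE t in ?M1. f1 t = f t" and e2: "AE t in ?M2. f2 t = f t"
          using A B by (auto simp: AE_restrict_space_iff f_def)
        have fK: "f \<in> K"
          using K_conv ae_invariantD(3)[OF inv1 f1 restr(1)[OF fm] e1]
            ae_invariantD(3)[OF inv2 f2 restr(2)[OF fm] e2] fm by blast
        have "Z = (ae_class ?M1 f, ae_class ?M2 f)"
          unfolding Z using ae_class_eq_iff[OF m1 restr(1)[OF fm]] ae_class_eq_iff[OF m2 restr(2)[OF fm]] e1 e2
          by simp
        then have "Z = restr_pair M A (ae_class M f)" using pair[OF fK] by simp
        moreover have "ae_class M f \<in> elems (fun_space M K N)" using fK by (simp add: fun_space_def)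
        ultimately show "Z \<in> restr_pair M A ` elems (fun_space M K N)" by blast
      qed
    qed
  qed
qed


lemma L1_restrict:
  assumes [measurable]: "x \<in> borel_measurable M" "U \<in> sets M"
  shows "(\<integral>\<^sup>+t. e2ennreal \<bar>ereal (x t)\<bar> \<partial>restrict_space M U) = (\<integral>\<^sup>+t. ennreal (\<bar>x t\<bar> * indicator U t) \<partial>M)"
  by (subst nn_integral_restrict_space) (auto intro!: nn_integral_cong simp: indicator_def)

lemma L1_restrict_finite_iff:
  assumes [measurable]: "x \<in> borel_measurable M" "U \<in> sets M"
  shows "(\<integral>\<^sup>+t. e2ennreal \<bar>ereal (x t)\<bar> \<partial>restrict_space M U) < \<infinity> \<longleftrightarrow> integrable M (\<lambda>t. \<bar>x t\<bar> * indicator U t)"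
  unfolding L1_restrict[OF assms] by (simp add: integrable_iff_bounded)

lemma L1_restrict_norm:
  assumes x: "x \<in> borel_measurable M" and U: "U \<in> sets M" and i: "integrable M (\<lambda>t. \<bar>x t\<bar> * indicator U t)"
  shows "enn2real (\<integral>\<^sup>+t. e2ennreal \<bar>ereal (x t)\<bar> \<partial>restrict_space M U) = part_int M U x"
  unfolding L1_restrict[OF x U] part_int_def using i by (subst nn_integral_eq_integral) (auto intro!: integral_nonneg_AE)

lemma Linf_restrict_finite_iff:
  assumes x: "x \<in> borel_measurable M" and W: "W \<in> sets M"
  shows "esssup (restrict_space M W) (\<lambda>t. e2ennreal \<bar>ereal (x t)\<bar>) < \<infinity> \<longleftrightarrow> (\<exists>c. AE t in M. t \<in> W \<longrightarrow> \<bar>x t\<bar> \<le> c)"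
proof
  assume fin: "esssup (restrict_space M W) (\<lambda>t. e2ennreal \<bar>ereal (x t)\<bar>) < \<infinity>"
  then obtain c where c: "esssup (restrict_space M W) (\<lambda>t. e2ennreal \<bar>ereal (x t)\<bar>) = ennreal c" "0 \<le> c"
    by (cases "esssup (restrict_space M W) (\<lambda>t. e2ennreal \<bar>ereal (x t)\<bar>)") auto
  then have "AE t in M. t \<in> W \<longrightarrow> \<bar>x t\<bar> \<le> c"
    using esssup_restrict_le_iff[OF x W c(2)] by simp
  then show "\<exists>c. AE t in M. t \<in> W \<longrightarrow> \<bar>x t\<bar> \<le> c" by blast
next
  assume "\<exists>c. AE t in M. t \<in> W \<longrightarrow> \<bar>x t\<bar> \<le> c"
  then obtain c where "AE t in M. t \<in> W \<longrightarrow> \<bar>x t\<bar> \<le> c" by blast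
  then have "AE t in M. t \<in> W \<longrightarrow> \<bar>x t\<bar> \<le> \<bar>c\<bar>" by eventually_elim auto
  then have "esssup (restrict_space M W) (\<lambda>t. e2ennreal \<bar>ereal (x t)\<bar>) \<le> ennreal \<bar>c\<bar>"
    using esssup_restrict_le_iff[OF x W, of "\<bar>c\<bar>"] by simp
  then show "esssup (restrict_space M W) (\<lambda>t. e2ennreal \<bar>ereal (x t)\<bar>) < \<infinity>"
    by (rule le_less_trans) simp
qed

lemma esssup_indicator:
  assumes [measurable]: "E \<in> sets M" and pos: "emeasure M E \<noteq> 0"
  shows "esssup M (\<lambda>t. e2ennreal \<bar>ereal (indicator E t)\<bar>) = 1"
proof (rule antisym)
  show "esssup M (\<lambda>t. e2ennreal \<bar>ereal (indicator E t)\<bar>) \<le> 1"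
  proof (rule esssup_I)
    show "(\<lambda>t. e2ennreal \<bar>ereal (indicator E t)\<bar>) \<in> borel_measurable M" by measurable
    show "AE t in M. e2ennreal \<bar>ereal (indicator E t)\<bar> \<le> 1" by (auto simp: indicator_def)
  qed
  show "1 \<le> esssup M (\<lambda>t. e2ennreal \<bar>ereal (indicator E t)\<bar>)"
  proof (rule ccontr)
    assume lt: "\<not> ?thesis"
    have "AE t in M. t \<notin> E"
      using esssup_AE[of "\<lambda>t. e2ennreal \<bar>ereal (indicator E t)\<bar>" M]
      by eventually_elim (use lt in \<open>auto simp: indicator_def split: if_splits\<close>)
    then have "emeasure M E = 0" using AE_iff_null_sets[of E M] by auto
    then show False using pos by simp
  qed
qed

context sigma_finite_exponent
begin

text \<open>Both identifications compare the explicit norms with the definitions of the summands; the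
  Orlicz norm uses the conjugate exponent, whose two parts are exchanged.\<close>

lemma equal_spaces_extreme:
  assumes na: "non_atomic M" and ext: "AE t in M. p t = 1 \<or> p t = \<infinity>"
  defines "A \<equiv> {t \<in> space M. p t = \<infinity>}"
  shows "daugavet (nakano_space M p)" "daugavet (nakano_orlicz_space M (conj_exp p) p)"
    "equal_via (restr_pair M A) (nakano_space M p)
      (sum_inf (L1_space (restrict_space M (space M - A))) (Linf_space (restrict_space M A)))"
    "equal_via (restr_pair M A) (nakano_orlicz_space M (conj_exp p) p)
      (sum_one (Linf_space (restrict_space M (space M - A))) (L1_space (restrict_space M A)))"
proof -
  have A [measurable]: "A \<in> sets M" unfolding A_def by measurable
  define U where "U = space M - A"
  have U [measurable]: "U \<in> sets M" unfolding U_def by measurable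
  interpret E: sigma_finite_extreme_exponent M p U A
  proof
    show "AE t in M. t \<in> U \<longrightarrow> p t = 1"
      using ext AE_space by eventually_elim (auto simp: U_def A_def)
    show "AE t in M. t \<in> A \<longrightarrow> p t = \<infinity>" by (auto simp: A_def)
  qed (use sets.sets_into_space[OF A] A U in \<open>auto simp: U_def\<close>)
  interpret Q: extreme_exponent M "conj_exp p" A U by (rule E.conj_extreme)
  interpret F: normed_fun_space M "modular_funs M (nakano p)" "luxemburg_norm M (nakano p)"
    by (rule lux_space)
  interpret O: normed_fun_space M "modular_funs M (nakano (conj_exp p))" "orlicz_norm M (nakano p)"
    by (rule orl_space)
  show "daugavet (nakano_space M p)" by (rule E.daugavet_luxemburg[OF na])
  show "daugavet (nakano_orlicz_space M (conj_exp p) p)" by (rule E.daugavet_orlicz[OF na])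
  have meas: "(\<lambda>t. ereal (x t)) \<in> borel_measurable (restrict_space M Z)" if "x \<in> borel_measurable M" for x Z
    using that by (intro measurable_restrict_space1) simp
  show "equal_via (restr_pair M A) (nakano_space M p)
      (sum_inf (L1_space (restrict_space M (space M - A))) (Linf_space (restrict_space M A)))"
    unfolding nakano_space_def sum_inf_def L1_space_def Linf_space_def
  proof (rule equal_via_restr_pair[OF A F.ae_invariant ae_invariant_L1 ae_invariant_Linf])
    fix x :: "'a \<Rightarrow> real" assume x: "x \<in> borel_measurable M"
    show "(\<lambda>t. ereal (x t)) \<in> modular_funs M (nakano p) \<longleftrightarrow>
      (\<lambda>t. ereal (x t)) \<in> {f \<in> borel_measurable (restrict_space M (space M - A)).
          (\<integral>\<^sup>+t. e2ennreal \<bar>f t\<bar> \<partial>restrict_space M (space M - A)) < \<infinity>} \<and>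
      (\<lambda>t. ereal (x t)) \<in> {f \<in> borel_measurable (restrict_space M A).
          esssup (restrict_space M A) (\<lambda>t. e2ennreal \<bar>f t\<bar>) < \<infinity>}"
      unfolding E.modular_funs_extreme_iff mem_Collect_eq L1_restrict_finite_iff[OF x U, unfolded U_def]
        Linf_restrict_finite_iff[OF x A]
      using x meas[OF x] by (simp add: U_def)
  next
    fix x :: "'a \<Rightarrow> real" assume x: "(\<lambda>t. ereal (x t)) \<in> modular_funs M (nakano p)"
    then have xm: "x \<in> borel_measurable M" and i: "integrable M (\<lambda>t. \<bar>x t\<bar> * indicator U t)"
      unfolding E.modular_funs_extreme_iff by auto
    show "luxemburg_norm M (nakano p) (\<lambda>t. ereal (x t)) =
      max (enn2real (\<integral>\<^sup>+t. e2ennreal \<bar>ereal (x t)\<bar> \<partial>restrict_space M (space M - A)))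
        (enn2real (esssup (restrict_space M A) (\<lambda>t. e2ennreal \<bar>ereal (x t)\<bar>)))"
      unfolding luxemburg_norm_real E.lux_extreme[OF x]
      using L1_restrict_norm[OF xm U i] by (simp add: U_def part_sup_def)
  qed
  show "equal_via (restr_pair M A) (nakano_orlicz_space M (conj_exp p) p)
      (sum_one (Linf_space (restrict_space M (space M - A))) (L1_space (restrict_space M A)))"
    unfolding nakano_orlicz_space_def sum_one_def L1_space_def Linf_space_def
  proof (rule equal_via_restr_pair[OF A O.ae_invariant ae_invariant_Linf ae_invariant_L1])
    fix x :: "'a \<Rightarrow> real" assume x: "x \<in> borel_measurable M"
    show "(\<lambda>t. ereal (x t)) \<in> modular_funs M (nakano (conj_exp p)) \<longleftrightarrow>
      (\<lambda>t. ereal (x t)) \<in> {f \<in> borel_measurable (restrict_space M (space M - A)).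
          esssup (restrict_space M (space M - A)) (\<lambda>t. e2ennreal \<bar>f t\<bar>) < \<infinity>} \<and>
      (\<lambda>t. ereal (x t)) \<in> {f \<in> borel_measurable (restrict_space M A).
          (\<integral>\<^sup>+t. e2ennreal \<bar>f t\<bar> \<partial>restrict_space M A) < \<infinity>}"
      unfolding Q.modular_funs_extreme_iff mem_Collect_eq L1_restrict_finite_iff[OF x A]
        Linf_restrict_finite_iff[OF x U, unfolded U_def]
      using x meas[OF x] by (auto simp: U_def)
  next
    fix x :: "'a \<Rightarrow> real" assume x: "(\<lambda>t. ereal (x t)) \<in> modular_funs M (nakano (conj_exp p))"
    then have xm: "x \<in> borel_measurable M" and i: "integrable M (\<lambda>t. \<bar>x t\<bar> * indicator A t)"
      unfolding Q.modular_funs_extreme_iff by auto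
    show "orlicz_norm M (nakano p) (\<lambda>t. ereal (x t)) =
      enn2real (esssup (restrict_space M (space M - A)) (\<lambda>t. e2ennreal \<bar>ereal (x t)\<bar>)) +
      enn2real (\<integral>\<^sup>+t. e2ennreal \<bar>ereal (x t)\<bar> \<partial>restrict_space M A)"
      unfolding orlicz_norm_real E.orl_extreme[OF na x]
      using L1_restrict_norm[OF xm A i] by (simp add: U_def part_sup_def)
  qed
qed

text \<open>On \<open>E\<close> the exponent lies between \<open>a > 1\<close> and \<open>b\<close>. Testing with \<open>2 \<chi>\<^sub>E\<close>, whose modular is at most
  one, gives Luxemburg norm at most 1/2 and Orlicz norm at least \<open>2 \<mu>(E)\<close>. Since \<open>4 u \<le> u\<^sup>p / p\<close> for
  \<open>u \<ge> K\<close>, the modular of \<open>\<chi>\<^sub>E / (2 \<mu>(E))\<close> exceeds one, so the Luxemburg norm is not \<open>\<mu>(E)\<close>, and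
  \<open>|g| \<le> K + |g|\<^sup>p / (4 p)\<close> on \<open>E\<close> gives Orlicz norm at most 1/2.\<close>

lemma indicator_norms:
  assumes na: "non_atomic M" and bad: "\<not> (AE t in M. p t = 1 \<or> p t = \<infinity>)"
  obtains E where "E \<in> sets M" "E \<subseteq> {t \<in> space M. p t \<noteq> \<infinity>}" "0 < measure M E" "emeasure M E = ennreal (measure M E)"
    "(\<lambda>t. ereal (indicator E t)) \<in> modular_funs M (nakano p)"
    "(\<lambda>t. ereal (indicator E t)) \<in> modular_funs M (nakano (conj_exp p))"
    "lux (indicator E) \<noteq> measure M E" "lux (indicator E) \<noteq> 1"
    "orl (indicator E) \<noteq> measure M E" "orl (indicator E) \<noteq> 1"
proof -
  obtain C a b where C [measurable]: "C \<in> sets M" and C2: "0 < emeasure M C" "emeasure M C < \<infinity>"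
    and ab: "1 < (a::real)" "a \<le> b"
    and pC: "\<And>t. t \<in> C \<Longrightarrow> ennreal a \<le> p t \<and> p t \<le> ennreal b"
    by (rule intermediate_exponent_set[OF bad]) blast
  obtain K where K: "2 \<le> K" and Kb: "\<And>u P. K \<le> u \<Longrightarrow> a \<le> P \<Longrightarrow> 4 * b \<le> u powr (P - 1)"
    by (rule powr_eventually_large[OF ab(1), of "4 * b"]) blast
  have large: "4 * u \<le> u powr P / P" if u: "K \<le> u" and P: "a \<le> P" "P \<le> b" for u P
  proof -
    have "4 * P * u \<le> u powr (P - 1) * u" using Kb[OF u P(1)] P K u by (intro mult_right_mono) auto
    also have "\<dots> = u powr P" using powr_add[of u "P - 1" 1] K u by simp
    finally show ?thesis using P ab by (simp add: field_simps)
  qed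
  \<comment> \<open>makes \<open>K m \<le> 1/4\<close> and \<open>2\<^sup>b m \<le> 1\<close> for \<open>m = \<mu>(E)\<close>\<close>
  define e where "e = min (1 / (4 * K)) (1 / 2 powr b)"
  have e: "0 < e" using K by (simp add: e_def)
  define D where "D = density M (indicator C)"
  have finC: "(\<integral>\<^sup>+t. indicator C t \<partial>M) < \<infinity>" using C2 by simp
  have naD: "non_atomic D" unfolding D_def by (rule non_atomic_density[OF na _ finC]) simp
  have finD: "finite_measure D"
    by (rule finite_measureI) (use C2 in \<open>simp add: D_def emeasure_density\<close>)
  have D_eq: "measure D B = measure M B" if "B \<in> sets M" "B \<subseteq> C" for B
  proof -
    have "emeasure D B = (\<integral>\<^sup>+t. indicator C t * indicator B t \<partial>M)" unfolding D_def
      using that by (subst emeasure_density) auto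
    also have "\<dots> = (\<integral>\<^sup>+t. indicator B t \<partial>M)"
      using that by (intro nn_integral_cong) (auto simp: indicator_def)
    finally have "emeasure D B = (\<integral>\<^sup>+t. indicator B t \<partial>M)" .
    then show ?thesis using that by (simp add: measure_def)
  qed
  have "0 < measure D C" using D_eq[OF C] C2 by (simp add: measure_def enn2real_positive_iff)
  then obtain E where "E \<in> sets D" "E \<subseteq> C" "0 < measure D E" "measure D E < e"
    using non_atomic_small_subset[OF naD finD _ _ e, of C] by (auto simp: D_def)
  then have E [measurable]: "E \<in> sets M" and EC: "E \<subseteq> C" and m0: "0 < measure M E" "measure M E < e"
    using D_eq by (auto simp: D_def)
  define m where "m = measure M E"
  have m: "0 < m" "m < 1 / (4 * K)" "m < 1 / 2 powr b" using m0 by (auto simp: m_def e_def)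
  have "emeasure M E \<le> emeasure M C" using EC by (intro emeasure_mono) auto
  then have "emeasure M E < top" using C2 by (auto intro: le_less_trans)
  then have em: "emeasure M E = ennreal m" by (simp add: m_def emeasure_eq_ennreal_measure)
  define P where "P t = enn2real (p t)" for t
  have P: "a \<le> P t" "P t \<le> b" "p t \<noteq> \<infinity>" if "t \<in> E" for t
    using enn2real_between[of a "p t" b] pC[of t] that EC ab by (auto simp: P_def)
  have nak: "nakano p t (ennreal u) = ennreal (u powr P t / P t)" if "t \<in> E" "0 \<le> u" for t u
    using P(3)[OF that(1)] that(2) by (simp add: nakano_finite_exponent P_def)
  let ?x = "indicator E :: 'a \<Rightarrow> real"
  have int_const: "(\<integral>\<^sup>+t. ennreal k * indicator E t \<partial>M) = ennreal (k * m)" if "0 \<le> k" for k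
    using that m(1) by (subst nn_integral_cmult_indicator) (auto simp: em ennreal_mult)
  have rho2: "rho (\<lambda>t. 2 * ?x t) \<le> 1"
  proof -
    have "rho (\<lambda>t. 2 * ?x t) \<le> (\<integral>\<^sup>+t. ennreal (2 powr b) * indicator E t \<partial>M)"
      unfolding rho_def
    proof (intro nn_integral_mono)
      fix t
      show "nakano p t (ennreal \<bar>2 * ?x t\<bar>) \<le> ennreal (2 powr b) * indicator E t"
      proof (cases "t \<in> E")
        case True
        have "2 powr P t / P t \<le> 2 powr P t / 1" using P[OF True] ab by (intro divide_left_mono) auto
        also have "\<dots> \<le> 2 powr b" using P[OF True] by simp
        finally show ?thesis using True nak[OF True, of 2] by (simp add: ennreal_leI)
      qed simp
    qed
    also have "\<dots> = ennreal (2 powr b * m)" by (rule int_const) simp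
    also have "\<dots> \<le> 1" using m(3) by (simp add: ennreal_le_1 field_simps)
    finally show ?thesis .
  qed
  have xp: "(\<lambda>t. ereal (?x t)) \<in> modular_funs M (nakano p)"
    unfolding modular_funs_real_iff using rho2 by (auto intro!: exI[of _ "2::real"] intro: le_less_trans)
  interpret Q: exponent M "conj_exp p" by (rule conj_exponent)
  have xq: "(\<lambda>t. ereal (?x t)) \<in> modular_funs M (nakano (conj_exp p))"
  proof -
    have "Q.rho ?x \<le> (\<integral>\<^sup>+t. indicator E t \<partial>M)" unfolding Q.rho_def
    proof (intro nn_integral_mono)
      fix t assume "t \<in> space M"
      then show "nakano (conj_exp p) t (ennreal \<bar>?x t\<bar>) \<le> indicator E t"
        using nakano_one_le[of "conj_exp p" t, OF Q.p_ge_1] by (auto simp: indicator_def)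
    qed
    also have "\<dots> < \<infinity>" by (simp add: em)
    finally show ?thesis unfolding Q.modular_funs_real_iff by (auto intro!: exI[of _ "1::real"])
  qed
  have "lux ?x \<noteq> m"
  proof
    assume eq: "lux ?x = m"
    define u where "u = 1 / (2 * m)"
    have u: "K \<le> u" "0 < u" using m K by (auto simp: u_def field_simps)
    have "ennreal (4 * u * m) = (\<integral>\<^sup>+t. ennreal (4 * u) * indicator E t \<partial>M)"
      using int_const[of "4 * u"] u by simp
    also have "\<dots> \<le> rho (\<lambda>t. ?x t / (2 * m))" unfolding rho_def
    proof (intro nn_integral_mono)
      fix t
      show "ennreal (4 * u) * indicator E t \<le> nakano p t (ennreal \<bar>?x t / (2 * m)\<bar>)"
      proof (cases "t \<in> E")
        case True
        then have "\<bar>?x t / (2 * m)\<bar> = u" using m(1) by (simp add: u_def)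
        then show ?thesis using True nak[OF True, of u] large[OF u(1) P(1,2)[OF True]] u
          by (simp add: ennreal_leI)
      qed simp
    qed
    also have "\<dots> \<le> 1" using m(1) eq by (intro lux_less xp) simp
    finally show False using m(1) by (simp add: u_def ennreal_le_1)
  qed
  moreover have "lux ?x \<le> 1 / 2" using rho2 by (intro lux_le) (auto simp: mult.commute)
  then have "lux ?x \<noteq> 1" by simp
  moreover have "orl ?x \<noteq> m"
  proof
    assume eq: "orl ?x = m"
    have "ennreal (2 * m) = (\<integral>\<^sup>+t. ennreal 2 * indicator E t \<partial>M)" using int_const[of 2] by simp
    also have "\<dots> = (\<integral>\<^sup>+t. ennreal \<bar>?x t * (2 * ?x t)\<bar> \<partial>M)"
      by (intro nn_integral_cong) (auto simp: indicator_def)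
    also have "\<dots> \<le> osup ?x" using rho2 by (intro osup_upper) auto
    also have "\<dots> = ennreal m" using osup_orl[OF xq] eq by simp
    finally show False using m(1) by (subst (asm) ennreal_le_iff) auto
  qed
  moreover have "orl ?x \<noteq> 1"
  proof -
    have "osup ?x \<le> ennreal (1 / 2)"
    proof (rule osup_least)
      fix g assume [measurable]: "g \<in> borel_measurable M" and g: "rho g \<le> 1"
      have "(\<integral>\<^sup>+t. ennreal \<bar>?x t * g t\<bar> \<partial>M) \<le>
        (\<integral>\<^sup>+t. ennreal K * indicator E t + ennreal (1 / 4) * nakano p t (ennreal \<bar>g t\<bar>) \<partial>M)"
      proof (intro nn_integral_mono)
        fix t
        show "ennreal \<bar>?x t * g t\<bar> \<le> ennreal K * indicator E t + ennreal (1 / 4) * nakano p t (ennreal \<bar>g t\<bar>)"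
        proof (cases "t \<in> E")
          case True
          have "\<bar>g t\<bar> \<le> K + (1 / 4) * (\<bar>g t\<bar> powr P t / P t)"
          proof (cases "\<bar>g t\<bar> \<le> K")
            case True
            have "0 \<le> (1 / 4) * (\<bar>g t\<bar> powr P t / P t)" using P[OF \<open>t \<in> E\<close>] ab by simp
            then show ?thesis using True by linarith
          next
            case False
            then show ?thesis using large[of "\<bar>g t\<bar>" "P t"] P[OF \<open>t \<in> E\<close>] K by simp
          qed
          then have "ennreal \<bar>g t\<bar> \<le> ennreal (K + (1 / 4) * (\<bar>g t\<bar> powr P t / P t))" by (rule ennreal_leI)
          also have "\<dots> = ennreal K + ennreal (1 / 4) * ennreal (\<bar>g t\<bar> powr P t / P t)"
            using K P[OF True] ab by (subst ennreal_plus) (auto simp: ennreal_mult'[symmetric])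
          finally show ?thesis using True nak[OF True, of "\<bar>g t\<bar>"] by simp
        qed simp
      qed
      also have "\<dots> = ennreal (K * m) + ennreal (1 / 4) * rho g"
        unfolding rho_def using int_const[of K] K by (subst nn_integral_add) (auto simp: nn_integral_cmult)
      also have "\<dots> \<le> ennreal (K * m) + ennreal (1 / 4) * 1" using g by (intro add_left_mono mult_left_mono) auto
      also have "\<dots> = ennreal (K * m + 1 / 4)" using K m(1) by (subst ennreal_plus) auto
      also have "\<dots> \<le> ennreal (1 / 2)" using m K by (intro ennreal_leI) (simp add: field_simps)
      finally show "(\<integral>\<^sup>+t. ennreal \<bar>?x t * g t\<bar> \<partial>M) \<le> ennreal (1 / 2)" .
    qed
    then have "ennreal (orl ?x) \<le> ennreal (1 / 2)" using osup_orl[OF xq] by simp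
    then have "orl ?x \<le> 1 / 2" by (subst (asm) ennreal_le_iff) auto
    then show ?thesis by simp
  qed
  moreover have "E \<subseteq> {t \<in> space M. p t \<noteq> \<infinity>}" using P(3) sets.sets_into_space[OF E] by auto
  ultimately show thesis using that[of E] E m(1) em xp xq by (simp add: m_def)
qed

lemma not_equal_spaces:
  assumes na: "non_atomic M" and bad: "\<not> (AE t in M. p t = 1 \<or> p t = \<infinity>)"
  defines "A \<equiv> {t \<in> space M. p t = \<infinity>}"
  shows "\<not> equal_spaces (nakano_space M p) (L1_space M)"
    "\<not> equal_spaces (nakano_space M p) (Linf_space M)"
    "\<not> equal_via (restr_pair M A) (nakano_space M p)
      (sum_inf (L1_space (restrict_space M (space M - A))) (Linf_space (restrict_space M A)))"
    "\<not> equal_spaces (nakano_orlicz_space M (conj_exp p) p) (L1_space M)"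
    "\<not> equal_spaces (nakano_orlicz_space M (conj_exp p) p) (Linf_space M)"
    "\<not> equal_via (restr_pair M A) (nakano_orlicz_space M (conj_exp p) p)
      (sum_one (Linf_space (restrict_space M (space M - A))) (L1_space (restrict_space M A)))"
proof -
  obtain E where E [measurable]: "E \<in> sets M" and EA: "E \<subseteq> {t \<in> space M. p t \<noteq> \<infinity>}"
    and m: "0 < measure M E" "emeasure M E = ennreal (measure M E)"
    and xp: "(\<lambda>t. ereal (indicator E t)) \<in> modular_funs M (nakano p)"
    and xq: "(\<lambda>t. ereal (indicator E t)) \<in> modular_funs M (nakano (conj_exp p))"
    and lux: "lux (indicator E) \<noteq> measure M E" "lux (indicator E) \<noteq> 1"
    and orl: "orl (indicator E) \<noteq> measure M E" "orl (indicator E) \<noteq> 1"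
    by (rule indicator_norms[OF na bad])
  have A [measurable]: "A \<in> sets M" unfolding A_def by measurable
  have U [measurable]: "space M - A \<in> sets M" by measurable
  have EU: "E \<subseteq> space M - A" using EA by (auto simp: A_def)
  define f where "f = (\<lambda>t. ereal (indicator E t))"
  have fm: "f \<in> borel_measurable M" unfolding f_def by measurable
  have fr: "f \<in> borel_measurable (restrict_space M Z)" for Z
    using fm by (rule measurable_restrict_space1)
  define F where "F = ae_class M f"
  interpret F: normed_fun_space M "modular_funs M (nakano p)" "luxemburg_norm M (nakano p)"
    by (rule lux_space)
  interpret O: normed_fun_space M "modular_funs M (nakano (conj_exp p))" "orlicz_norm M (nakano p)"
    by (rule orl_space)
  have Lp: "F \<in> elems (nakano_space M p)" "nrm (nakano_space M p) F = lux (indicator E)"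
    using xp nrm_ae_class[OF F.ae_invariant xp] luxemburg_norm_real[of "indicator E"]
    by (auto simp: F_def f_def nakano_space_def fun_space_def)
  have Lq: "F \<in> elems (nakano_orlicz_space M (conj_exp p) p)"
      "nrm (nakano_orlicz_space M (conj_exp p) p) F = orl (indicator E)"
    using xq nrm_ae_class[OF O.ae_invariant xq] orlicz_norm_real[of "indicator E"]
    by (auto simp: F_def f_def nakano_orlicz_space_def fun_space_def)
  have int_E: "(\<integral>\<^sup>+t. e2ennreal \<bar>f t\<bar> \<partial>M) = ennreal (measure M E)"
  proof -
    have "(\<integral>\<^sup>+t. e2ennreal \<bar>f t\<bar> \<partial>M) = (\<integral>\<^sup>+t. indicator E t \<partial>M)"
      by (intro nn_integral_cong) (auto simp: f_def indicator_def)
    then show ?thesis using m by simp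
  qed
  have nrm_L1: "nrm (L1_space M) F = measure M E"
    unfolding L1_space_def F_def
    using fm int_E nrm_ae_class[OF ae_invariant_L1, of f M] by simp
  have sup_E: "esssup M (\<lambda>t. e2ennreal \<bar>f t\<bar>) = 1"
    unfolding f_def using m by (intro esssup_indicator) auto
  have nrm_Linf: "nrm (Linf_space M) F = 1"
    unfolding Linf_space_def F_def
    using fm sup_E nrm_ae_class[OF ae_invariant_Linf, of f M] by simp
  show "\<not> equal_spaces (nakano_space M p) (L1_space M)"
    using Lp lux nrm_L1 unfolding equal_spaces_def by metis
  show "\<not> equal_spaces (nakano_space M p) (Linf_space M)"
    using Lp lux nrm_Linf unfolding equal_spaces_def by metis
  show "\<not> equal_spaces (nakano_orlicz_space M (conj_exp p) p) (L1_space M)"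
    using Lq orl nrm_L1 unfolding equal_spaces_def by metis
  show "\<not> equal_spaces (nakano_orlicz_space M (conj_exp p) p) (Linf_space M)"
    using Lq orl nrm_Linf unfolding equal_spaces_def by metis
  have ind: "(indicator E :: 'a \<Rightarrow> real) \<in> borel_measurable M" by simp
  have int_U: "(\<integral>\<^sup>+t. e2ennreal \<bar>f t\<bar> \<partial>restrict_space M (space M - A)) = ennreal (measure M E)"
  proof -
    have "(\<integral>\<^sup>+t. e2ennreal \<bar>f t\<bar> \<partial>restrict_space M (space M - A)) = (\<integral>\<^sup>+t. indicator E t \<partial>M)"
      unfolding f_def L1_restrict[OF ind U]
      using EU by (intro nn_integral_cong) (auto simp: indicator_def)
    then show ?thesis using m by simp
  qed
  have int_A: "(\<integral>\<^sup>+t. e2ennreal \<bar>f t\<bar> \<partial>restrict_space M A) = 0"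
  proof -
    have "(\<integral>\<^sup>+t. e2ennreal \<bar>f t\<bar> \<partial>restrict_space M A) = (\<integral>\<^sup>+t. 0 \<partial>M)"
      unfolding f_def L1_restrict[OF ind A]
      using EU by (intro nn_integral_cong) (auto simp: indicator_def)
    then show ?thesis by simp
  qed
  have sup_A: "esssup (restrict_space M A) (\<lambda>t. e2ennreal \<bar>f t\<bar>) = 0"
  proof -
    have "AE t in M. t \<in> A \<longrightarrow> \<bar>indicator E t :: real\<bar> \<le> 0"
      using EU by (intro AE_I2) (auto simp: indicator_def)
    then show ?thesis using esssup_restrict_le_iff[OF ind A, of 0] by (simp add: f_def)
  qed
  have sup_U: "esssup (restrict_space M (space M - A)) (\<lambda>t. e2ennreal \<bar>f t\<bar>) = 1"
    unfolding f_def
  proof (rule esssup_indicator)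
    show "E \<in> sets (restrict_space M (space M - A))"
      using EU E U by (simp add: sets_restrict_space_iff)
    show "emeasure (restrict_space M (space M - A)) E \<noteq> 0"
      using EU U m by (subst emeasure_restrict_space) auto
  qed
  have "nrm (sum_inf (L1_space (restrict_space M (space M - A))) (Linf_space (restrict_space M A)))
      (restr_pair M A F) = max (measure M E) 0"
    unfolding sum_inf_def L1_space_def Linf_space_def F_def
    by (subst nrm_restr_pair[OF fm A ae_invariant_L1 _ ae_invariant_Linf]) (auto simp: fr int_U sup_A)
  then show "\<not> equal_via (restr_pair M A) (nakano_space M p)
      (sum_inf (L1_space (restrict_space M (space M - A))) (Linf_space (restrict_space M A)))"
    using Lp lux m(1) unfolding equal_via_def by (metis max.absorb1 less_imp_le)
  have "nrm (sum_one (Linf_space (restrict_space M (space M - A))) (L1_space (restrict_space M A)))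
      (restr_pair M A F) = 1 + 0"
    unfolding sum_one_def L1_space_def Linf_space_def F_def
    by (subst nrm_restr_pair[OF fm A ae_invariant_Linf _ ae_invariant_L1]) (auto simp: fr int_A sup_U)
  then show "\<not> equal_via (restr_pair M A) (nakano_orlicz_space M (conj_exp p) p)
      (sum_one (Linf_space (restrict_space M (space M - A))) (L1_space (restrict_space M A)))"
    using Lq orl unfolding equal_via_def by (metis add.right_neutral)
qed

end

text \<open>Nothing but its values outside a null set is known about the conjugate exponent. That
  suffices, since also for a function that is not measurable the integral ignores null sets.\<close>

lemma nakano_orlicz_space_cong:
  assumes "AE t in M. q t = q' t"
  shows "nakano_orlicz_space M q p = nakano_orlicz_space M q' p"
proof -
  have "modular M (nakano q) f = modular M (nakano q') f" for f
    unfolding modular_def by (rule nn_integral_cong_AE, use assms in eventually_elim) (simp add: nakano_def)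
  then show ?thesis by (simp add: nakano_orlicz_space_def modular_funs_def)
qed

theorem corollary4p16:
  fixes M :: "'a measure" and p q :: "'a \<Rightarrow> ennreal"
  assumes "sigma_finite_measure M"
    and "complete_measure M"
    and "non_atomic M"
    and "p \<in> borel_measurable M"
    and "\<forall>t\<in>space M. 1 \<le> p t"
    and "AE t in M. 1 / p t + 1 / q t = 1"
  shows
    "let Oinf = {t \<in> space M. p t = \<infinity>};
         Ofin = space M - Oinf;
         Lp = nakano_space M p;
         Lqo = nakano_orlicz_space M q p;
         i = daugavet Lp;
         ii = (equal_spaces Lp (L1_space M)
             \<or> equal_spaces Lp (Linf_space M)
             \<or> equal_via (restr_pair M Oinf) Lp
                 (sum_inf (L1_space (restrict_space M Ofin)) (Linf_space (restrict_space M Oinf))));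
         iii = (equal_spaces Lqo (Linf_space M)
             \<or> equal_spaces Lqo (L1_space M)
             \<or> equal_via (restr_pair M Oinf) Lqo
                 (sum_one (Linf_space (restrict_space M Ofin)) (L1_space (restrict_space M Oinf))));
         iv = daugavet Lqo
     in (i \<longleftrightarrow> ii) \<and> (ii \<longleftrightarrow> iii) \<and> (iii \<longleftrightarrow> iv)"
proof -
  interpret sigma_finite_measure M by fact
  interpret sigma_finite_exponent M p
    by unfold_locales (use assms(4,5) in auto)
  have "AE t in M. q t = conj_exp p t"
    using assms(6) AE_space by eventually_elim (rule conj_exp_unique, use assms(5) in auto)
  then have Lqo: "nakano_orlicz_space M q p = nakano_orlicz_space M (conj_exp p) p"
    by (rule nakano_orlicz_space_cong)
  show ?thesis
  proof (cases "AE t in M. p t = 1 \<or> p t = \<infinity>")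
    case True
    show ?thesis unfolding Let_def Lqo using equal_spaces_extreme[OF assms(3) True] by simp
  next
    case False
    show ?thesis unfolding Let_def Lqo
      using not_equal_spaces[OF assms(3) False] not_daugavet_luxemburg[OF False] not_daugavet_orlicz[OF False]
      by simp
  qed
qed

end
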